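(* Assume (H2) and let $x\in\mathcal C^{p\text{-var}}([a,b],\mathbb R^m)$, $0\le a<b$. For every $y_a\in\mathbb R^d$ the equation $y_t=y_a+\int_a^t[Ay_s+f(y_s)]\,ds+\int_a^t g(y_s)\,dx_s$, $t\in[a,b]$, has a unique solution $y$, and $$\|y\|_{\infty,[a,b]}\le\big[\|y_a\|+M_0N_{[a,b]}(x)\big]e^{\alpha N_{[a,b]}(x)+2L(b-a)},$$ $$\|y\|_{p\text{-var},[a,b]}\le\big[\|y_a\|+M_0N_{[a,b]}(x)\big]e^{\alpha N_{[a,b]}(x)+2L(b-a)}\,N_{[a,b]}(x)^{\frac{p-1}{p}}.$$
   Context: Fix $d,m\ge1$ and $p\in(1,2)$. For a path $x:[a,b]\to\mathbb R^r$: $\|x\|_{\infty,[a,b]}=\sup_{t\in[a,b]}\|x_t\|$ (Euclidean norm); $|||x|||_{p\text{-var},[a,b]}=\big(\sup_{\Pi}\sum_i\|x_{t_{i+1}}-x_{t_i}\|^p\big)^{1/p}$, the supremum over all finite partitions $a=t_0<\dots<t_n=b$; $\|x\|_{p\text{-var},[a,b]}=\|x_a\|+|||x|||_{p\text{-var},[a,b]}$; $\mathcal C^{p\text{-var}}$ denotes continuous paths with finite $p$-variation. Integrals against $dx$ are Young integrals. Here $A\in\mathbb R^{d\times d}$, $|A|$ is its operator norm. (H2): $f:\mathbb R^d\to\mathbb R^d$ and $g:\mathbb R^d\to\mathbb R^{d\times m}$ are globally Lipschitz with constants $C_f$ and $C_g>0$; $g\in C^1$ and $Dg$ is globally Lipschitz.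 Constants: $L=|A|+C_f$, $K=(1-2^{1-2/p})^{-1}$, $\alpha=\log\big(1+\frac1{K+1}\big)$, $M_0=\frac{\|f(0)\|}{L}+\frac{\|g(0)\|}{(K+1)C_g}$. Greedy times: with $\gamma=\frac{1}{2(K+1)C_g}$, set $\tau_0=a$, $\tau_{k+1}=\inf\{t>\tau_k:|||x|||_{p\text{-var},[\tau_k,t]}=\gamma\}\wedge b$ (with $\inf\emptyset=\infty$), and $N_{[a,b]}(x)=\min\{k\ge1:\tau_k=b\}$. *)

theory Defs
  imports "HOL-Analysis.Analysis"
begin

definition partitions :: "real \<Rightarrow> real \<Rightarrow> (nat \<times> (nat \<Rightarrow> real)) set" where
  "partitions a b = {(n, t). t 0 = a \<and> t n = b \<and> (\<forall>i<n. t i < t (Suc i))}"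

definition variation_sum :: "(real \<Rightarrow> 'a::real_normed_vector) \<Rightarrow> real \<Rightarrow> nat \<times> (nat \<Rightarrow> real) \<Rightarrow> real" where
  "variation_sum x p P = (\<Sum>i<fst P. norm (x (snd P (Suc i)) - x (snd P i)) powr p)"

definition finite_pvar :: "(real \<Rightarrow> 'a::real_normed_vector) \<Rightarrow> real \<Rightarrow> real \<Rightarrow> real \<Rightarrow> bool" where
  "finite_pvar x p a b = bdd_above (variation_sum x p ` partitions a b)"

definition pvar_seminorm :: "(real \<Rightarrow> 'a::real_normed_vector) \<Rightarrow> real \<Rightarrow> real \<Rightarrow> real \<Rightarrow> real" where
  "pvar_seminorm x p a b = (SUP P\<in>partitions a b. variation_sum x p P) powr (1 / p)"

definition pvar_norm :: "(real \<Rightarrow> 'a::real_normed_vector) \<Rightarrow> real \<Rightarrow> real \<Rightarrow> real \<Rightarrow> real" where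
  "pvar_norm x p a b = norm (x a) + pvar_seminorm x p a b"

definition sup_norm :: "(real \<Rightarrow> 'a::real_normed_vector) \<Rightarrow> real \<Rightarrow> real \<Rightarrow> real" where
  "sup_norm y a b = (SUP t\<in>{a..b}. norm (y t))"

definition opnorm :: "real^'n^'k \<Rightarrow> real" where
  "opnorm M = onorm (\<lambda>v. M *v v)"

definition young_sum :: "(real \<Rightarrow> real^'m^'d) \<Rightarrow> (real \<Rightarrow> real^'m) \<Rightarrow> nat \<times> (nat \<Rightarrow> real) \<Rightarrow> real^'d" where
  "young_sum G x P = (\<Sum>i<fst P. G (snd P i) *v (x (snd P (Suc i)) - x (snd P i)))"

definition has_young_integral ::
  "(real \<Rightarrow> real^'m^'d) \<Rightarrow> (real \<Rightarrow> real^'m) \<Rightarrow> real \<Rightarrow> real \<Rightarrow> real^'d \<Rightarrow> bool" where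
  "has_young_integral G x a b I \<longleftrightarrow>
     (\<forall>\<epsilon>>0. \<exists>\<delta>>0. \<forall>P\<in>partitions a b.
        (\<forall>i<fst P. snd P (Suc i) - snd P i < \<delta>) \<longrightarrow> norm (young_sum G x P - I) < \<epsilon>)"

definition is_solution ::
  "real^'d^'d \<Rightarrow> (real^'d \<Rightarrow> real^'d) \<Rightarrow> (real^'d \<Rightarrow> real^'m^'d) \<Rightarrow> (real \<Rightarrow> real^'m)
   \<Rightarrow> real \<Rightarrow> real \<Rightarrow> real \<Rightarrow> real^'d \<Rightarrow> (real \<Rightarrow> real^'d) \<Rightarrow> bool" where
  "is_solution A f g x p a b ya y \<longleftrightarrow>
     continuous_on {a..b} y \<and> finite_pvar y p a b \<and>
     (\<forall>t\<in>{a..b}. \<exists>I. has_young_integral (\<lambda>s. g (y s)) x a t I \<and>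
         y t = ya + integral {a..t} (\<lambda>s. A *v y s + f (y s)) + I)"

text \<open>Greedy times: tau_0 = a, tau_{k+1} = inf{t in (tau_k,b] : |||x|||_{p-var,[tau_k,t]} = gamma} /\ b,
  where inf of the empty set is +infinity (so the minimum with b is b).\<close>
primrec greedy_time :: "(real \<Rightarrow> 'a::real_normed_vector) \<Rightarrow> real \<Rightarrow> real \<Rightarrow> real \<Rightarrow> real \<Rightarrow> nat \<Rightarrow> real" where
  "greedy_time x p \<gamma> a b 0 = a"
| "greedy_time x p \<gamma> a b (Suc k) =
     (let S = {t. greedy_time x p \<gamma> a b k < t \<and> t \<le> b \<and>
                  pvar_seminorm x p (greedy_time x p \<gamma> a b k) t = \<gamma>}
      in if S = {} then b else min (Inf S) b)"

definition greedy_N :: "(real \<Rightarrow> 'a::real_normed_vector) \<Rightarrow> real \<Rightarrow> real \<Rightarrow> real \<Rightarrow> real \<Rightarrow> nat" where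
  "greedy_N x p \<gamma> a b = (LEAST k. 1 \<le> k \<and> greedy_time x p \<gamma> a b k = b)"

end

theory Submission
  imports Defs
begin

text \<open>The Young integral comes from the sewing lemma for \<open>G s *v (x t - x s)\<close>; its crude constant
  improves to \<open>K = 1 / (1 - 2 powr (1 - 2 / p))\<close> by repeated bisection with respect to the control
  \<open>(|||G||| |||x|||) powr (p / 2)\<close>. On an interval with \<open>|||x||| \<le> \<gamma>\<close> the integral term absorbs half of
  \<open>|||y|||\<close>, so that Gronwall's inequality for \<open>t \<mapsto> \<parallel>y s\<parallel> + |||y|||\<close> on \<open>[s, t]\<close> gives
  \<open>\<parallel>y s\<parallel> + |||y||| \<le> (exp \<alpha> * \<parallel>y s\<parallel> + M0) * exp (2 * L * (t - s))\<close>. Iterating over the greedy intervals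
  and adding up the seminorms by the triangle inequality \<open>|||y||| on [s, t] \<le> |||y||| on [s, u] + |||y||| on [u, t]\<close>
  bounds the whole norm without the factor \<open>N powr ((p - 1) / p) \<ge> 1\<close>. On intervals with small \<open>|||x|||\<close> the
  Picard map contracts differences of paths in the p-variation seminorm, which yields uniqueness and
  local solutions; the a priori bound makes the step size uniform, so these can be glued.\<close>

section \<open>Inequalities for powers\<close>

text \<open>The constants \<open>K\<close>, \<open>\<alpha>\<close>, \<open>M0\<close> and
  \<open>\<gamma>\<close> are prescribed, so no estimate may lose a factor. Bounds are therefore
  carried by functions \<open>\<phi> s t\<close> whose p-th power is superadditive: Minkowski's
  inequality keeps them closed under sums, and an increment bound by \<open>\<phi> u v\<close>
  becomes a bound of the seminorm by \<open>\<phi> s t\<close> with the same constants. For a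
  solution, the term g(y_u)(x_v - x_u) costs C_g |||x||| times sup |y|, where sup |y| is at most
  |y_s| + |||y|||, and the Young remainder costs K C_g |||x||| |||y|||. The factor of |||y||| is
  thus (K + 1) C_g \<gamma> = 1/2. Absorbing it doubles the rest: L becomes 2L, 2 C_g \<gamma> =
  1/(K + 1) produces exp \<alpha>, and 2 \<gamma> |g(0)| together with |f(0)|/L is M0. The
  difficulty with the sharp Young constant is that bisection needs some a priori bound in terms of
  the control being bisected, while sewing only gives one in terms of a larger, additive function. A
  small multiple of that function is added to the control and removed in the limit.\<close>

lemma convex_powr_Icc:
  fixes p :: real
  assumes "1 \<le> p" "0 \<le> x" "0 \<le> y" "0 \<le> l" "l \<le> 1"
  shows "((1 - l) * x + l * y) powr p \<le> (1 - l) * x powr p + l * y powr p"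
proof (cases "x = 0 \<or> y = 0 \<or> l = 0 \<or> l = 1")
  case True
  \<comment> \<open>When a summand or a weight vanishes, all that is needed is
    \<open>m powr p \<le> m\<close> for \<open>m\<close> in the unit interval.\<close>
  have *: "(m * z) powr p \<le> m * z powr p" if "0 \<le> m" "m \<le> 1" "0 \<le> z" for m z :: real
  proof -
    have "m powr p \<le> m"
      using that assms(1) powr_mono'[of 1 p m] by (cases "m = 0") auto
    then show ?thesis
      using that by (simp add: powr_mult mult_right_mono)
  qed
  show ?thesis
    using True *[of l y] *[of "1 - l" x] assms by auto
next
  case False
  then show ?thesis
    using convex_onD[OF powr_convex[OF assms(1)], of l x y] assms by auto
qed

text \<open>The triangle inequality of the p-norm in the plane for (a, c) and (b, d). Upper bounds
  \<open>u\<close> and \<open>v\<close> stand in for the two norms, so that superadditivity of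
  controls can be plugged in directly. After normalisation by \<open>u\<close> and \<open>v\<close>
  it is convexity of the p-th power.\<close>

lemma minkowski2:
  fixes a b c d p :: real
  assumes p: "1 \<le> p" and nn: "0 \<le> a" "0 \<le> b" "0 \<le> c" "0 \<le> d"
    and u: "a powr p + c powr p \<le> u powr p" "0 \<le> u"
    and v: "b powr p + d powr p \<le> v powr p" "0 \<le> v"
  shows "(a + b) powr p + (c + d) powr p \<le> (u + v) powr p"
proof -
  have z: "a = 0 \<and> c = 0" if "u = 0"
    using u that by (simp add: add_nonneg_eq_0_iff flip: powr_eq_0_iff) 
      (smt (verit) powr_ge_zero powr_eq_0_iff)
  have z': "b = 0 \<and> d = 0" if "v = 0"
    using v that by (simp add: add_nonneg_eq_0_iff flip: powr_eq_0_iff) 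
      (smt (verit) powr_ge_zero powr_eq_0_iff)
  show ?thesis
  proof (cases "u = 0 \<or> v = 0")
    case True
    then show ?thesis using z z' u v by auto
  next
    case False
    then have pos: "0 < u" "0 < v" using u v by auto
    \<comment> \<open>With this weight (e + h) / (u + v) is the convex combination of e / u and h /
      v.\<close>
    define l where "l = v / (u + v)"
    have l: "0 \<le> l" "l \<le> 1" "1 - l = u / (u + v)"
      using pos by (auto simp: l_def field_simps)
    have key: "(e + h) powr p \<le> (u + v) powr p * ((1 - l) * (e / u) powr p + l * (h / v) powr p)"
      if "0 \<le> e" "0 \<le> h" for e h :: real
    proof -
      have "e + h = (u + v) * ((1 - l) * (e / u) + l * (h / v))"
        unfolding l(3) using pos by (simp add: l_def distrib_left)
      then have "(e + h) powr p = (u + v) powr p * ((1 - l) * (e / u) + l * (h / v)) powr p"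
        using pos l that by (simp add: powr_mult)
      also have "\<dots> \<le> (u + v) powr p * ((1 - l) * (e / u) powr p + l * (h / v) powr p)"
        using convex_powr_Icc[OF p, of "e / u" "h / v" l] that pos l
        by (intro mult_left_mono) auto
      finally show ?thesis .
    qed
    have 1: "(a / u) powr p + (c / u) powr p \<le> 1"
      using u nn pos by (simp add: powr_divide flip: add_divide_distrib)
    have 2: "(b / v) powr p + (d / v) powr p \<le> 1"
      using v nn pos by (simp add: powr_divide flip: add_divide_distrib)
    have "(a + b) powr p + (c + d) powr p \<le>
       (u + v) powr p * ((1 - l) * ((a / u) powr p + (c / u) powr p)
          + l * ((b / v) powr p + (d / v) powr p))"
      using key[of a b] key[of c d] nn by (simp add: algebra_simps)
    also have "\<dots> \<le> (u + v) powr p * ((1 - l) * 1 + l * 1)"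
      using 1 2 l by (intro mult_left_mono add_mono) auto
    finally show ?thesis by simp
  qed
qed

lemma powr_add_le_powr_sum:
  fixes a b p :: real
  assumes "1 \<le> p" "0 \<le> a" "0 \<le> b"
  shows "a powr p + b powr p \<le> (a + b) powr p"
  using minkowski2[of p a 0 0 b a b] assms by simp

section \<open>Two-parameter controls\<close>

text \<open>The p-th power of \<open>\<phi>\<close> is what is usually called a control. Storing the
  root gives \<open>\<phi>\<close> the homogeneity of the p-variation seminorm, and closure under
  addition becomes Minkowski's inequality.\<close>

definition pcontrol :: "real \<Rightarrow> (real \<Rightarrow> real \<Rightarrow> real) \<Rightarrow> real \<Rightarrow> real \<Rightarrow> bool" where
  "pcontrol p \<phi> a b \<longleftrightarrow> (\<forall>s t. a \<le> s \<longrightarrow> s \<le> t \<longrightarrow> t \<le> b \<longrightarrow> 0 \<le> \<phi> s t) \<and>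
     (\<forall>s u t. a \<le> s \<longrightarrow> s \<le> u \<longrightarrow> u \<le> t \<longrightarrow> t \<le> b \<longrightarrow>
        \<phi> s u powr p + \<phi> u t powr p \<le> \<phi> s t powr p)"

lemma pcontrolI:
  assumes "\<And>s t. a \<le> s \<Longrightarrow> s \<le> t \<Longrightarrow> t \<le> b \<Longrightarrow> 0 \<le> \<phi> s t"
    "\<And>s u t. a \<le> s \<Longrightarrow> s \<le> u \<Longrightarrow> u \<le> t \<Longrightarrow> t \<le> b \<Longrightarrow>
        \<phi> s u powr p + \<phi> u t powr p \<le> \<phi> s t powr p"
  shows "pcontrol p \<phi> a b"
  using assms unfolding pcontrol_def by blast

lemma pcontrol_nonneg: "pcontrol p \<phi> a b \<Longrightarrow> a \<le> s \<Longrightarrow> s \<le> t \<Longrightarrow> t \<le> b \<Longrightarrow> 0 \<le> \<phi> s t"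
  unfolding pcontrol_def by blast

lemma pcontrol_super: "pcontrol p \<phi> a b \<Longrightarrow> a \<le> s \<Longrightarrow> s \<le> u \<Longrightarrow> u \<le> t \<Longrightarrow> t \<le> b \<Longrightarrow>
   \<phi> s u powr p + \<phi> u t powr p \<le> \<phi> s t powr p"
  unfolding pcontrol_def by blast

lemma pcontrol_subset: "pcontrol p \<phi> a b \<Longrightarrow> a \<le> a' \<Longrightarrow> b' \<le> b \<Longrightarrow> pcontrol p \<phi> a' b'"
  unfolding pcontrol_def by (meson order_trans)

lemma pcontrol_mono:
  assumes "pcontrol p \<phi> a b" "1 \<le> p" "a \<le> s" "s \<le> s'" "s' \<le> t'" "t' \<le> t" "t \<le> b"
  shows "\<phi> s' t' \<le> \<phi> s t"
proof -
  have "\<phi> s' t' powr p \<le> \<phi> s' t powr p"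
    using pcontrol_super[OF assms(1), of s' t' t] assms by (smt (verit) powr_ge_zero)
  also have "\<dots> \<le> \<phi> s t powr p"
    using pcontrol_super[OF assms(1), of s s' t] assms by (smt (verit) powr_ge_zero)
  finally show ?thesis
    using assms pcontrol_nonneg[OF assms(1), of s t] pcontrol_nonneg[OF assms(1), of s' t']
    by (smt (verit) powr_less_mono2)
qed

lemma pcontrol_diag:
  assumes "pcontrol p \<phi> a b" "a \<le> s" "s \<le> b"
  shows "\<phi> s s = 0"
  using pcontrol_super[OF assms(1), of s s s] assms
  by (simp add: add_nonneg_eq_0_iff)

lemma pcontrol_add:
  assumes "1 \<le> p" "pcontrol p \<phi> a b" "pcontrol p \<psi> a b"
  shows "pcontrol p (\<lambda>s t. \<phi> s t + \<psi> s t) a b"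
  using assms unfolding pcontrol_def by (auto intro!: minkowski2)

lemma pcontrol_cmult:
  assumes "0 \<le> c" "pcontrol p \<phi> a b"
  shows "pcontrol p (\<lambda>s t. c * \<phi> s t) a b"
  using assms unfolding pcontrol_def
  by (auto simp: powr_mult simp flip: distrib_left intro!: mult_left_mono)

text \<open>Expanding the product of the two superadditive sums only adds nonnegative cross
  terms.\<close>

lemma pcontrol_mult:
  assumes "pcontrol p \<phi> a b" "pcontrol p \<psi> a b"
  shows "pcontrol p (\<lambda>s t. \<phi> s t * \<psi> s t) a b"
proof (rule pcontrolI)
  fix s u t assume st: "a \<le> s" "s \<le> u" "u \<le> t" "t \<le> b"
  have "\<phi> s u powr p * \<psi> s u powr p + \<phi> u t powr p * \<psi> u t powr p
     \<le> (\<phi> s u powr p + \<phi> u t powr p) * (\<psi> s u powr p + \<psi> u t powr p)"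
    by (simp add: algebra_simps)
  also have "\<dots> \<le> \<phi> s t powr p * \<psi> s t powr p"
    using st assms by (intro mult_mono pcontrol_super) auto
  finally show "(\<phi> s u * \<psi> s u) powr p + (\<phi> u t * \<psi> u t) powr p \<le> (\<phi> s t * \<psi> s t) powr p"
    using st pcontrol_nonneg[OF assms(1), of s u] pcontrol_nonneg[OF assms(1), of u t] pcontrol_nonneg[OF assms(1), of s t]
    by (simp add: powr_mult)
next
  fix s t assume "a \<le> s" "s \<le> t" "t \<le> b"
  then show "0 \<le> \<phi> s t * \<psi> s t"
    using assms by (simp add: pcontrol_nonneg)
qed

text \<open>Lets the drift contribution, an increment of a monotone integral, be added to
  p-variation terms with constant 1.\<close>

lemma pcontrol_increment:
  assumes "1 \<le> p" "mono_on {a..b} H"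
  shows "pcontrol p (\<lambda>s t. H t - H s) a b"
proof (rule pcontrolI)
  fix s u t assume st: "a \<le> s" "s \<le> u" "u \<le> t" "t \<le> b"
  then have "H s \<le> H u" "H u \<le> H t"
    using assms(2) by (auto simp: monotone_on_def)
  then show "(H u - H s) powr p + (H t - H u) powr p \<le> (H t - H s) powr p"
    using powr_add_le_powr_sum[OF assms(1), of "H u - H s" "H t - H u"] by simp
qed (use assms in \<open>auto simp: monotone_on_def\<close>)

lemma seq_mono:
  fixes t :: "nat \<Rightarrow> real"
  assumes "\<And>i. i < n \<Longrightarrow> t i \<le> t (Suc i)" "i \<le> j" "j \<le> n"
  shows "t i \<le> t j"
  using assms(2,3)
proof (induction rule: dec_induct)
  case (step k)
  then show ?case using assms(1)[of k] by simp
qed simp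

lemma pcontrol_sum:
  assumes "pcontrol p \<phi> a b" "a \<le> t 0" "t n \<le> b" "\<And>i. i < n \<Longrightarrow> t i \<le> t (Suc i)"
  shows "(\<Sum>i<n. \<phi> (t i) (t (Suc i)) powr p) \<le> \<phi> (t 0) (t n) powr p"
  using assms(3,4)
proof (induction n)
  case (Suc n)
  have "t 0 \<le> t n" by (rule seq_mono[of n]) (use Suc in auto)
  then have "\<phi> (t 0) (t n) powr p + \<phi> (t n) (t (Suc n)) powr p \<le> \<phi> (t 0) (t (Suc n)) powr p"
    using Suc.prems assms(2) by (intro pcontrol_super[OF assms(1)]) auto
  then show ?case using Suc.IH Suc.prems(1) Suc.prems(2)[of n] Suc.prems(2) by fastforce
qed simp

section \<open>Paths of finite p-variation\<close>

lemma partition_strict: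
  assumes "P \<in> partitions a b" "i < j" "j \<le> fst P"
  shows "snd P i < snd P j"
proof -
  obtain n t where P: "P = (n, t)" by (cases P)
  have st: "\<And>i. i < n \<Longrightarrow> t i < t (Suc i)"
    using assms(1) by (auto simp: partitions_def P)
  have "t (Suc i) \<le> t j"
    by (rule seq_mono[of n t]) (use assms(2,3) in \<open>auto simp: P intro: less_imp_le st\<close>)
  then show ?thesis using st[of i] assms by (auto simp: P)
qed

lemma partition_range:
  assumes "P \<in> partitions a b" "i \<le> fst P"
  shows "snd P i \<in> {a..b}"
proof -
  have "snd P 0 = a" "snd P (fst P) = b"
    using assms(1) by (auto simp: partitions_def)
  then show ?thesis
    using partition_strict[OF assms(1), of 0 i] partition_strict[OF assms(1), of i "fst P"] assms(2)
    by (cases "i = 0"; cases "i = fst P") auto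
qed

lemma partition_le: "P \<in> partitions a b \<Longrightarrow> a \<le> b"
  using partition_range[of P a b 0] by auto

lemma trivial_partition:
  assumes "s \<le> t"
  obtains P where "P \<in> partitions s t" "\<And>x p. variation_sum x p P = norm (x t - x s) powr p"
proof (cases "s = t")
  case True
  then show ?thesis
    by (intro that[of "(0, \<lambda>_. s)"]) (auto simp: partitions_def variation_sum_def)
next
  case False
  then show ?thesis using assms
    by (intro that[of "(1, \<lambda>i. if i = 0 then s else t)"])
      (auto simp: partitions_def variation_sum_def)
qed

lemma partitions_nonempty: "s \<le> t \<Longrightarrow> partitions s t \<noteq> {}"
  by (metis trivial_partition empty_iff)

lemma sum_lessThan_add:
  fixes h :: "nat \<Rightarrow> 'a::comm_monoid_add"
  shows "sum h {..<n + m} = sum h {..<n} + (\<Sum>i<m. h (n + i))"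
  by (induction m) (auto simp: add.assoc)

lemma partitions_concat:
  assumes "P \<in> partitions s u" "Q \<in> partitions u t"
  obtains R where "R \<in> partitions s t"
    "\<And>x p. variation_sum x p R = variation_sum x p P + variation_sum x p Q"
proof -
  obtain n q where P: "P = (n, q)" by (cases P)
  obtain m r where Q: "Q = (m, r)" by (cases Q)
  define z where "z i = (if i \<le> n then q i else r (i - n))" for i
  have qr: "q 0 = s" "q n = u" "r 0 = u" "r m = t" "\<And>i. i < n \<Longrightarrow> q i < q (Suc i)"
    "\<And>i. i < m \<Longrightarrow> r i < r (Suc i)"
    using assms by (auto simp: partitions_def P Q)
  have z1: "z i = q i" if "i \<le> n" for i using that by (simp add: z_def)
  have z2: "z (n + i) = r i" for i using qr by (simp add: z_def)
  have "z i < z (Suc i)" if "i < n + m" for i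
  proof (cases "i < n")
    case False
    then obtain j where "i = n + j" using le_Suc_ex not_less by blast
    then show ?thesis using that qr(6)[of j] z2[of j] z2[of "Suc j"] by simp
  qed (use qr(5) z1 in auto)
  then have "(n + m, z) \<in> partitions s t"
    using z1[of 0] z2[of m] qr by (auto simp: partitions_def)
  moreover have "variation_sum x p (n + m, z) = variation_sum x p P + variation_sum x p Q"
    for x :: "real \<Rightarrow> 'b::real_normed_vector" and p
    unfolding variation_sum_def P Q
    using z2 z2[of "Suc _"] by (auto simp: sum_lessThan_add z1)
  ultimately show ?thesis using that by blast
qed

lemma variation_sum_nonneg: "0 \<le> variation_sum x p P"
  by (simp add: variation_sum_def sum_nonneg)

lemma finite_pvar_subset:
  assumes "finite_pvar x p a b" "a \<le> s" "s \<le> t" "t \<le> b"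
  shows "finite_pvar x p s t"
proof -
  obtain M where M: "\<And>P. P \<in> partitions a b \<Longrightarrow> variation_sum x p P \<le> M"
    using assms(1) by (auto simp: finite_pvar_def bdd_above_def)
  have "variation_sum x p P \<le> M" if P: "P \<in> partitions s t" for P
  proof -
    obtain Q where Q: "Q \<in> partitions a s" using partitions_nonempty[OF assms(2)] by auto
    obtain R where R: "R \<in> partitions t b" using partitions_nonempty[OF assms(4)] by auto
    obtain S where S: "S \<in> partitions s b" "variation_sum x p S = variation_sum x p P + variation_sum x p R"
      by (rule partitions_concat[OF P R]) blast
    obtain T where T: "T \<in> partitions a b" "variation_sum x p T = variation_sum x p Q + variation_sum x p S"
      by (rule partitions_concat[OF Q S(1)]) blast
    show ?thesis
      using M[OF T(1)] T(2) S(2) variation_sum_nonneg[of x p Q] variation_sum_nonneg[of x p R] by simp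
  qed
  then show ?thesis unfolding finite_pvar_def by (rule bdd_aboveI2)
qed

lemma pvar_seminorm_nonneg: "0 \<le> pvar_seminorm x p s t"
  by (simp add: pvar_seminorm_def)

lemma pvar_SUP_nonneg:
  assumes "finite_pvar x p s t" "s \<le> t"
  shows "0 \<le> (SUP P\<in>partitions s t. variation_sum x p P)"
proof -
  obtain P where "P \<in> partitions s t" using partitions_nonempty[OF assms(2)] by auto
  then show ?thesis
    using assms(1) variation_sum_nonneg[of x p P] by (auto simp: finite_pvar_def intro: cSUP_upper2)
qed

lemma pvar_seminorm_powr:
  assumes "finite_pvar x p s t" "s \<le> t" "0 < p"
  shows "pvar_seminorm x p s t powr p = (SUP P\<in>partitions s t. variation_sum x p P)"
  using pvar_SUP_nonneg[OF assms(1,2)] assms(3) by (simp add: pvar_seminorm_def powr_powr)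

lemma variation_sum_le:
  assumes "finite_pvar x p s t" "0 < p" "P \<in> partitions s t"
  shows "variation_sum x p P \<le> pvar_seminorm x p s t powr p"
  using assms partition_le[OF assms(3)] 
  by (auto simp: pvar_seminorm_powr finite_pvar_def intro: cSUP_upper)

lemma pvar_seminorm_least:
  assumes "\<And>P. P \<in> partitions s t \<Longrightarrow> variation_sum x p P \<le> B powr p" "s \<le> t" "0 < p" "0 \<le> B"
  shows "finite_pvar x p s t" "pvar_seminorm x p s t \<le> B"
proof -
  show f: "finite_pvar x p s t"
    unfolding finite_pvar_def using assms(1) by (rule bdd_aboveI2)
  have "(SUP P\<in>partitions s t. variation_sum x p P) \<le> B powr p"
    using assms partitions_nonempty by (intro cSUP_least) auto
  then have "pvar_seminorm x p s t powr p \<le> B powr p"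
    using pvar_seminorm_powr[OF f] assms by simp
  then show "pvar_seminorm x p s t \<le> B"
    using assms by (smt (verit) powr_less_mono2 pvar_seminorm_nonneg)
qed

lemma increment_le_pvar_seminorm:
  assumes "finite_pvar x p a b" "a \<le> s" "s \<le> t" "t \<le> b" "0 < p"
  shows "norm (x t - x s) \<le> pvar_seminorm x p s t"
proof -
  obtain P where P: "P \<in> partitions s t" "variation_sum x p P = norm (x t - x s) powr p"
    using trivial_partition[OF assms(3)] by metis
  have "norm (x t - x s) powr p \<le> pvar_seminorm x p s t powr p"
    using variation_sum_le[OF finite_pvar_subset[OF assms(1-4)] assms(5) P(1)] P(2) by simp
  then show ?thesis
    using assms by (smt (verit) powr_less_mono2 pvar_seminorm_nonneg)
qed

text \<open>Partitions of the two halves concatenate to one of the whole interval; the suprema over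
  the halves are then taken one after the other.\<close>

lemma pcontrol_pvar_seminorm:
  assumes "finite_pvar x p a b" "0 < p"
  shows "pcontrol p (pvar_seminorm x p) a b"
proof (rule pcontrolI)
  fix s u t assume st: "a \<le> s" "s \<le> u" "u \<le> t" "t \<le> b"
  have fin: "finite_pvar x p s u" "finite_pvar x p u t" "finite_pvar x p s t"
    using st by (auto intro: finite_pvar_subset[OF assms(1)])
  let ?R = "pvar_seminorm x p s t powr p"
  have PQ: "variation_sum x p P + variation_sum x p Q \<le> ?R"
    if "P \<in> partitions s u" "Q \<in> partitions u t" for P Q
    using partitions_concat[OF that] variation_sum_le[OF fin(3) assms(2)] by metis
  have "pvar_seminorm x p s u powr p \<le> ?R - variation_sum x p Q" if "Q \<in> partitions u t" for Q
    unfolding pvar_seminorm_powr[OF fin(1) st(2) assms(2)]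
    using PQ[OF _ that] partitions_nonempty[OF st(2)] by (intro cSUP_least) (auto simp: le_diff_eq)
  then have "pvar_seminorm x p u t powr p \<le> ?R - pvar_seminorm x p s u powr p"
    unfolding pvar_seminorm_powr[OF fin(2) st(3) assms(2)]
    using partitions_nonempty[OF st(3)] by (intro cSUP_least) (auto simp: algebra_simps)
  then show "pvar_seminorm x p s u powr p + pvar_seminorm x p u t powr p \<le> ?R" by simp
qed (simp add: pvar_seminorm_nonneg)

text \<open>The bridge from increments to seminorms: summing p-th powers over a partition collapses
  by superadditivity, so no constant is lost. The later bounds of solutions, Picard images and
  differences all go through it.\<close>

lemma pvar_seminorm_le_pcontrol:
  assumes "1 \<le> p" "s \<le> t" "pcontrol p \<phi> s t"
    and "\<And>u v. s \<le> u \<Longrightarrow> u \<le> v \<Longrightarrow> v \<le> t \<Longrightarrow> norm (y v - y u) \<le> \<phi> u v"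
  shows "finite_pvar y p s t" "pvar_seminorm y p s t \<le> \<phi> s t"
proof -
  have *: "variation_sum y p P \<le> \<phi> s t powr p" if P: "P \<in> partitions s t" for P
  proof -
    have r: "i \<le> fst P \<Longrightarrow> s \<le> snd P i \<and> snd P i \<le> t" for i
      using partition_range[OF P, of i] by auto
    have st: "i < fst P \<Longrightarrow> snd P i \<le> snd P (Suc i)" for i
      using partition_strict[OF P, of i "Suc i"] by auto
    have "variation_sum y p P \<le> (\<Sum>i<fst P. \<phi> (snd P i) (snd P (Suc i)) powr p)"
      unfolding variation_sum_def using assms(1) r st
      by (intro sum_mono powr_mono2 assms(4)) auto
    also have "\<dots> \<le> \<phi> (snd P 0) (snd P (fst P)) powr p"
      using r[of 0] r[of "fst P"] st by (intro pcontrol_sum[OF assms(3)]) auto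
    finally show ?thesis using P by (auto simp: partitions_def)
  qed
  show "finite_pvar y p s t" "pvar_seminorm y p s t \<le> \<phi> s t"
    using pvar_seminorm_least[OF *] assms pcontrol_nonneg[OF assms(3)] by auto
qed

text \<open>An increment over [v, r] splits at \<open>u\<close> into a part in each half, and
  Minkowski adds the two seminorms with constant 1, without the factor that Hoelder's inequality
  would introduce.\<close>

lemma pvar_seminorm_triangle:
  assumes "1 \<le> p" "s \<le> u" "u \<le> t" "finite_pvar x p s u" "finite_pvar x p u t"
  shows "finite_pvar x p s t"
    "pvar_seminorm x p s t \<le> pvar_seminorm x p s u + pvar_seminorm x p u t"
proof -
  \<comment> \<open>Clamping both arguments at \<open>u\<close> freezes each seminorm outside its
    own half and makes it a p-control on all of [s, t].\<close>
  let ?\<phi> = "\<lambda>v r. pvar_seminorm x p (min v u) (min r u)"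
  let ?\<psi> = "\<lambda>v r. pvar_seminorm x p (max v u) (max r u)"
  have "0 < p" using assms(1) by simp
  note pc = pcontrol_pvar_seminorm[OF assms(4) this] pcontrol_pvar_seminorm[OF assms(5) this]
  have "pcontrol p ?\<phi> s t"
  proof (rule pcontrolI)
    fix v w r assume "s \<le> v" "v \<le> w" "w \<le> r" "r \<le> t"
    then show "?\<phi> v w powr p + ?\<phi> w r powr p \<le> ?\<phi> v r powr p"
      using assms(2,3) by (intro pcontrol_super[OF pc(1)]) auto
  qed (simp add: pvar_seminorm_nonneg)
  moreover have "pcontrol p ?\<psi> s t"
  proof (rule pcontrolI)
    fix v w r assume "s \<le> v" "v \<le> w" "w \<le> r" "r \<le> t"
    then show "?\<psi> v w powr p + ?\<psi> w r powr p \<le> ?\<psi> v r powr p"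
      using assms(2,3) by (intro pcontrol_super[OF pc(2)]) auto
  qed (simp add: pvar_seminorm_nonneg)
  ultimately have pc: "pcontrol p (\<lambda>v r. ?\<phi> v r + ?\<psi> v r) s t"
    by (intro pcontrol_add assms)
  have inc: "norm (x r - x v) \<le> ?\<phi> v r + ?\<psi> v r" if vr: "s \<le> v" "v \<le> r" "r \<le> t" for v r
  proof -
    have "norm (x (min r u) - x (min v u)) \<le> ?\<phi> v r"
      by (rule increment_le_pvar_seminorm[OF assms(4)]) (use vr assms in auto)
    moreover have "norm (x (max r u) - x (max v u)) \<le> ?\<psi> v r"
      by (rule increment_le_pvar_seminorm[OF assms(5)]) (use vr assms in auto)
    moreover have "x r - x v = (x (min r u) - x (min v u)) + (x (max r u) - x (max v u))"
      using vr by (auto simp: min_def max_def)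
    ultimately show ?thesis
      using norm_triangle_ineq[of "x (min r u) - x (min v u)" "x (max r u) - x (max v u)"] by simp
  qed
  note * = pvar_seminorm_le_pcontrol[OF assms(1) order_trans[OF assms(2,3)] pc inc]
  show "finite_pvar x p s t" by (rule *)
  show "pvar_seminorm x p s t \<le> pvar_seminorm x p s u + pvar_seminorm x p u t"
    using *(2) assms by (simp add: min_def max_def split: if_splits)
qed

lemma pvar_seminorm_diag:
  assumes "0 < p"
  shows "finite_pvar x p s s" "pvar_seminorm x p s s = 0"
proof -
  have "variation_sum x p P \<le> 0 powr p" if P: "P \<in> partitions s s" for P
  proof -
    have "snd P 0 = s" "snd P (fst P) = s" using P by (auto simp: partitions_def)
    then have "fst P = 0" using partition_strict[OF P, of 0 "fst P"] by (cases "fst P") auto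
    then show ?thesis by (simp add: variation_sum_def)
  qed
  note * = pvar_seminorm_least[OF this order_refl assms order_refl]
  show "finite_pvar x p s s" by (rule *)
  show "pvar_seminorm x p s s = 0" using *(2)[of s] pvar_seminorm_nonneg[of x p s s] by simp
qed

section \<open>Continuity of the p-variation seminorm in its endpoints\<close>

lemma near_optimal_partition:
  assumes "finite_pvar x p s t" "s \<le> t" "0 < p" "0 < \<epsilon>"
  obtains P where "P \<in> partitions s t" "pvar_seminorm x p s t powr p < variation_sum x p P + \<epsilon>"
proof -
  have "(SUP P\<in>partitions s t. variation_sum x p P) - \<epsilon> < (SUP P\<in>partitions s t. variation_sum x p P)"
    using assms(4) by simp
  then obtain P where "P \<in> partitions s t" "(SUP P\<in>partitions s t. variation_sum x p P) - \<epsilon> < variation_sum x p P"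
    using less_cSUP_iff[OF partitions_nonempty[OF assms(2)]] assms(1)
    unfolding finite_pvar_def by blast
  then show ?thesis using that pvar_seminorm_powr[OF assms(1-3)] by simp
qed

lemma increment_powr_continuous:
  fixes x :: "real \<Rightarrow> 'a::real_normed_vector"
  assumes "continuous_on {a..b} x" "t \<in> {a..b}" "0 < \<epsilon>" "0 < (p::real)"
  obtains d where "0 < d" "\<And>t'. t' \<in> {a..b} \<Longrightarrow> \<bar>t' - t\<bar> < d \<Longrightarrow>
    norm (x t - c) powr p < norm (x t' - c) powr p + \<epsilon>"
proof -
  have "continuous_on {a..b} (\<lambda>r. norm (x r - c) powr p)"
    using assms by (intro continuous_on_powr' continuous_intros) auto
  then obtain d where "0 < d" "\<And>t'. t' \<in> {a..b} \<Longrightarrow> dist t' t < d \<Longrightarrow>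
    dist (norm (x t' - c) powr p) (norm (x t - c) powr p) < \<epsilon>"
    using assms(2,3) unfolding continuous_on_iff by blast
  then show ?thesis using that by (force simp: dist_real_def)
qed

text \<open>Move the endpoint of a nearly optimal partition slightly and use superadditivity.\<close>

lemma pvar_seminorm_small_left:
  assumes "continuous_on {a..b} x" "finite_pvar x p a b" "1 \<le> p" "t \<in> {a..b}" "0 < \<epsilon>"
  obtains d where "0 < d" "\<And>t'. a \<le> t' \<Longrightarrow> t - d < t' \<Longrightarrow> t' \<le> t \<Longrightarrow> pvar_seminorm x p t' t < \<epsilon>"
proof (cases "a = t")
  case True
  then show ?thesis using that[of 1] pvar_seminorm_diag(2)[of p x t] assms(3,5) by force
next
  case False
  then have at: "a < t" "t \<le> b" using assms(4) by auto
  \<comment> \<open>One half of \<open>\<epsilon> powr p\<close> pays for the partition not being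
    optimal, the other for moving its last point.\<close>
  define e where "e = \<epsilon> powr p / 2"
  have e: "0 < e" using assms(5) by (simp add: e_def)
  have fin: "finite_pvar x p a t" by (rule finite_pvar_subset[OF assms(2)]) (use at in auto)
  obtain P where P: "P \<in> partitions a t" "pvar_seminorm x p a t powr p < variation_sum x p P + e"
    using near_optimal_partition[OF fin _ _ e] assms(3) at by auto
  obtain n q where "P = (n, q)" by (cases P)
  moreover from this have "n \<noteq> 0" using P(1) at unfolding partitions_def by (cases n) auto
  ultimately obtain m where m: "P = (Suc m, q)" using not0_implies_Suc by blast
  have q: "q 0 = a" "q (Suc m) = t" "\<And>i. i < Suc m \<Longrightarrow> q i < q (Suc i)"
    using P(1) by (auto simp: partitions_def m)
  obtain d where d: "0 < d" "\<And>t'. t' \<in> {a..b} \<Longrightarrow> \<bar>t' - t\<bar> < d \<Longrightarrow>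
    norm (x t - x (q m)) powr p < norm (x t' - x (q m)) powr p + e"
    using increment_powr_continuous[OF assms(1,4) e, of p] assms(3) by (metis less_le_trans zero_less_one)
  show ?thesis
  \<comment> \<open>The bound \<open>t - q m\<close> keeps \<open>t'\<close> to the right of the
    penultimate point, so the modified sequence is still a strict partition.\<close>
  proof (rule that[of "min d (t - q m)"])
    show "0 < min d (t - q m)" using d q(2) q(3)[of m] by simp
    fix t' assume t': "a \<le> t'" "t - min d (t - q m) < t'" "t' \<le> t"
    define q' where "q' = q(Suc m := t')"
    have P': "(Suc m, q') \<in> partitions a t'"
      using q t' by (auto simp: partitions_def q'_def less_Suc_eq)
    have "variation_sum x p P = (\<Sum>i<m. norm (x (q (Suc i)) - x (q i)) powr p) + norm (x t - x (q m)) powr p"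
      by (simp add: variation_sum_def m q)
    moreover have "variation_sum x p (Suc m, q') = (\<Sum>i<m. norm (x (q (Suc i)) - x (q i)) powr p) + norm (x t' - x (q m)) powr p"
      by (simp add: variation_sum_def q'_def)
    moreover have "norm (x t - x (q m)) powr p < norm (x t' - x (q m)) powr p + e"
      using t' at by (intro d) auto
    moreover have "variation_sum x p (Suc m, q') \<le> pvar_seminorm x p a t' powr p"
      using t' at assms(3) by (intro variation_sum_le[OF finite_pvar_subset[OF assms(2)] _ P']) auto
    moreover have "pvar_seminorm x p a t' powr p + pvar_seminorm x p t' t powr p \<le> pvar_seminorm x p a t powr p"
      using t' at assms(3) by (intro pcontrol_super[OF pcontrol_pvar_seminorm[OF assms(2)]]) auto
    ultimately have "pvar_seminorm x p t' t powr p < \<epsilon> powr p"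
      using P(2) unfolding e_def by linarith
    then show "pvar_seminorm x p t' t < \<epsilon>"
      using assms(3,5) by (smt (verit) powr_mono2)
  qed
qed

lemma pvar_seminorm_small_right:
  assumes "continuous_on {a..b} x" "finite_pvar x p a b" "1 \<le> p" "t \<in> {a..b}" "0 < \<epsilon>"
  obtains d where "0 < d" "\<And>t'. t \<le> t' \<Longrightarrow> t' < t + d \<Longrightarrow> t' \<le> b \<Longrightarrow> pvar_seminorm x p t t' < \<epsilon>"
proof (cases "t = b")
  case True
  then show ?thesis using that[of 1] pvar_seminorm_diag(2)[of p x t] assms(3,5) by force
next
  case False
  then have at: "a \<le> t" "t < b" using assms(4) by auto
  define e where "e = \<epsilon> powr p / 2"
  have e: "0 < e" using assms(5) by (simp add: e_def)
  have fin: "finite_pvar x p t b" by (rule finite_pvar_subset[OF assms(2)]) (use at in auto)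
  obtain P where P: "P \<in> partitions t b" "pvar_seminorm x p t b powr p < variation_sum x p P + e"
    using near_optimal_partition[OF fin _ _ e] assms(3) at by auto
  obtain n q where "P = (n, q)" by (cases P)
  moreover from this have "n \<noteq> 0" using P(1) at unfolding partitions_def by (cases n) auto
  ultimately obtain m where m: "P = (Suc m, q)" using not0_implies_Suc by blast
  have q: "q 0 = t" "q (Suc m) = b" "\<And>i. i < Suc m \<Longrightarrow> q i < q (Suc i)"
    using P(1) by (auto simp: partitions_def m)
  obtain d where d: "0 < d" "\<And>t'. t' \<in> {a..b} \<Longrightarrow> \<bar>t' - t\<bar> < d \<Longrightarrow>
    norm (x t - x (q 1)) powr p < norm (x t' - x (q 1)) powr p + e"
    using increment_powr_continuous[OF assms(1,4) e, of p] assms(3) by (metis less_le_trans zero_less_one)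
  show ?thesis
  proof (rule that[of "min d (q 1 - t)"])
    show "0 < min d (q 1 - t)" using d q(1) q(3)[of 0] by simp
    fix t' assume t': "t \<le> t'" "t' < t + min d (q 1 - t)" "t' \<le> b"
    define q' where "q' = q(0 := t')"
    have P': "(Suc m, q') \<in> partitions t' b"
      using q t' by (auto simp: partitions_def q'_def)
    have "variation_sum x p P = norm (x t - x (q 1)) powr p + (\<Sum>i<m. norm (x (q (Suc (Suc i))) - x (q (Suc i))) powr p)"
      unfolding variation_sum_def m by (simp add: sum.lessThan_Suc_shift q norm_minus_commute del: sum.lessThan_Suc)
    moreover have "variation_sum x p (Suc m, q') = norm (x t' - x (q 1)) powr p + (\<Sum>i<m. norm (x (q (Suc (Suc i))) - x (q (Suc i))) powr p)"
      unfolding variation_sum_def q'_def by (simp add: sum.lessThan_Suc_shift norm_minus_commute del: sum.lessThan_Suc)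
    moreover have "norm (x t - x (q 1)) powr p < norm (x t' - x (q 1)) powr p + e"
      using t' at by (intro d) auto
    moreover have "variation_sum x p (Suc m, q') \<le> pvar_seminorm x p t' b powr p"
      using t' at assms(3) by (intro variation_sum_le[OF finite_pvar_subset[OF assms(2)] _ P']) auto
    moreover have "pvar_seminorm x p t t' powr p + pvar_seminorm x p t' b powr p \<le> pvar_seminorm x p t b powr p"
      using t' at assms(3) by (intro pcontrol_super[OF pcontrol_pvar_seminorm[OF assms(2)]]) auto
    ultimately have "pvar_seminorm x p t t' powr p < \<epsilon> powr p"
      using P(2) unfolding e_def by linarith
    then show "pvar_seminorm x p t t' < \<epsilon>"
      using assms(3,5) by (smt (verit) powr_mono2)
  qed
qed

text \<open>By monotonicity and the triangle inequality, moving the right endpoint from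
  \<open>u\<close> to \<open>v\<close> changes the value by at most the seminorm over [u, v], which
  is small on both sides of \<open>t\<close>.\<close>

lemma continuous_on_pvar_seminorm:
  assumes x: "continuous_on {a..b} x" "finite_pvar x p a b" and p: "1 \<le> p" and s: "a \<le> s"
  shows "continuous_on {s..b} (pvar_seminorm x p s)"
  unfolding continuous_on_iff
proof (intro ballI allI impI)
  fix t \<epsilon> :: real assume t: "t \<in> {s..b}" and e: "0 < \<epsilon>"
  then have tab: "t \<in> {a..b}" using s by auto
  obtain d1 where d1: "0 < d1" "\<And>t'. a \<le> t' \<Longrightarrow> t - d1 < t' \<Longrightarrow> t' \<le> t \<Longrightarrow> pvar_seminorm x p t' t < \<epsilon>"
    using pvar_seminorm_small_left[OF x p tab e] by metis
  obtain d2 where d2: "0 < d2" "\<And>t'. t \<le> t' \<Longrightarrow> t' < t + d2 \<Longrightarrow> t' \<le> b \<Longrightarrow> pvar_seminorm x p t t' < \<epsilon>"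
    using pvar_seminorm_small_right[OF x p tab e] by metis
  have step: "\<bar>pvar_seminorm x p s v - pvar_seminorm x p s u\<bar> \<le> pvar_seminorm x p u v"
    if uv: "s \<le> u" "u \<le> v" "v \<le> b" for u v
  proof -
    have "pvar_seminorm x p s v \<le> pvar_seminorm x p s u + pvar_seminorm x p u v"
      using uv s by (intro pvar_seminorm_triangle(2)[OF p] finite_pvar_subset[OF x(2)]) auto
    moreover have "pvar_seminorm x p s u \<le> pvar_seminorm x p s v"
      using uv s p by (intro pcontrol_mono[OF pcontrol_pvar_seminorm[OF x(2)]]) auto
    ultimately show ?thesis by simp
  qed
  show "\<exists>d>0. \<forall>t'\<in>{s..b}. dist t' t < d \<longrightarrow> dist (pvar_seminorm x p s t') (pvar_seminorm x p s t) < \<epsilon>"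
  proof (intro exI[of _ "min d1 d2"] conjI ballI impI)
    fix t' assume t': "t' \<in> {s..b}" "dist t' t < min d1 d2"
    show "dist (pvar_seminorm x p s t') (pvar_seminorm x p s t) < \<epsilon>"
    proof (cases "t' \<le> t")
      case True
      then show ?thesis using step[of t' t] d1(2)[of t'] t' t s by (auto simp: dist_real_def)
    next
      case False
      then show ?thesis using step[of t t'] d2(2)[of t'] t' t s by (auto simp: dist_real_def)
    qed
  qed (use d1 d2 in auto)
qed

text \<open>Superadditivity bounds the p-th power over [s, t] by an increment of the function of one
  variable \<open>pvar_seminorm x p a t powr p\<close>, which is uniformly continuous on the compact
  interval.\<close>

lemma pvar_seminorm_uniformly_small:
  assumes x: "continuous_on {a..b} x" "finite_pvar x p a b" and p: "1 \<le> p" and e: "0 < \<epsilon>"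
  obtains d where "0 < d" "\<And>s t. a \<le> s \<Longrightarrow> s \<le> t \<Longrightarrow> t \<le> b \<Longrightarrow> t - s < d \<Longrightarrow> pvar_seminorm x p s t < \<epsilon>"
proof -
  have "continuous_on {a..b} (\<lambda>t. pvar_seminorm x p a t powr p)"
    using continuous_on_pvar_seminorm[OF x p, of a] p
    by (intro continuous_on_powr' continuous_intros) (auto simp: pvar_seminorm_nonneg)
  then have "uniformly_continuous_on {a..b} (\<lambda>t. pvar_seminorm x p a t powr p)"
    by (rule compact_uniformly_continuous) simp
  then obtain d where d: "0 < d" "\<And>s t. s \<in> {a..b} \<Longrightarrow> t \<in> {a..b} \<Longrightarrow> dist t s < d \<Longrightarrow>
      dist (pvar_seminorm x p a t powr p) (pvar_seminorm x p a s powr p) < \<epsilon> powr p"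
    using e unfolding uniformly_continuous_on_def by (metis powr_gt_zero less_irrefl)
  show ?thesis
  proof (rule that[OF d(1)])
    fix s t assume st: "a \<le> s" "s \<le> t" "t \<le> b" "t - s < d"
    have "pvar_seminorm x p a s powr p + pvar_seminorm x p s t powr p \<le> pvar_seminorm x p a t powr p"
      using st p by (intro pcontrol_super[OF pcontrol_pvar_seminorm[OF x(2)]]) auto
    moreover have "dist (pvar_seminorm x p a t powr p) (pvar_seminorm x p a s powr p) < \<epsilon> powr p"
      using st by (intro d) (auto simp: dist_real_def)
    ultimately have "pvar_seminorm x p s t powr p < \<epsilon> powr p"
      by (simp add: dist_real_def)
    then show "pvar_seminorm x p s t < \<epsilon>"
      using p e by (smt (verit) powr_mono2)
  qed
qed

section \<open>Differences, pointwise limits and congruence\<close>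

lemma finite_pvar_diff:
  assumes "1 \<le> p" "s \<le> t" "finite_pvar y p s t" "finite_pvar z p s t"
  shows "finite_pvar (\<lambda>r. y r - z r) p s t"
    "pvar_seminorm (\<lambda>r. y r - z r) p s t \<le> pvar_seminorm y p s t + pvar_seminorm z p s t"
proof -
  have p0: "0 < p" using assms(1) by simp
  have pc: "pcontrol p (\<lambda>u v. pvar_seminorm y p u v + pvar_seminorm z p u v) s t"
    using assms p0 by (intro pcontrol_add pcontrol_pvar_seminorm)
  have "norm ((y v - z v) - (y u - z u)) \<le> pvar_seminorm y p u v + pvar_seminorm z p u v"
    if uv: "s \<le> u" "u \<le> v" "v \<le> t" for u v
  proof -
    have eq: "(y v - z v) - (y u - z u) = (y v - y u) - (z v - z u)" by simp
    show ?thesis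
      unfolding eq using increment_le_pvar_seminorm[OF assms(3) uv p0] increment_le_pvar_seminorm[OF assms(4) uv p0]
        norm_triangle_ineq4[of "y v - y u" "z v - z u"] by linarith
  qed
  note * = pvar_seminorm_le_pcontrol[OF assms(1,2) pc this]
  show "finite_pvar (\<lambda>r. y r - z r) p s t" by (rule *(1))
  show "pvar_seminorm (\<lambda>r. y r - z r) p s t \<le> pvar_seminorm y p s t + pvar_seminorm z p s t" by (rule *(2))
qed

text \<open>Lower semicontinuity under pointwise convergence: a variation sum has finitely many
  terms, so the bound passes to the limit for each partition separately.\<close>

lemma pvar_seminorm_limit:
  assumes p: "0 < p" and st: "s \<le> t" and B: "0 \<le> B"
    and fin: "\<And>n. finite_pvar (h n) p s t" and le: "\<And>n. pvar_seminorm (h n) p s t \<le> B"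
    and lim: "\<And>r. s \<le> r \<Longrightarrow> r \<le> t \<Longrightarrow> (\<lambda>n. h n r) \<longlonglongrightarrow> y r"
  shows "finite_pvar y p s t" "pvar_seminorm y p s t \<le> B"
proof -
  have "variation_sum y p P \<le> B powr p" if P: "P \<in> partitions s t" for P
  proof (rule LIMSEQ_le_const2)
    show "(\<lambda>n. variation_sum (h n) p P) \<longlonglongrightarrow> variation_sum y p P"
      unfolding variation_sum_def
    proof (rule tendsto_sum)
      fix i assume "i \<in> {..<fst P}"
      then have "snd P i \<in> {s..t}" "snd P (Suc i) \<in> {s..t}"
        using partition_range[OF P] by auto
      then show "(\<lambda>n. norm (h n (snd P (Suc i)) - h n (snd P i)) powr p) \<longlonglongrightarrow> norm (y (snd P (Suc i)) - y (snd P i)) powr p"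
        using p by (intro tendsto_powr' tendsto_norm tendsto_diff lim tendsto_const) auto
    qed
    have "variation_sum (h n) p P \<le> B powr p" for n
      using variation_sum_le[OF fin p P, of n] powr_mono2[OF _ pvar_seminorm_nonneg le, of p n] p by simp
    then show "\<exists>N. \<forall>n\<ge>N. variation_sum (h n) p P \<le> B powr p" by blast
  qed
  from pvar_seminorm_least[OF this st p B]
  show "finite_pvar y p s t" "pvar_seminorm y p s t \<le> B" by auto
qed

lemma finite_pvar_cong:
  assumes "\<And>r. s \<le> r \<Longrightarrow> r \<le> t \<Longrightarrow> y r = z r"
  shows "finite_pvar y p s t \<longleftrightarrow> finite_pvar z p s t"
proof -
  have "variation_sum y p P = variation_sum z p P" if "P \<in> partitions s t" for P
    unfolding variation_sum_def
    using partition_range[OF that] assms by (intro sum.cong) auto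
  then show ?thesis by (simp add: finite_pvar_def cong: image_cong)
qed

section \<open>The sewing lemma\<close>

lemma norm_diff_diff_add_le: "norm (u + v - w - z) \<le> norm u + norm v + norm w + norm z"
  for u v w z :: "'a::real_normed_vector"
  by norm

text \<open>The defect is measured by increments of a function of one variable: these telescope
  along a partition and are uniformly small on fine ones. Since \<open>\<theta>\<close> exceeds 1,
  the total defect of a partition vanishes with its mesh.\<close>

locale sewing =
  fixes \<Xi> :: "real \<Rightarrow> real \<Rightarrow> 'a::banach" and W :: "real \<Rightarrow> real" and \<theta> a b :: real
  assumes theta: "1 < \<theta>" and W_mono: "mono_on {a..b} W"
    and W_cont: "continuous_on {a..b} W"
    and defect: "\<And>s u t. a \<le> s \<Longrightarrow> s \<le> u \<Longrightarrow> u \<le> t \<Longrightarrow> t \<le> b \<Longrightarrow>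
      norm (\<Xi> s t - \<Xi> s u - \<Xi> u t) \<le> (W t - W s) powr \<theta>"
begin

text \<open>The solution of C = C * 2 powr (1 - \<theta>) + 2: two subproblems with at most half of
  the \<open>W\<close>-mass each, and two defects for the cell between them.\<close>

definition sew_const :: real where "sew_const = 2 / (1 - 2 powr (1 - \<theta>))"

lemma sew_ratio: "0 < 2 powr (1 - \<theta>)" "2 powr (1 - \<theta>) < 1"
  using theta by (auto simp: powr_less_one)

lemma sew_const_pos: "0 < sew_const"
  using sew_ratio by (simp add: sew_const_def)

lemma W_le: "a \<le> s \<Longrightarrow> s \<le> t \<Longrightarrow> t \<le> b \<Longrightarrow> W s \<le> W t"
  using W_mono by (auto simp: monotone_on_def)

lemma Xi_diag: "a \<le> s \<Longrightarrow> s \<le> b \<Longrightarrow> \<Xi> s s = 0"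
  using defect[of s s s] by simp

lemma half_powr:
  assumes "0 \<le> D"
  shows "2 * (D / 2) powr \<theta> = 2 powr (1 - \<theta>) * D powr \<theta>"
  using assms by (simp add: powr_divide powr_diff)

text \<open>The partition is cut at the cell that contains the midpoint with respect to \<open>W\<close>.\<close>

lemma discrete_sewing:
  assumes "\<And>i. m \<le> i \<Longrightarrow> i < n \<Longrightarrow> t i \<le> t (Suc i)" "a \<le> t m" "t n \<le> b" "m \<le> n"
  shows "norm ((\<Sum>i=m..<n. \<Xi> (t i) (t (Suc i))) - \<Xi> (t m) (t n)) \<le> sew_const * (W (t n) - W (t m)) powr \<theta>"
  using assms
proof (induction "n - m" arbitrary: m n rule: less_induct)
  case less
  have mono: "t i \<le> t j" if "m \<le> i" "i \<le> j" "j \<le> n" for i j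
    using that(2,1,3)
  proof (induction rule: dec_induct)
    case (step k)
    have "t k \<le> t (Suc k)" by (rule less.prems(1)) (use step in auto)
    then show ?case using step by auto
  qed simp
  have rng: "a \<le> t i \<and> t i \<le> b" if "m \<le> i" "i \<le> n" for i
    using mono[of m i] mono[of i n] that less.prems(2,3) by auto
  define D where "D = W (t n) - W (t m)"
  have D0: "0 \<le> D" using W_le[of "t m" "t n"] mono[of m n] less.prems by (simp add: D_def)
  show ?case
  proof (cases "n = m")
    case True
    then show ?thesis using Xi_diag[of "t m"] rng[of m] by simp
  next
    case False
    then have mn: "m < n" using less.prems by simp
    \<comment> \<open>The largest index in \<open>J\<close> names the cell containing the
      \<open>W\<close>-midpoint. The points before it and those after it both carry at most
      \<open>D / 2\<close>; the cell itself may carry more and is split off.\<close>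
    define J where "J = {j. m \<le> j \<and> j < n \<and> W (t j) - W (t m) \<le> D / 2}"
    have "m \<in> J" "finite J" using mn D0 by (auto simp: J_def)
    define j where "j = Max J"
    have "j \<in> J" using \<open>m \<in> J\<close> \<open>finite J\<close> unfolding j_def by (intro Max_in) auto
    then have j: "m \<le> j" "j < n" "W (t j) - W (t m) \<le> D / 2" by (auto simp: J_def)
    have j2: "W (t n) - W (t (Suc j)) \<le> D / 2"
    proof (cases "Suc j = n")
      case False
      then have "Suc j \<notin> J" using Max_ge[OF \<open>finite J\<close>, of "Suc j"] unfolding j_def by auto
      then have "W (t (Suc j)) - W (t m) > D / 2" using j False by (auto simp: J_def)
      then show ?thesis by (simp add: D_def field_simps)
    qed (use D0 in simp)
    let ?S = "\<lambda>m n. \<Sum>i=m..<n. \<Xi> (t i) (t (Suc i))"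
    have S: "?S m n = ?S m j + \<Xi> (t j) (t (Suc j)) + ?S (Suc j) n"
      using j sum.atLeastLessThan_concat[of m j n "\<lambda>i. \<Xi> (t i) (t (Suc i))"]
        sum.atLeast_Suc_lessThan[of j n "\<lambda>i. \<Xi> (t i) (t (Suc i))"] by (simp add: add.assoc)
    have 1: "norm (?S m j - \<Xi> (t m) (t j)) \<le> sew_const * (W (t j) - W (t m)) powr \<theta>"
      using j less.prems rng[of j] by (intro less.hyps) auto
    have 2: "norm (?S (Suc j) n - \<Xi> (t (Suc j)) (t n)) \<le> sew_const * (W (t n) - W (t (Suc j))) powr \<theta>"
      using j less.prems rng[of "Suc j"] by (intro less.hyps) auto
    have h1: "(W (t j) - W (t m)) powr \<theta> \<le> (D / 2) powr \<theta>"
      using j rng[of m] rng[of j] mono[of m j] W_le[of "t m" "t j"] theta by (intro powr_mono2) auto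
    have h2: "(W (t n) - W (t (Suc j))) powr \<theta> \<le> (D / 2) powr \<theta>"
      using j j2 rng[of n] rng[of "Suc j"] mono[of "Suc j" n] W_le[of "t (Suc j)" "t n"] theta
      by (intro powr_mono2) auto
    have 3: "norm (\<Xi> (t m) (t n) - \<Xi> (t m) (t j) - \<Xi> (t j) (t n)) \<le> D powr \<theta>"
      using j rng[of m] rng[of n] mono[of m j] mono[of j n] unfolding D_def by (intro defect) auto
    have "norm (\<Xi> (t j) (t n) - \<Xi> (t j) (t (Suc j)) - \<Xi> (t (Suc j)) (t n)) \<le> (W (t n) - W (t j)) powr \<theta>"
      using j rng[of j] rng[of n] mono[of j "Suc j"] mono[of "Suc j" n] by (intro defect) auto
    also have "\<dots> \<le> D powr \<theta>"
      using j rng[of m] rng[of j] rng[of n] mono[of m j] mono[of j n] W_le[of "t m" "t j"]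
        W_le[of "t j" "t n"] theta unfolding D_def
      by (intro powr_mono2) auto
    finally have 4: "norm (\<Xi> (t j) (t n) - \<Xi> (t j) (t (Suc j)) - \<Xi> (t (Suc j)) (t n)) \<le> D powr \<theta>" .
    \<comment> \<open>Two smaller instances of the claim, and the two defects caused by inserting
      first \<open>t j\<close> and then \<open>t (Suc j)\<close>.\<close>
    have eq: "?S m n - \<Xi> (t m) (t n) = (?S m j - \<Xi> (t m) (t j)) + (?S (Suc j) n - \<Xi> (t (Suc j)) (t n))
      - (\<Xi> (t m) (t n) - \<Xi> (t m) (t j) - \<Xi> (t j) (t n))
      - (\<Xi> (t j) (t n) - \<Xi> (t j) (t (Suc j)) - \<Xi> (t (Suc j)) (t n))"
      unfolding S by (simp add: algebra_simps)
    have "norm (?S m n - \<Xi> (t m) (t n)) \<le> norm (?S m j - \<Xi> (t m) (t j))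
      + norm (?S (Suc j) n - \<Xi> (t (Suc j)) (t n))
      + norm (\<Xi> (t m) (t n) - \<Xi> (t m) (t j) - \<Xi> (t j) (t n))
      + norm (\<Xi> (t j) (t n) - \<Xi> (t j) (t (Suc j)) - \<Xi> (t (Suc j)) (t n))"
      unfolding eq by (rule norm_diff_diff_add_le)
    also have "\<dots> \<le> sew_const * (D / 2) powr \<theta> + sew_const * (D / 2) powr \<theta> + D powr \<theta> + D powr \<theta>"
      using 1 2 3 4 mult_left_mono[OF h1, of sew_const] mult_left_mono[OF h2, of sew_const] sew_const_pos
      by linarith
    also have "\<dots> = (sew_const * 2 powr (1 - \<theta>) + 2) * D powr \<theta>"
      using half_powr[OF D0] by (simp add: algebra_simps)
    also have "sew_const * 2 powr (1 - \<theta>) + 2 = sew_const"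
    proof -
      have "2 / (1 - r) * r + 2 = 2 / (1 - r)" if "r < 1" for r :: real
        using that by (simp add: field_simps)
      then show ?thesis using sew_ratio(2) unfolding sew_const_def .
    qed
    finally show ?thesis by (simp add: D_def)
  qed
qed

text \<open>One factor of each term is kept and telescopes; the remaining power, with positive
  exponent \<theta> - 1, is bounded by that of the mesh.\<close>

lemma W_powr_sum_bound:
  assumes "\<And>i. i < n \<Longrightarrow> t i \<le> t (Suc i)" "a \<le> t 0" "t n \<le> b"
    and "\<And>i. i < n \<Longrightarrow> W (t (Suc i)) - W (t i) \<le> \<eta>" "0 \<le> \<eta>"
  shows "(\<Sum>i<n. (W (t (Suc i)) - W (t i)) powr \<theta>) \<le> \<eta> powr (\<theta> - 1) * (W (t n) - W (t 0))"
proof -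
  have rng: "a \<le> t i \<and> t i \<le> b" if "i \<le> n" for i
    using seq_mono[of n t 0 i, OF assms(1)] seq_mono[of n t i n, OF assms(1)] that assms(2,3) by auto
  have "(\<Sum>i<n. (W (t (Suc i)) - W (t i)) powr \<theta>) \<le> (\<Sum>i<n. \<eta> powr (\<theta> - 1) * (W (t (Suc i)) - W (t i)))"
  proof (rule sum_mono)
    fix i assume i: "i \<in> {..<n}"
    then have d: "0 \<le> W (t (Suc i)) - W (t i)"
      using W_le[of "t i" "t (Suc i)"] rng[of i] rng[of "Suc i"] assms(1)[of i] by simp
    then have "(W (t (Suc i)) - W (t i)) powr \<theta> = (W (t (Suc i)) - W (t i)) powr (\<theta> - 1) * (W (t (Suc i)) - W (t i))"
      using powr_add[of "W (t (Suc i)) - W (t i)" "\<theta> - 1" 1] by (cases "W (t (Suc i)) - W (t i) = 0") auto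
    also have "\<dots> \<le> \<eta> powr (\<theta> - 1) * (W (t (Suc i)) - W (t i))"
      using assms(4)[of i] i d theta by (intro mult_right_mono powr_mono2) auto
    finally show "(W (t (Suc i)) - W (t i)) powr \<theta> \<le> \<eta> powr (\<theta> - 1) * (W (t (Suc i)) - W (t i))" .
  qed
  also have "\<dots> = \<eta> powr (\<theta> - 1) * (W (t n) - W (t 0))"
    by (simp add: sum_lessThan_telescope[of "\<lambda>i. W (t i)"] flip: sum_distrib_left)
  finally show ?thesis .
qed

text \<open>Dyadic points of \<open>{a..b}\<close>, clamped to \<open>{s..t}\<close>: all intervals share the same grid, which makes
  the limit of the dyadic sums additive.\<close>

definition grid :: "nat \<Rightarrow> nat \<Rightarrow> real" where "grid n i = a + real i * (b - a) / 2 ^ n"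

definition clamp :: "real \<Rightarrow> real \<Rightarrow> real \<Rightarrow> real" where "clamp s t r = max s (min t r)"

definition dyadic_sum :: "nat \<Rightarrow> real \<Rightarrow> real \<Rightarrow> 'a" where
  "dyadic_sum n s t = (\<Sum>i<2 ^ n. \<Xi> (clamp s t (grid n i)) (clamp s t (grid n (Suc i))))"

lemma clamp_mono: "r \<le> r' \<Longrightarrow> clamp s t r \<le> clamp s t r'"
  by (auto simp: clamp_def)

lemma clamp_range: "s \<le> t \<Longrightarrow> s \<le> clamp s t r \<and> clamp s t r \<le> t"
  by (auto simp: clamp_def)

lemma grid_0: "grid n 0 = a" and grid_last: "grid n (2 ^ n) = b"
  by (auto simp: grid_def)

lemma grid_mono: "a \<le> b \<Longrightarrow> i \<le> j \<Longrightarrow> grid n i \<le> grid n j"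
  by (auto simp: grid_def intro!: divide_right_mono mult_right_mono)

lemma grid_refine: "grid (n + k) (i * 2 ^ k) = grid n i"
  by (simp add: grid_def power_add)

lemma clamp_ends: "a \<le> s \<Longrightarrow> s \<le> t \<Longrightarrow> t \<le> b \<Longrightarrow> clamp s t a = s \<and> clamp s t b = t"
  by (auto simp: clamp_def)

lemma dyadic_sum_local:
  assumes "a \<le> s" "s \<le> t" "t \<le> b"
  shows "norm (dyadic_sum n s t - \<Xi> s t) \<le> sew_const * (W t - W s) powr \<theta>"
proof -
  let ?t = "\<lambda>i. clamp s t (grid n i)"
  have "norm ((\<Sum>i=0..<2^n. \<Xi> (?t i) (?t (Suc i))) - \<Xi> (?t 0) (?t (2^n))) \<le> sew_const * (W (?t (2^n)) - W (?t 0)) powr \<theta>"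
    using assms clamp_range[of s t] by (intro discrete_sewing clamp_mono grid_mono) (auto intro: order_trans)
  then show ?thesis
    using clamp_ends[OF assms] by (simp add: dyadic_sum_def grid_0 grid_last lessThan_atLeast0)
qed

lemma grid_fine:
  assumes "0 < \<eta>" "a \<le> b"
  obtains n0 where "\<And>n i s t. n0 \<le> n \<Longrightarrow> i < 2 ^ n \<Longrightarrow> a \<le> s \<Longrightarrow> s \<le> t \<Longrightarrow> t \<le> b \<Longrightarrow>
    W (clamp s t (grid n (Suc i))) - W (clamp s t (grid n i)) \<le> \<eta>"
proof -
  have "uniformly_continuous_on {a..b} W"
    by (rule compact_uniformly_continuous[OF W_cont]) simp
  then obtain d where d: "0 < d" "\<And>r r'. r \<in> {a..b} \<Longrightarrow> r' \<in> {a..b} \<Longrightarrow> dist r' r < d \<Longrightarrow> dist (W r') (W r) < \<eta>"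
    using assms unfolding uniformly_continuous_on_def by metis
  obtain n0 where n0: "(b - a) / d < 2 ^ n0"
    using real_arch_pow[of 2 "(b - a) / d"] by auto
  show ?thesis
  proof (rule that[of n0])
    fix n i s t assume n: "n0 \<le> n" and st: "a \<le> s" "s \<le> t" "t \<le> b"
    have "(b - a) / d < 2 ^ n"
      by (rule less_le_trans[OF n0 power_increasing[OF n]]) simp
    then have "(b - a) / 2 ^ n < d" using d by (simp add: field_simps)
    moreover have "grid n (Suc i) - grid n i = (b - a) / 2 ^ n"
      by (simp add: grid_def field_simps)
    moreover have "grid n i \<le> grid n (Suc i)" using assms by (intro grid_mono) auto
    ultimately have "dist (clamp s t (grid n (Suc i))) (clamp s t (grid n i)) < d"
      by (auto simp: clamp_def dist_real_def)
    then have "dist (W (clamp s t (grid n (Suc i)))) (W (clamp s t (grid n i))) < \<eta>"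
      using clamp_range[OF st(2), of "grid n i"] clamp_range[OF st(2), of "grid n (Suc i)"] st
      by (intro d) auto
    then show "W (clamp s t (grid n (Suc i))) - W (clamp s t (grid n i)) \<le> \<eta>"
      by (simp add: dist_real_def)
  qed
qed

lemma clamped_sum_bound:
  assumes st: "a \<le> s" "s \<le> t" "t \<le> b" and "0 \<le> \<eta>"
    and "\<And>i. i < 2 ^ n \<Longrightarrow> W (clamp s t (grid n (Suc i))) - W (clamp s t (grid n i)) \<le> \<eta>"
  shows "(\<Sum>i<2 ^ n. (W (clamp s t (grid n (Suc i))) - W (clamp s t (grid n i))) powr \<theta>)
    \<le> \<eta> powr (\<theta> - 1) * (W b - W a)"
proof -
  let ?t = "\<lambda>i. clamp s t (grid n i)"
  have "(\<Sum>i<2 ^ n. (W (?t (Suc i)) - W (?t i)) powr \<theta>) \<le> \<eta> powr (\<theta> - 1) * (W (?t (2 ^ n)) - W (?t 0))"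
    using assms clamp_range[OF st(2)] by (intro W_powr_sum_bound clamp_mono grid_mono) (auto intro: order_trans)
  also have "\<dots> = \<eta> powr (\<theta> - 1) * (W t - W s)"
    using clamp_ends[OF st] by (simp add: grid_0 grid_last)
  also have "\<dots> \<le> \<eta> powr (\<theta> - 1) * (W b - W a)"
    using W_le[of a s] W_le[of t b] st by (intro mult_left_mono) auto
  finally show ?thesis .
qed

lemma small_powr:
  assumes "0 < \<epsilon>"
  obtains \<eta> where "0 < \<eta>" "\<And>e. 0 \<le> e \<Longrightarrow> e \<le> \<eta> \<Longrightarrow> C * (e powr (\<theta> - 1) * (W b - W a)) \<le> \<epsilon>"
proof -
  \<comment> \<open>The summand 1 keeps \<open>M\<close> positive when \<open>C\<close> or the total
    increment of \<open>W\<close> is zero.\<close>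
  define M where "M = \<bar>C * (W b - W a)\<bar> + 1"
  have M: "0 < M" by (simp add: M_def)
  define \<eta> where "\<eta> = (\<epsilon> / M) powr (1 / (\<theta> - 1))"
  show ?thesis
  proof (rule that[of \<eta>])
    show "0 < \<eta>" using assms M by (simp add: \<eta>_def)
    fix e :: real assume e: "0 \<le> e" "e \<le> \<eta>"
    have "e powr (\<theta> - 1) \<le> \<eta> powr (\<theta> - 1)" using e theta by (intro powr_mono2) auto
    also have "\<dots> = \<epsilon> / M" using theta assms M by (simp add: \<eta>_def powr_powr)
    finally have *: "e powr (\<theta> - 1) * M \<le> \<epsilon>" using M by (simp add: field_simps)
    have "C * (e powr (\<theta> - 1) * (W b - W a)) = e powr (\<theta> - 1) * (C * (W b - W a))" by simp
    also have "\<dots> \<le> e powr (\<theta> - 1) * M" by (intro mult_left_mono) (auto simp: M_def)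
    finally show "C * (e powr (\<theta> - 1) * (W b - W a)) \<le> \<epsilon>" using * by simp
  qed
qed

text \<open>The fine sum is grouped into blocks of \<open>2 ^ k\<close> cells. Each block refines
  one coarse cell, so \<open>discrete_sewing\<close> applies blockwise, uniformly in
  \<open>k\<close>.\<close>

lemma dyadic_sum_refine:
  assumes st: "a \<le> s" "s \<le> t" "t \<le> b" and "0 \<le> \<eta>"
    and "\<And>i. i < 2 ^ n \<Longrightarrow> W (clamp s t (grid n (Suc i))) - W (clamp s t (grid n i)) \<le> \<eta>"
  shows "norm (dyadic_sum (n + k) s t - dyadic_sum n s t) \<le> sew_const * (\<eta> powr (\<theta> - 1) * (W b - W a))"
proof -
  let ?u = "\<lambda>i. clamp s t (grid (n + k) i)" and ?t = "\<lambda>i. clamp s t (grid n i)"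
  have ab: "a \<le> b" using st by simp
  have "dyadic_sum (n + k) s t = (\<Sum>i<2 ^ n. \<Sum>j = i * 2 ^ k..<i * 2 ^ k + 2 ^ k. \<Xi> (?u j) (?u (Suc j)))"
    unfolding dyadic_sum_def sum.nat_group by (simp add: power_add)
  then have eq: "dyadic_sum (n + k) s t - dyadic_sum n s t =
    (\<Sum>i<2 ^ n. (\<Sum>j = i * 2 ^ k..<i * 2 ^ k + 2 ^ k. \<Xi> (?u j) (?u (Suc j))) - \<Xi> (?t i) (?t (Suc i)))"
    by (simp add: dyadic_sum_def sum_subtractf)
  have "norm (dyadic_sum (n + k) s t - dyadic_sum n s t) \<le> (\<Sum>i<2 ^ n. sew_const * (W (?t (Suc i)) - W (?t i)) powr \<theta>)"
    unfolding eq
  proof (rule sum_norm_le)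
    fix i :: nat
    have e: "?u (i * 2 ^ k) = ?t i" "?u (i * 2 ^ k + 2 ^ k) = ?t (Suc i)"
      using grid_refine[of n k i] grid_refine[of n k "Suc i"] by (auto simp: algebra_simps)
    have "norm ((\<Sum>j = i * 2 ^ k..<i * 2 ^ k + 2 ^ k. \<Xi> (?u j) (?u (Suc j))) - \<Xi> (?u (i * 2 ^ k)) (?u (i * 2 ^ k + 2 ^ k)))
       \<le> sew_const * (W (?u (i * 2 ^ k + 2 ^ k)) - W (?u (i * 2 ^ k))) powr \<theta>"
      using st clamp_range[OF st(2)] ab by (intro discrete_sewing clamp_mono grid_mono) (auto intro: order_trans)
    then show "norm ((\<Sum>j = i * 2 ^ k..<i * 2 ^ k + 2 ^ k. \<Xi> (?u j) (?u (Suc j))) - \<Xi> (?t i) (?t (Suc i)))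
       \<le> sew_const * (W (?t (Suc i)) - W (?t i)) powr \<theta>"
      unfolding e .
  qed
  also have "\<dots> \<le> sew_const * (\<eta> powr (\<theta> - 1) * (W b - W a))"
    using mult_left_mono[OF clamped_sum_bound[OF assms] less_imp_le[OF sew_const_pos]]
    by (simp only: sum_distrib_left)
  finally show ?thesis .
qed

lemma dyadic_sum_Cauchy:
  assumes st: "a \<le> s" "s \<le> t" "t \<le> b"
  shows "Cauchy (\<lambda>n. dyadic_sum n s t)"
proof (rule metric_CauchyI)
  fix \<epsilon> :: real assume "0 < \<epsilon>"
  then have "0 < \<epsilon> / 3" by simp
  from small_powr[OF this, of sew_const] obtain \<eta> where \<eta>: "0 < \<eta>"
    "sew_const * (\<eta> powr (\<theta> - 1) * (W b - W a)) \<le> \<epsilon> / 3"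
    by (metis order_refl less_imp_le)
  obtain n where n: "\<And>i. i < 2 ^ n \<Longrightarrow> W (clamp s t (grid n (Suc i))) - W (clamp s t (grid n i)) \<le> \<eta>"
    using grid_fine[OF \<eta>(1)] st by (metis order_refl order_trans)
  have *: "dist (dyadic_sum m s t) (dyadic_sum n s t) \<le> \<epsilon> / 3" if nm: "n \<le> m" for m
  proof -
    obtain k where "m = n + k" using le_Suc_ex[OF nm] by (rule exE)
    then show ?thesis
      using dyadic_sum_refine[OF st less_imp_le[OF \<eta>(1)] n, of k] \<eta>(2) by (simp add: dist_norm)
  qed
  show "\<exists>M. \<forall>m\<ge>M. \<forall>n\<ge>M. dist (dyadic_sum m s t) (dyadic_sum n s t) < \<epsilon>"
  proof (intro exI[of _ n] allI impI)
    fix m m' assume "n \<le> m" "n \<le> m'"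
    then show "dist (dyadic_sum m s t) (dyadic_sum m' s t) < \<epsilon>"
      using *[of m] *[of m'] \<open>0 < \<epsilon>\<close> dist_triangle2[of "dyadic_sum m s t" "dyadic_sum m' s t" "dyadic_sum n s t"]
      by simp
  qed
qed

definition sewn :: "real \<Rightarrow> real \<Rightarrow> 'a" where "sewn s t = lim (\<lambda>n. dyadic_sum n s t)"

lemma dyadic_sum_tendsto:
  "a \<le> s \<Longrightarrow> s \<le> t \<Longrightarrow> t \<le> b \<Longrightarrow> (\<lambda>n. dyadic_sum n s t) \<longlonglongrightarrow> sewn s t"
  unfolding sewn_def using dyadic_sum_Cauchy Cauchy_convergent convergent_LIMSEQ_iff by blast

lemma sewn_local:
  assumes "a \<le> s" "s \<le> t" "t \<le> b"
  shows "norm (sewn s t - \<Xi> s t) \<le> sew_const * (W t - W s) powr \<theta>"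
  by (rule LIMSEQ_le_const2[OF tendsto_norm[OF tendsto_diff[OF dyadic_sum_tendsto[OF assms] tendsto_const]]])
    (use dyadic_sum_local[OF assms] in auto)

text \<open>On the common grid the three sums are compared cell by cell, and the total difference
  tends to 0 with the \<open>W\<close>-mesh.\<close>

lemma sewn_additive:
  assumes "a \<le> s" "s \<le> t" "t \<le> r" "r \<le> b"
  shows "sewn s t + sewn t r = sewn s r"
proof -
  let ?d = "\<lambda>n. dyadic_sum n s r - dyadic_sum n s t - dyadic_sum n t r"
  have lim: "?d \<longlonglongrightarrow> sewn s r - sewn s t - sewn t r"
    using assms by (intro tendsto_diff dyadic_sum_tendsto) auto
  have "norm (sewn s r - sewn s t - sewn t r) \<le> \<epsilon>" if e: "0 < \<epsilon>" for \<epsilon>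
  proof -
    from small_powr[OF e, of 1] obtain \<eta> where \<eta>: "0 < \<eta>" "\<eta> powr (\<theta> - 1) * (W b - W a) \<le> \<epsilon>"
      by (metis order_refl less_imp_le mult_1)
    obtain n0 where n0: "\<And>n i. n0 \<le> n \<Longrightarrow> i < 2 ^ n \<Longrightarrow> W (clamp s r (grid n (Suc i))) - W (clamp s r (grid n i)) \<le> \<eta>"
      using grid_fine[OF \<eta>(1)] assms by (metis order_refl order_trans)
    have "norm (?d n) \<le> \<epsilon>" if n: "n0 \<le> n" for n
    proof -
      have eq: "?d n = (\<Sum>i<2 ^ n. \<Xi> (clamp s r (grid n i)) (clamp s r (grid n (Suc i)))
           - \<Xi> (clamp s t (grid n i)) (clamp s t (grid n (Suc i)))
           - \<Xi> (clamp t r (grid n i)) (clamp t r (grid n (Suc i))))"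
        by (simp add: dyadic_sum_def sum_subtractf)
      have "norm (?d n) \<le> (\<Sum>i<2 ^ n. (W (clamp s r (grid n (Suc i))) - W (clamp s r (grid n i))) powr \<theta>)"
        unfolding eq
      proof (rule sum_norm_le)
        fix i :: nat
        define q where "q = grid n i"
        define q' where "q' = grid n (Suc i)"
        have qq: "q \<le> q'" unfolding q_def q'_def using assms by (intro grid_mono) auto
        have "norm (\<Xi> (clamp s r q) (clamp s r q') - \<Xi> (clamp s t q) (clamp s t q') - \<Xi> (clamp t r q) (clamp t r q'))
            \<le> (W (clamp s r q') - W (clamp s r q)) powr \<theta>"
        \<comment> \<open>If \<open>t\<close> is not interior to the cell, one of the two clamped
          cells collapses to the point \<open>t\<close>, where \<open>\<Xi>\<close> vanishes, and
          the other agrees with the full cell. Otherwise the term is exactly the defect at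
          \<open>t\<close>.\<close>
        proof (cases "q' \<le> t \<or> t \<le> q")
          case True
          then have "(clamp s r q = clamp s t q \<and> clamp s r q' = clamp s t q' \<and> clamp t r q = t \<and> clamp t r q' = t)
            \<or> (clamp s r q = clamp t r q \<and> clamp s r q' = clamp t r q' \<and> clamp s t q = t \<and> clamp s t q' = t)"
            using qq assms by (auto simp: clamp_def max_def min_def)
          then show ?thesis using Xi_diag[of t] assms by auto
        next
          case False
          then have "clamp s r q = clamp s t q" "clamp s t q' = t" "clamp t r q = t" "clamp s r q' = clamp t r q'"
            using qq assms by (auto simp: clamp_def max_def min_def)
          then show ?thesis
            using defect[of "clamp s t q" t "clamp t r q'"] assms clamp_range[of s t q] clamp_range[of t r q'] by auto
        qed
        then show "norm (\<Xi> (clamp s r (grid n i)) (clamp s r (grid n (Suc i)))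
           - \<Xi> (clamp s t (grid n i)) (clamp s t (grid n (Suc i)))
           - \<Xi> (clamp t r (grid n i)) (clamp t r (grid n (Suc i))))
           \<le> (W (clamp s r (grid n (Suc i))) - W (clamp s r (grid n i))) powr \<theta>"
          by (simp add: q_def q'_def)
      qed
      also have "\<dots> \<le> \<eta> powr (\<theta> - 1) * (W b - W a)"
        using assms \<eta>(1) n0[OF n] by (intro clamped_sum_bound) auto
      finally show ?thesis using \<eta>(2) by simp
    qed
    then show ?thesis
      by (intro LIMSEQ_le_const2[OF tendsto_norm[OF lim]]) auto
  qed
  then have "norm (sewn s r - sewn s t - sewn t r) \<le> 0"
    by (rule field_le_epsilon) auto
  then show ?thesis by (simp add: algebra_simps)
qed

end

text \<open>By additivity the sewn increments over any partition telescope to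
  \<open>sewn s t\<close>, so the error is a sum of local errors. This passes from dyadic sums to
  arbitrary fine partitions, as \<open>has_young_integral\<close> requires.\<close>

lemma (in sewing) Riemann_sums_converge:
  assumes st: "a \<le> s" "s \<le> t" "t \<le> b" and e: "0 < \<epsilon>"
  obtains \<delta> where "0 < \<delta>" "\<And>P. P \<in> partitions s t \<Longrightarrow> \<forall>i<fst P. snd P (Suc i) - snd P i < \<delta> \<Longrightarrow>
    norm ((\<Sum>i<fst P. \<Xi> (snd P i) (snd P (Suc i))) - sewn s t) \<le> \<epsilon>"
proof -
  obtain \<eta> where \<eta>: "0 < \<eta>" "sew_const * (\<eta> powr (\<theta> - 1) * (W b - W a)) \<le> \<epsilon>"
    using small_powr[OF e, of sew_const] by (metis order_refl less_imp_le)
  have "uniformly_continuous_on {a..b} W"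
    by (rule compact_uniformly_continuous[OF W_cont]) simp
  then obtain d where d: "0 < d" "\<And>r r'. r \<in> {a..b} \<Longrightarrow> r' \<in> {a..b} \<Longrightarrow> dist r' r < d \<Longrightarrow> dist (W r') (W r) < \<eta>"
    using \<eta> unfolding uniformly_continuous_on_def by metis
  show ?thesis
  proof (rule that[OF d(1)])
    fix P assume P: "P \<in> partitions s t" and mesh: "\<forall>i<fst P. snd P (Suc i) - snd P i < d"
    let ?t = "snd P"
    have rng: "a \<le> ?t i \<and> ?t i \<le> b" if "i \<le> fst P" for i
      using partition_range[OF P that] st by auto
    have ends: "?t 0 = s" "?t (fst P) = t" using P by (auto simp: partitions_def)
    have step: "?t i \<le> ?t (Suc i)" if "i < fst P" for i
      using partition_strict[OF P, of i "Suc i"] that by simp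
    have tel: "(\<Sum>i<n. sewn (?t i) (?t (Suc i))) = sewn s (?t n)" if "n \<le> fst P" for n
      using that
    proof (induction n)
      case 0
      have "sewn s s = 0" using sewn_additive[of s s s] st by simp
      then show ?case using ends by simp
    next
      case (Suc n)
      then show ?case
        using sewn_additive[of s "?t n" "?t (Suc n)"] rng[of "Suc n"] step[of n] st
          partition_range[OF P, of n] by auto
    qed
    have "norm (\<Sum>i<fst P. \<Xi> (?t i) (?t (Suc i)) - sewn (?t i) (?t (Suc i)))
       \<le> (\<Sum>i<fst P. sew_const * (W (?t (Suc i)) - W (?t i)) powr \<theta>)"
    proof (rule sum_norm_le)
      fix i assume "i \<in> {..<fst P}"
      then show "norm (\<Xi> (?t i) (?t (Suc i)) - sewn (?t i) (?t (Suc i))) \<le> sew_const * (W (?t (Suc i)) - W (?t i)) powr \<theta>"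
        using sewn_local[of "?t i" "?t (Suc i)"] rng[of i] rng[of "Suc i"] step[of i]
        by (simp add: norm_minus_commute)
    qed
    also have "\<dots> = sew_const * (\<Sum>i<fst P. (W (?t (Suc i)) - W (?t i)) powr \<theta>)"
      by (simp only: sum_distrib_left)
    also have "\<dots> \<le> sew_const * (\<eta> powr (\<theta> - 1) * (W (?t (fst P)) - W (?t 0)))"
    proof (intro mult_left_mono W_powr_sum_bound)
      fix i assume i: "i < fst P"
      have "dist (W (?t (Suc i))) (W (?t i)) < \<eta>"
        using rng[of i] rng[of "Suc i"] step[of i] mesh i by (intro d) (auto simp: dist_real_def)
      then show "W (?t (Suc i)) - W (?t i) \<le> \<eta>" by (simp add: dist_real_def)
    qed (use step rng[of 0] rng[of "fst P"] \<eta> sew_const_pos in auto)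
    also have "\<dots> \<le> sew_const * (\<eta> powr (\<theta> - 1) * (W b - W a))"
      using W_le[of a s] W_le[of t b] st ends sew_const_pos by (intro mult_left_mono) auto
    finally show "norm ((\<Sum>i<fst P. \<Xi> (?t i) (?t (Suc i))) - sewn s t) \<le> \<epsilon>"
      using tel[of "fst P"] ends \<eta>(2) by (simp add: sum_subtractf)
  qed
qed

text \<open>Bisecting with respect to \<open>Q\<close> replaces the crude constant of the sewing lemma by the geometric
  series \<open>c / (1 - 2 powr (1 - \<theta>))\<close>.\<close>

lemma bisection_bound:
  fixes Z :: "real \<Rightarrow> real \<Rightarrow> 'a::real_normed_vector"
  assumes theta: "1 < \<theta>"
    and bis: "\<And>s t. a \<le> s \<Longrightarrow> s \<le> t \<Longrightarrow> t \<le> b \<Longrightarrow> \<exists>u\<in>{s..t}. Q s u \<le> Q s t / 2 \<and> Q u t \<le> Q s t / 2 \<and>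
      norm (Z s t) \<le> c * Q s t powr \<theta> + norm (Z s u) + norm (Z u t)"
    and crude: "\<And>s t. a \<le> s \<Longrightarrow> s \<le> t \<Longrightarrow> t \<le> b \<Longrightarrow> norm (Z s t) \<le> C * Q s t powr \<theta>"
    and nn: "\<And>s t. a \<le> s \<Longrightarrow> s \<le> t \<Longrightarrow> t \<le> b \<Longrightarrow> 0 \<le> Q s t" "0 \<le> c" "0 \<le> C"
    and st: "a \<le> s" "s \<le> t" "t \<le> b"
  shows "norm (Z s t) \<le> c / (1 - 2 powr (1 - \<theta>)) * Q s t powr \<theta>"
proof -
  define r where "r = 2 powr (1 - \<theta>)"
  have r: "0 < r" "r < 1" using theta by (auto simp: r_def powr_less_one)
  \<comment> \<open>The fixed point of the recursion k = c + r * k produced by one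
    bisection.\<close>
  define k where "k = c / (1 - r)"
  have k: "0 \<le> k" "c + r * k = k" using r nn by (auto simp: k_def field_simps)
  \<comment> \<open>Each bisection multiplies the weight of the crude constant by \<open>r\<close>,
    because the two halves together contribute \<open>r * Q s t powr \<theta>\<close>; in the limit
    only \<open>k\<close> survives.\<close>
  have *: "norm (Z s t) \<le> (k + r ^ n * C) * Q s t powr \<theta>" if "a \<le> s" "s \<le> t" "t \<le> b" for n s t
    using that
  proof (induction n arbitrary: s t)
    case 0
    have "norm (Z s t) \<le> C * Q s t powr \<theta>" by (rule crude) (use 0 in auto)
    also have "\<dots> \<le> (k + C) * Q s t powr \<theta>" using k nn by (intro mult_right_mono) auto
    finally show ?case by simp
  next
    case (Suc n)
    obtain u where u: "u \<in> {s..t}" "Q s u \<le> Q s t / 2" "Q u t \<le> Q s t / 2"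
      "norm (Z s t) \<le> c * Q s t powr \<theta> + norm (Z s u) + norm (Z u t)"
      using bis[OF Suc.prems] by blast
    have half: "norm (Z v w) \<le> (k + r ^ n * C) * (Q s t / 2) powr \<theta>"
      if "a \<le> v" "v \<le> w" "w \<le> b" "Q v w \<le> Q s t / 2" for v w
    proof -
      have "norm (Z v w) \<le> (k + r ^ n * C) * Q v w powr \<theta>" using that by (intro Suc.IH)
      also have "\<dots> \<le> (k + r ^ n * C) * (Q s t / 2) powr \<theta>"
        using that k r nn theta by (intro mult_left_mono powr_mono2) auto
      finally show ?thesis .
    qed
    have "2 * (Q s t / 2) powr \<theta> = r * Q s t powr \<theta>"
      using nn(1)[OF Suc.prems] by (simp add: r_def powr_divide powr_diff)
    then have "2 * ((k + r ^ n * C) * (Q s t / 2) powr \<theta>) = (k + r ^ n * C) * (r * Q s t powr \<theta>)"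
      by (simp add: algebra_simps)
    moreover have "norm (Z s t) \<le> c * Q s t powr \<theta> + 2 * ((k + r ^ n * C) * (Q s t / 2) powr \<theta>)"
      using u half[of s u] half[of u t] Suc.prems by auto
    ultimately have "norm (Z s t) \<le> (c + r * k + r ^ Suc n * C) * Q s t powr \<theta>"
      by (simp add: algebra_simps)
    then show ?case using k by simp
  qed
  have "(\<lambda>n. (k + r ^ n * C) * Q s t powr \<theta>) \<longlonglongrightarrow> (k + 0 * C) * Q s t powr \<theta>"
    using r by (intro tendsto_intros LIMSEQ_realpow_zero) auto
  then show ?thesis
    using *[OF st] by (intro LIMSEQ_le_const[of "\<lambda>n. (k + r ^ n * C) * Q s t powr \<theta>"]) (auto simp: k_def r_def)
qed

text \<open>The Cauchy-Schwarz inequality in the plane; after squaring, the mixed term is handled by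
  the arithmetic-geometric mean inequality.\<close>

lemma sqrt_mult_superadditive:
  assumes "0 \<le> a" "0 \<le> b" "0 \<le> c" "0 \<le> d"
  shows "sqrt (a * b) + sqrt (c * d) \<le> sqrt ((a + c) * (b + d))"
proof (rule real_le_rsqrt)
  have "sqrt (a * b) * sqrt (c * d) = sqrt ((a * d) * (c * b))"
    by (simp add: real_sqrt_mult)
  also have "\<dots> \<le> (a * d + c * b) / 2"
    using assms by (intro arith_geo_mean_sqrt) auto
  finally show "(sqrt (a * b) + sqrt (c * d))\<^sup>2 \<le> (a + c) * (b + d)"
    using assms by (simp add: power2_sum algebra_simps)
qed

text \<open>Makes the p/2-th power of the product of two p-variation seminorms superadditive, which
  is the control to be bisected for the Young integral.\<close>

lemma pcontrol_geometric_mean: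
  assumes "pcontrol p \<phi> a b" "pcontrol p \<psi> a b" "0 < p"
  shows "pcontrol p (\<lambda>s t. sqrt (\<phi> s t * \<psi> s t)) a b"
proof (rule pcontrolI)
  fix s u t assume st: "a \<le> s" "s \<le> u" "u \<le> t" "t \<le> b"
  have sq: "sqrt (\<phi> v w * \<psi> v w) powr p = sqrt (\<phi> v w powr p * \<psi> v w powr p)"
    if "a \<le> v" "v \<le> w" "w \<le> b" for v w
    using pcontrol_nonneg[OF assms(1) that] pcontrol_nonneg[OF assms(2) that]
    by (simp add: powr_half_sqrt[symmetric] powr_powr powr_mult mult.commute)
  have "sqrt (\<phi> s u powr p * \<psi> s u powr p) + sqrt (\<phi> u t powr p * \<psi> u t powr p)
     \<le> sqrt ((\<phi> s u powr p + \<phi> u t powr p) * (\<psi> s u powr p + \<psi> u t powr p))"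
    by (rule sqrt_mult_superadditive) auto
  also have "\<dots> \<le> sqrt (\<phi> s t powr p * \<psi> s t powr p)"
    using st assms by (intro real_sqrt_le_mono mult_mono pcontrol_super) auto
  finally show "sqrt (\<phi> s u * \<psi> s u) powr p + sqrt (\<phi> u t * \<psi> u t) powr p \<le> sqrt (\<phi> s t * \<psi> s t) powr p"
    using st sq by simp
qed (use assms pcontrol_nonneg in auto)

section \<open>The Young integral\<close>

lemma opnorm_mult: "norm (M *v v) \<le> opnorm M * norm v"
  unfolding opnorm_def by (rule onorm[OF matrix_vector_mul_bounded_linear])

lemma opnorm_nonneg: "0 \<le> opnorm M"
  unfolding opnorm_def by (rule onorm_pos_le[OF matrix_vector_mul_bounded_linear])

lemma opnorm_le: "(\<And>v. norm (M *v v) \<le> c * norm v) \<Longrightarrow> opnorm M \<le> c"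
  unfolding opnorm_def by (rule onorm_le)

lemma opnorm_add: "opnorm (M + N) \<le> opnorm M + opnorm N"
proof (rule opnorm_le)
  fix v
  have "norm ((M + N) *v v) \<le> norm (M *v v) + norm (N *v v)"
    by (simp add: matrix_vector_mult_add_rdistrib norm_triangle_ineq)
  also have "\<dots> \<le> (opnorm M + opnorm N) * norm v"
    using opnorm_mult[of M v] opnorm_mult[of N v] by (simp add: algebra_simps)
  finally show "norm ((M + N) *v v) \<le> (opnorm M + opnorm N) * norm v" .
qed

text \<open>The \<open>norm\<close> of a matrix type is the Frobenius norm; apply Cauchy-Schwarz to
  every row.\<close>

lemma opnorm_le_norm:
  fixes M :: "real^'n^'k"
  shows "opnorm M \<le> norm M"
proof (rule opnorm_le)
  fix v
  have "norm (M *v v) = L2_set (\<lambda>i. norm (inner (M $ i) v)) UNIV"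
    by (simp add: norm_vec_def matrix_vector_mult_def inner_vec_def)
  also have "\<dots> \<le> L2_set (\<lambda>i. norm (M $ i) * norm v) UNIV"
    by (intro L2_set_mono) (auto simp: Cauchy_Schwarz_ineq2)
  also have "\<dots> = norm M * norm v"
    by (simp add: norm_vec_def[of M] L2_set_left_distrib)
  finally show "norm (M *v v) \<le> norm M * norm v" .
qed

text \<open>Each entry is a coordinate of the image of a basis vector, hence at most
  \<open>opnorm M\<close>; the Frobenius norm is at most the sum of all entries' moduli.\<close>

lemma norm_le_opnorm:
  fixes M :: "real^'n^'k"
  shows "norm M \<le> real (CARD('k) * CARD('n)) * opnorm M"
proof -
  have entry: "norm (M $ i $ j) \<le> opnorm M" for i j
  proof -
    have "M $ i $ j = (M *v axis j 1) $ i" by (simp add: matrix_vector_mult_basis column_def)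
    then have "norm (M $ i $ j) \<le> norm (M *v axis j 1)"
      by (metis component_le_norm_cart real_norm_def)
    also have "\<dots> \<le> opnorm M" using opnorm_mult[of M "axis j 1"] by simp
    finally show ?thesis .
  qed
  have "norm M \<le> (\<Sum>i\<in>UNIV. norm (M $ i))"
    unfolding norm_vec_def[of M] by (intro L2_set_le_sum) auto
  also have "\<dots> \<le> (\<Sum>i\<in>(UNIV::'k set). \<Sum>j\<in>(UNIV::'n set). norm (M $ i $ j))"
    by (intro sum_mono) (simp add: norm_vec_def L2_set_le_sum)
  also have "\<dots> \<le> (\<Sum>i\<in>(UNIV::'k set). \<Sum>j\<in>(UNIV::'n set). opnorm M)"
    by (intro sum_mono entry)
  finally show ?thesis by simp
qed

section \<open>Uniqueness and linearity of the mesh limit\<close>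

lemma fine_partition:
  assumes "s \<le> t" "0 < (\<delta>::real)"
  obtains P where "P \<in> partitions s t" "\<forall>i<fst P. snd P (Suc i) - snd P i < \<delta>"
proof (cases "s = t")
  case True
  then show ?thesis by (intro that[of "(0, \<lambda>_. s)"]) (auto simp: partitions_def)
next
  case False
  then have st: "s < t" using assms by simp
  obtain n where n: "(t - s) / \<delta> < real n" using reals_Archimedean2 by blast
  then have n0: "0 < real n" using st assms by (smt (verit) divide_pos_pos)
  define h where "h = (t - s) / real n"
  have "h < \<delta>" "0 < h" "real n * h = t - s" using n n0 st assms by (auto simp: h_def field_simps)
  then show ?thesis
    by (intro that[of "(n, \<lambda>i. s + real i * h)"]) (auto simp: partitions_def algebra_simps)
qed

lemma has_young_integralD:
  assumes "has_young_integral G x s t I" "0 < \<epsilon>"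
  obtains d where "0 < d" "\<And>P. P \<in> partitions s t \<Longrightarrow> \<forall>i<fst P. snd P (Suc i) - snd P i < d \<Longrightarrow>
    norm (young_sum G x P - I) < \<epsilon>"
  using assms unfolding has_young_integral_def by blast

lemma has_young_integral_unique:
  assumes "has_young_integral G x s t I" "has_young_integral G x s t J" "s \<le> t"
  shows "I = J"
proof -
  have "norm (I - J) \<le> \<epsilon>" if e: "0 < \<epsilon>" for \<epsilon>
  proof -
    have "0 < \<epsilon> / 2" using e by simp
    note e2 = this
    obtain d1 where d1: "0 < d1" "\<And>P. P \<in> partitions s t \<Longrightarrow> \<forall>i<fst P. snd P (Suc i) - snd P i < d1 \<Longrightarrow>
      norm (young_sum G x P - I) < \<epsilon> / 2"
      by (rule has_young_integralD[OF assms(1) e2]) (rule that)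
    obtain d2 where d2: "0 < d2" "\<And>P. P \<in> partitions s t \<Longrightarrow> \<forall>i<fst P. snd P (Suc i) - snd P i < d2 \<Longrightarrow>
      norm (young_sum G x P - J) < \<epsilon> / 2"
      by (rule has_young_integralD[OF assms(2) e2]) (rule that)
    obtain P where P: "P \<in> partitions s t" "\<forall>i<fst P. snd P (Suc i) - snd P i < min d1 d2"
      using fine_partition[OF assms(3), of "min d1 d2"] d1 d2 by auto
    have "norm (young_sum G x P - I) < \<epsilon> / 2" "norm (young_sum G x P - J) < \<epsilon> / 2"
      using d1(2)[OF P(1)] d2(2)[OF P(1)] P(2) by auto
    moreover have "I - J = (young_sum G x P - J) - (young_sum G x P - I)" by simp
    ultimately show ?thesis
      using norm_triangle_ineq4[of "young_sum G x P - J" "young_sum G x P - I"] by simp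
  qed
  then have "norm (I - J) \<le> 0" by (rule field_le_epsilon) auto
  then show ?thesis by simp
qed

lemma has_young_integral_cong:
  assumes "\<And>r. s \<le> r \<Longrightarrow> r \<le> t \<Longrightarrow> G r = H r"
  shows "has_young_integral G x s t I \<longleftrightarrow> has_young_integral H x s t I"
proof -
  have "young_sum G x P = young_sum H x P" if "P \<in> partitions s t" for P
    unfolding young_sum_def
    using partition_range[OF that] assms by (intro sum.cong) auto
  then show ?thesis by (simp add: has_young_integral_def)
qed

lemma has_young_integral_diff:
  assumes "has_young_integral G x s t I" "has_young_integral H x s t J"
  shows "has_young_integral (\<lambda>r. G r - H r) x s t (I - J)"
  unfolding has_young_integral_def
proof (intro allI impI)
  fix \<epsilon> :: real assume "0 < \<epsilon>"
  then have "0 < \<epsilon> / 2" by simp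
  note e2 = this
  obtain d1 where d1: "0 < d1" "\<And>P. P \<in> partitions s t \<Longrightarrow> \<forall>i<fst P. snd P (Suc i) - snd P i < d1 \<Longrightarrow>
    norm (young_sum G x P - I) < \<epsilon> / 2"
    by (rule has_young_integralD[OF assms(1) e2]) (rule that)
  obtain d2 where d2: "0 < d2" "\<And>P. P \<in> partitions s t \<Longrightarrow> \<forall>i<fst P. snd P (Suc i) - snd P i < d2 \<Longrightarrow>
    norm (young_sum H x P - J) < \<epsilon> / 2"
    by (rule has_young_integralD[OF assms(2) e2]) (rule that)
  show "\<exists>\<delta>>0. \<forall>P\<in>partitions s t. (\<forall>i<fst P. snd P (Suc i) - snd P i < \<delta>) \<longrightarrow>
      norm (young_sum (\<lambda>r. G r - H r) x P - (I - J)) < \<epsilon>"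
  proof (intro exI[of _ "min d1 d2"] conjI ballI impI)
    fix P assume P: "P \<in> partitions s t" "\<forall>i<fst P. snd P (Suc i) - snd P i < min d1 d2"
    have "norm (young_sum G x P - I) < \<epsilon> / 2" "norm (young_sum H x P - J) < \<epsilon> / 2"
      using d1(2)[OF P(1)] d2(2)[OF P(1)] P(2) by auto
    moreover have eq: "young_sum (\<lambda>r. G r - H r) x P - (I - J) = (young_sum G x P - I) - (young_sum H x P - J)"
      by (simp add: young_sum_def matrix_vector_mult_diff_rdistrib sum_subtractf)
    ultimately show "norm (young_sum (\<lambda>r. G r - H r) x P - (I - J)) < \<epsilon>"
      using norm_triangle_ineq4[of "young_sum G x P - I" "young_sum H x P - J"] unfolding eq by linarith
  qed (use d1 d2 in auto)
qed

section \<open>The Young integral with the prescribed constant\<close>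

definition young_const :: "real \<Rightarrow> real" where "young_const p = 1 / (1 - 2 powr (1 - 2 / p))"

lemma young_const_pos:
  assumes "0 < p" "p < 2"
  shows "0 < young_const p"
proof -
  have "2 powr (1 - 2 / p) < 1"
    using assms by (intro powr_less_one) (auto simp: field_simps)
  then show ?thesis by (simp add: young_const_def)
qed

text \<open>The Young-Loeve estimate; \<open>F\<close> is the indefinite integral.\<close>

theorem young_integral:
  fixes G :: "real \<Rightarrow> real^'m^'d" and x :: "real \<Rightarrow> real^'m" and z :: "real \<Rightarrow> 'z::real_normed_vector"
  assumes p: "1 \<le> p" "p < 2"
    and x: "continuous_on {a..b} x" "finite_pvar x p a b"
    and z: "continuous_on {a..b} z" "finite_pvar z p a b"
    and c: "0 \<le> c" and G: "\<And>u v. a \<le> u \<Longrightarrow> u \<le> v \<Longrightarrow> v \<le> b \<Longrightarrow> opnorm (G v - G u) \<le> c * norm (z v - z u)"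
  obtains F where "\<And>s t. a \<le> s \<Longrightarrow> s \<le> t \<Longrightarrow> t \<le> b \<Longrightarrow> has_young_integral G x s t (F t - F s)"
    "\<And>s t. a \<le> s \<Longrightarrow> s \<le> t \<Longrightarrow> t \<le> b \<Longrightarrow> norm (F t - F s - G s *v (x t - x s)) \<le>
       c * young_const p * pvar_seminorm z p s t * pvar_seminorm x p s t"
proof -
  define \<phi> where "\<phi> = pvar_seminorm z p"
  define \<psi> where "\<psi> = pvar_seminorm x p"
  have p0: "0 < p" using p by simp
  define \<theta> where "\<theta> = 2 / p"
  have theta: "1 < \<theta>" using p p0 by (simp add: \<theta>_def field_simps)
  have pth: "p * \<theta> = 2" using p0 by (simp add: \<theta>_def)
  have pc: "pcontrol p \<phi> a b" "pcontrol p \<psi> a b"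
    unfolding \<phi>_def \<psi>_def using pcontrol_pvar_seminorm z(2) x(2) p0 by auto
  have nn: "0 \<le> \<phi> s t" "0 \<le> \<psi> s t" for s t by (auto simp: \<phi>_def \<psi>_def pvar_seminorm_nonneg)
  have cont: "continuous_on {s..b} (\<phi> s)" "continuous_on {s..b} (\<psi> s)" if "a \<le> s" for s
    unfolding \<phi>_def \<psi>_def using continuous_on_pvar_seminorm[OF _ _ p(1) that] x z by auto
  \<comment> \<open>The increments of \<open>V\<close> dominate both p-th powers at once, so
    \<open>V\<close> serves as the additive majorant that sewing asks for.\<close>
  define V where "V t = \<phi> a t powr p + \<psi> a t powr p" for t
  have V: "\<phi> s t powr p + \<psi> s t powr p \<le> V t - V s" if "a \<le> s" "s \<le> t" "t \<le> b" for s t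
    using pcontrol_super[OF pc(1), of a s t] pcontrol_super[OF pc(2), of a s t] that by (simp add: V_def)
  have V_nn: "0 \<le> V t - V s" if "a \<le> s" "s \<le> t" "t \<le> b" for s t
    using V[OF that] powr_ge_zero[of "\<phi> s t" p] powr_ge_zero[of "\<psi> s t" p] by linarith
  have V_cont: "continuous_on {a..b} V"
    unfolding V_def using cont[of a] p0 nn
    by (intro continuous_on_add continuous_on_powr' continuous_intros) auto
  \<comment> \<open>As \<theta> = 2 / p, this factor turns into exactly \<open>c\<close> under the
    power \<open>\<theta>\<close>; each of \<open>\<phi>\<close> and \<open>\<psi>\<close> is at
    most the p-th root of an increment of \<open>V\<close>.\<close>
  define W where "W t = c powr (p / 2) * V t" for t
  have W_nn: "0 \<le> W t - W s" if "a \<le> s" "s \<le> t" "t \<le> b" for s t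
    using V_nn[OF that] by (simp add: W_def flip: right_diff_distrib)
  define \<Xi> where "\<Xi> s t = G s *v (x t - x s)" for s t
  have Xi_defect: "norm (\<Xi> s t - \<Xi> s u - \<Xi> u t) \<le> c * (\<phi> s t * \<psi> s t)"
    if st: "a \<le> s" "s \<le> u" "u \<le> t" "t \<le> b" for s u t
  proof -
    have "\<Xi> s t - \<Xi> s u - \<Xi> u t = - ((G u - G s) *v (x t - x u))"
      by (simp add: \<Xi>_def matrix_vector_mult_diff_rdistrib matrix_vector_mult_diff_distrib)
    then have "norm (\<Xi> s t - \<Xi> s u - \<Xi> u t) \<le> opnorm (G u - G s) * norm (x t - x u)"
      using opnorm_mult[of "G u - G s" "x t - x u"] by (simp only: norm_minus_cancel)
    also have "\<dots> \<le> (c * \<phi> s u) * \<psi> u t"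
    proof (intro mult_mono)
      have "norm (z u - z s) \<le> \<phi> s u"
        unfolding \<phi>_def by (rule increment_le_pvar_seminorm[OF z(2)]) (use st p0 in auto)
      then show "opnorm (G u - G s) \<le> c * \<phi> s u"
        using G[of s u] st c mult_left_mono order_trans by fastforce
      show "norm (x t - x u) \<le> \<psi> u t"
        unfolding \<psi>_def by (rule increment_le_pvar_seminorm[OF x(2)]) (use st p0 in auto)
    qed (use c nn in auto)
    also have "\<dots> \<le> (c * \<phi> s t) * \<psi> s t"
      using pcontrol_mono[OF pc(1) p(1), of s s u t] pcontrol_mono[OF pc(2) p(1), of s u t t] st c nn
      by (intro mult_mono) auto
    finally show ?thesis by (simp add: mult.assoc)
  qed
  have dW: "c * (\<phi> s t * \<psi> s t) \<le> (W t - W s) powr \<theta>" if st: "a \<le> s" "s \<le> t" "t \<le> b" for s t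
  proof -
    have *: "q \<le> (V t - V s) powr (1 / p)" if "q powr p \<le> V t - V s" "0 \<le> q" for q :: real
    proof -
      have "(q powr p) powr (1 / p) \<le> (V t - V s) powr (1 / p)"
        using that p0 by (intro powr_mono2) auto
      then show ?thesis using that p0 by (simp add: powr_powr)
    qed
    have "\<phi> s t * \<psi> s t \<le> (V t - V s) powr (1 / p) * (V t - V s) powr (1 / p)"
      using V[OF st] powr_ge_zero[of "\<phi> s t" p] powr_ge_zero[of "\<psi> s t" p] nn
      by (intro mult_mono *) (auto simp del: powr_ge_zero)
    also have "\<dots> = (V t - V s) powr \<theta>" by (simp add: \<theta>_def flip: powr_add)
    finally have "c * (\<phi> s t * \<psi> s t) \<le> c * (V t - V s) powr \<theta>" by (rule mult_left_mono[OF _ c])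
    also have "\<dots> = (c powr (p / 2) * (V t - V s)) powr \<theta>"
      using c V_nn[OF st] p0 by (simp add: powr_mult powr_powr \<theta>_def)
    finally show ?thesis by (simp add: W_def right_diff_distrib)
  qed
  interpret sewing \<Xi> W \<theta> a b
  proof
    show "mono_on {a..b} W" using W_nn by (auto intro!: monotone_onI)
    show "continuous_on {a..b} W" unfolding W_def by (intro continuous_intros V_cont)
    show "norm (\<Xi> s t - \<Xi> s u - \<Xi> u t) \<le> (W t - W s) powr \<theta>"
      if "a \<le> s" "s \<le> u" "u \<le> t" "t \<le> b" for s u t
      using Xi_defect[OF that] dW[of s t] that by simp
  qed (rule theta)
  define Z where "Z s t = sewn s t - \<Xi> s t" for s t
  \<comment> \<open>The power p * \<theta> = 2 of \<open>\<rho>\<close> is the product of the two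
    seminorms, so a bound by \<open>(\<rho> s t powr p) powr \<theta>\<close> is the desired
    one.\<close>
  define \<rho> where "\<rho> s t = sqrt (\<phi> s t * \<psi> s t)" for s t
  have pcr: "pcontrol p \<rho> a b"
    unfolding \<rho>_def by (rule pcontrol_geometric_mean[OF pc p0])
  have rho_nn: "0 \<le> \<rho> s t" for s t using nn by (simp add: \<rho>_def)
  have rho_th: "(\<rho> s t powr p) powr \<theta> = \<phi> s t * \<psi> s t" for s t
    using nn[of s t] rho_nn[of s t] by (simp add: powr_powr pth \<rho>_def)
  have K: "young_const p = 1 / (1 - 2 powr (1 - \<theta>))" by (simp add: young_const_def \<theta>_def)
  \<comment> \<open>Bisection needs a crude bound in terms of the bisected function, but sewing
    gives one in terms of \<open>W\<close> alone. Adding \<open>\<epsilon> * (W t - W s)\<close>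
    supplies it with constant \<open>sew_const / \<epsilon> powr \<theta>\<close>, whose size is
    irrelevant since bisection removes it.\<close>
  have bound_eps: "norm (Z s t) \<le> c * young_const p * (\<rho> s t powr p + \<epsilon> * (W t - W s)) powr \<theta>"
    if e: "0 < \<epsilon>" and st: "a \<le> s" "s \<le> t" "t \<le> b" for \<epsilon> s t
  proof -
    define Q where "Q s t = \<rho> s t powr p + \<epsilon> * (W t - W s)" for s t
    have Q_nn: "0 \<le> Q s t" if "a \<le> s" "s \<le> t" "t \<le> b" for s t
      using e W_nn[OF that] by (simp add: Q_def)
    have "norm (Z s t) \<le> c / (1 - 2 powr (1 - \<theta>)) * Q s t powr \<theta>"
    proof (rule bisection_bound[where a = a and b = b and Z = Z and Q = Q and c = c and C = "sew_const / \<epsilon> powr \<theta>", OF theta])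
      fix s t assume st: "a \<le> s" "s \<le> t" "t \<le> b"
      \<comment> \<open>By continuity, and since \<open>Q s\<close> vanishes at \<open>s\<close>,
        some \<open>u\<close> leaves exactly half of \<open>Q s t\<close> on the left;
        superadditivity leaves at most half on the right.\<close>
      have "continuous_on {s..t} (Q s)"
        unfolding Q_def \<rho>_def W_def using cont[OF st(1)] V_cont st p0 nn
        by (intro continuous_on_add continuous_on_powr' continuous_intros)
          (auto intro: continuous_on_subset)
      moreover have "Q s s = 0"
        using pcontrol_diag[OF pcr, of s] st by (simp add: Q_def)
      ultimately obtain u where u: "s \<le> u" "u \<le> t" "Q s u = Q s t / 2"
        using IVT'[of "Q s" s "Q s t / 2" t] Q_nn[OF st] st by auto
      have "Q s u + Q u t \<le> Q s t"
        using pcontrol_super[OF pcr, of s u t] u st by (simp add: Q_def algebra_simps)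
      then have "Q u t \<le> Q s t / 2" using u(3) by simp
      have "Z s t = Z s u + Z u t + - (\<Xi> s t - \<Xi> s u - \<Xi> u t)"
        using sewn_additive[of s u t] u st by (simp add: Z_def algebra_simps)
      then have "norm (Z s t) \<le> norm (Z s u) + norm (Z u t) + norm (\<Xi> s t - \<Xi> s u - \<Xi> u t)"
        by (metis norm_triangle_le norm_triangle_ineq add_mono order_refl norm_minus_cancel)
      moreover have "norm (\<Xi> s t - \<Xi> s u - \<Xi> u t) \<le> c * Q s t powr \<theta>"
      proof -
        have "norm (\<Xi> s t - \<Xi> s u - \<Xi> u t) \<le> c * (\<rho> s t powr p) powr \<theta>"
          unfolding rho_th using u st by (intro Xi_defect) auto
        also have "\<dots> \<le> c * Q s t powr \<theta>"
          using c theta e W_nn[OF st] by (intro mult_left_mono powr_mono2) (auto simp: Q_def)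
        finally show ?thesis .
      qed
      ultimately have "norm (Z s t) \<le> c * Q s t powr \<theta> + norm (Z s u) + norm (Z u t)"
        by simp
      then show "\<exists>u\<in>{s..t}. Q s u \<le> Q s t / 2 \<and> Q u t \<le> Q s t / 2 \<and>
          norm (Z s t) \<le> c * Q s t powr \<theta> + norm (Z s u) + norm (Z u t)"
        using u \<open>Q u t \<le> Q s t / 2\<close> by (intro bexI[of _ u]) auto
      have "norm (Z s t) \<le> sew_const * (W t - W s) powr \<theta>"
        unfolding Z_def by (rule sewn_local[OF st])
      also have "\<dots> = sew_const / \<epsilon> powr \<theta> * (\<epsilon> * (W t - W s)) powr \<theta>"
        using e W_nn[OF st] by (simp add: powr_mult)
      also have "\<dots> \<le> sew_const / \<epsilon> powr \<theta> * Q s t powr \<theta>"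
        using e W_nn[OF st] theta sew_const_pos
        by (intro mult_left_mono powr_mono2) (auto simp: Q_def)
      finally show "norm (Z s t) \<le> sew_const / \<epsilon> powr \<theta> * Q s t powr \<theta>" .
    qed (use Q_nn c sew_const_pos st in auto)
    then show ?thesis by (simp add: K Q_def)
  qed
  have bound: "norm (Z s t) \<le> c * young_const p * (\<phi> s t * \<psi> s t)"
    if st: "a \<le> s" "s \<le> t" "t \<le> b" for s t
  proof -
    \<comment> \<open>The constant in front is independent of \<open>\<epsilon>\<close>, so the
      auxiliary term disappears in the limit.\<close>
    have "((\<lambda>\<epsilon>. c * young_const p * (\<rho> s t powr p + \<epsilon> * (W t - W s)) powr \<theta>) \<longlongrightarrow>
        c * young_const p * (\<rho> s t powr p + 0 * (W t - W s)) powr \<theta>) (at_right 0)"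
      using theta W_nn[OF st]
      by (intro tendsto_intros tendsto_powr') (auto simp: eventually_at_filter)
    then have "norm (Z s t) \<le> c * young_const p * (\<rho> s t powr p + 0 * (W t - W s)) powr \<theta>"
      using bound_eps[OF _ st]
      by (intro tendsto_lowerbound) (auto simp: eventually_at_filter)
    then show ?thesis using rho_th by simp
  qed
  show ?thesis
  proof (rule that[of "sewn a"])
    fix s t assume st: "a \<le> s" "s \<le> t" "t \<le> b"
    have add: "sewn a t - sewn a s = sewn s t" using sewn_additive[of a s t] st by (simp add: algebra_simps)
    have "\<exists>\<delta>>0. \<forall>P\<in>partitions s t. (\<forall>i<fst P. snd P (Suc i) - snd P i < \<delta>) \<longrightarrow>
      norm (young_sum G x P - sewn s t) < \<epsilon>" if e: "0 < \<epsilon>" for \<epsilon>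
    proof -
      have "0 < \<epsilon> / 2" using e by simp
      note e2 = this
      obtain \<delta> where d: "0 < \<delta>"
        "\<And>P. P \<in> partitions s t \<Longrightarrow> \<forall>i<fst P. snd P (Suc i) - snd P i < \<delta> \<Longrightarrow>
          norm ((\<Sum>i<fst P. \<Xi> (snd P i) (snd P (Suc i))) - sewn s t) \<le> \<epsilon> / 2"
        by (rule Riemann_sums_converge[OF st e2]) (rule that)
      have "norm (young_sum G x P - sewn s t) < \<epsilon>"
        if "P \<in> partitions s t" "\<forall>i<fst P. snd P (Suc i) - snd P i < \<delta>" for P
        using d(2)[OF that] e by (simp add: young_sum_def \<Xi>_def)
      with d(1) show ?thesis by blast
    qed
    then show "has_young_integral G x s t (sewn a t - sewn a s)"
      unfolding has_young_integral_def add by blast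
    show "norm (sewn a t - sewn a s - G s *v (x t - x s)) \<le>
       c * young_const p * pvar_seminorm z p s t * pvar_seminorm x p s t"
      unfolding add using bound[OF st] by (simp add: Z_def \<Xi>_def \<phi>_def \<psi>_def mult.assoc)
  qed
qed

section \<open>Greedy times\<close>

locale greedy =
  fixes x :: "real \<Rightarrow> 'a::real_normed_vector" and p \<gamma> a b :: real
  assumes p1: "1 \<le> p" and x_cont: "continuous_on {a..b} x" and x_pvar: "finite_pvar x p a b"
    and gamma_pos: "0 < \<gamma>" and ab: "a < b"
begin

abbreviation \<tau> :: "nat \<Rightarrow> real" where "\<tau> \<equiv> greedy_time x p \<gamma> a b"

text \<open>One step of the recursion from an arbitrary start \<open>s\<close>; the hypothesis on
  \<open>t\<close> copies its body so that it applies to every \<open>\<tau> k\<close>. If the level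
  \<open>\<gamma>\<close> is never attained, the intermediate value theorem keeps the seminorm at or
  below it up to \<open>b\<close>.\<close>

lemma greedy_step:
  assumes s: "a \<le> s" "s \<le> b"
    and t: "t = (let S = {t. s < t \<and> t \<le> b \<and> pvar_seminorm x p s t = \<gamma>} in if S = {} then b else min (Inf S) b)"
  shows "s \<le> t" "t \<le> b" "pvar_seminorm x p s t \<le> \<gamma>" "t < b \<Longrightarrow> pvar_seminorm x p s t = \<gamma>"
proof -
  define S where "S = {t. s < t \<and> t \<le> b \<and> pvar_seminorm x p s t = \<gamma>}"
  have cont: "continuous_on {s..b} (pvar_seminorm x p s)"
    by (rule continuous_on_pvar_seminorm[OF x_cont x_pvar p1 s(1)])
  have s0: "pvar_seminorm x p s s = 0" using pvar_seminorm_diag(2)[of p x s] p1 by simp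
  \<comment> \<open>The left endpoint may be included because the seminorm is 0 there and
    \<open>\<gamma>\<close> is positive. So \<open>S\<close> is a closed preimage and contains its
    infimum.\<close>
  have S': "S = {s..b} \<inter> pvar_seminorm x p s -` {\<gamma>}"
    using s0 gamma_pos by (force simp: S_def less_le)
  have "closed S"
    unfolding S' by (rule continuous_closed_preimage[OF cont]) auto
  have "s \<le> t \<and> t \<le> b \<and> pvar_seminorm x p s t \<le> \<gamma> \<and> (t < b \<longrightarrow> pvar_seminorm x p s t = \<gamma>)"
  proof (cases "S = {}")
    case True
    then have "t = b" using t by (simp add: S_def[symmetric])
    moreover have "pvar_seminorm x p s b \<le> \<gamma>"
    proof (rule ccontr)
      assume "\<not> pvar_seminorm x p s b \<le> \<gamma>"
      then have "\<exists>u\<ge>s. u \<le> b \<and> pvar_seminorm x p s u = \<gamma>"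
        using s0 gamma_pos s by (intro IVT' cont) auto
      then show False using True unfolding S' by auto
    qed
    ultimately show ?thesis using s by auto
  next
    case False
    have bd: "bdd_below S" by (auto simp: S_def bdd_below_def intro!: exI[of _ s])
    have "Inf S \<in> S" by (rule closed_contains_Inf[OF False bd \<open>closed S\<close>])
    moreover from this have "t = Inf S" using t False by (auto simp: S_def[symmetric] Let_def) (auto simp: S_def)
    ultimately show ?thesis by (auto simp: S_def)
  qed
  then show "s \<le> t" "t \<le> b" "pvar_seminorm x p s t \<le> \<gamma>" "t < b \<Longrightarrow> pvar_seminorm x p s t = \<gamma>"
    by auto
qed

lemma greedy_range: "a \<le> \<tau> k \<and> \<tau> k \<le> b"
proof (induction k)
  case (Suc k)
  then show ?case using greedy_step(1,2)[of "\<tau> k" "\<tau> (Suc k)"] by auto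
qed (use ab in simp)

lemma greedy_properties:
  "\<tau> k \<le> \<tau> (Suc k)" "pvar_seminorm x p (\<tau> k) (\<tau> (Suc k)) \<le> \<gamma>"
  "\<tau> (Suc k) < b \<Longrightarrow> pvar_seminorm x p (\<tau> k) (\<tau> (Suc k)) = \<gamma>"
  using greedy_step[of "\<tau> k" "\<tau> (Suc k)"] greedy_range[of k] by auto

text \<open>Every step ending before \<open>b\<close> consumes \<open>\<gamma> powr p\<close> of the
  finite total \<open>pvar_seminorm x p a b powr p\<close>, by superadditivity.\<close>

lemma greedy_terminates: "\<exists>k\<ge>1. \<tau> k = b"
proof (rule ccontr)
  assume "\<not> (\<exists>k\<ge>1. \<tau> k = b)"
  then have lt: "\<tau> (Suc k) < b" for k
    using greedy_range[of "Suc k"] by (metis One_nat_def Suc_le_mono le0 less_le)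
  have "real n * \<gamma> powr p \<le> pvar_seminorm x p a b powr p" for n
  proof -
    have pc: "pcontrol p (pvar_seminorm x p) a b"
      using p1 by (intro pcontrol_pvar_seminorm x_pvar) auto
    have "(\<Sum>i<n. pvar_seminorm x p (\<tau> i) (\<tau> (Suc i)) powr p) \<le> pvar_seminorm x p (\<tau> 0) (\<tau> n) powr p"
      using greedy_range greedy_properties(1) by (intro pcontrol_sum[OF pc]) auto
    moreover have "pvar_seminorm x p (\<tau> i) (\<tau> (Suc i)) = \<gamma>" for i
      by (rule greedy_properties(3)[OF lt])
    moreover have "pvar_seminorm x p (\<tau> 0) (\<tau> n) powr p \<le> pvar_seminorm x p a b powr p"
      using greedy_range[of 0] greedy_range[of n] p1
      by (intro powr_mono2 pcontrol_mono[OF pc]) (auto simp: pvar_seminorm_nonneg)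
    ultimately show ?thesis by simp
  qed
  moreover obtain n where "pvar_seminorm x p a b powr p / \<gamma> powr p < real n"
    using reals_Archimedean2 by blast
  ultimately show False using gamma_pos by (simp add: field_simps not_less[symmetric])
qed

lemma greedy_N: "1 \<le> greedy_N x p \<gamma> a b" "\<tau> (greedy_N x p \<gamma> a b) = b"
  using LeastI_ex[of "\<lambda>k. 1 \<le> k \<and> \<tau> k = b"] greedy_terminates unfolding greedy_N_def by auto

end

section \<open>A priori estimates\<close>

text \<open>Adding m / k makes the affine inequality linear: the shifted right-hand side
  \<open>\<Phi>\<close> has derivative at most \<open>k * \<Phi>\<close>, so \<open>\<Phi>\<close>
  times the decaying exponential does not increase.\<close>

lemma Gronwall:
  fixes u :: "real \<Rightarrow> real"
  assumes u: "continuous_on {s..t} u" and k: "0 < k" and st: "s \<le> t"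
    and le: "\<And>r. s \<le> r \<Longrightarrow> r \<le> t \<Longrightarrow> u r \<le> c + integral {s..r} (\<lambda>v. m + k * u v)"
  shows "u t + m / k \<le> (c + m / k) * exp (k * (t - s))"
proof -
  define \<Phi> where "\<Phi> r = c + integral {s..r} (\<lambda>v. m + k * u v) + m / k" for r
  define \<Psi> where "\<Psi> r = \<Phi> r * exp (- k * (r - s))" for r
  have cont: "continuous_on {s..t} (\<lambda>v. m + k * u v)" by (intro continuous_intros u)
  have D: "(\<Phi> has_real_derivative m + k * u r) (at r within {s..t})" if "r \<in> {s..t}" for r
    unfolding \<Phi>_def using integral_has_real_derivative[OF cont that]
    by (auto intro!: derivative_eq_intros)
  have "\<Psi> t \<le> \<Psi> s"
  proof (rule DERIV_nonpos_imp_decreasing_open[OF st])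
    fix r assume r: "s < r" "r < t"
    then have "(\<Phi> has_real_derivative m + k * u r) (at r)"
      using D[of r] by (simp add: at_within_Icc_at)
    then have "(\<Psi> has_real_derivative (m + k * u r) * exp (- k * (r - s)) + \<Phi> r * (exp (- k * (r - s)) * - k)) (at r)"
      unfolding \<Psi>_def by (auto intro!: derivative_eq_intros)
    moreover have "(m + k * u r) * exp (- k * (r - s)) + \<Phi> r * (exp (- k * (r - s)) * - k)
        = (m + k * u r - k * \<Phi> r) * exp (- k * (r - s))" by (simp add: algebra_simps)
    moreover have "m + k * u r - k * \<Phi> r \<le> 0"
      using mult_left_mono[OF le[of r], of k] r k by (simp add: \<Phi>_def distrib_left)
    ultimately show "\<exists>y. (\<Psi> has_real_derivative y) (at r) \<and> y \<le> 0"
      by (metis exp_ge_zero mult_nonpos_nonneg)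
  next
    have "continuous_on {s..t} \<Phi>"
      using D by (rule DERIV_continuous_on)
    then show "continuous_on {s..t} \<Psi>" unfolding \<Psi>_def by (intro continuous_intros)
  qed
  then have "\<Phi> t * exp (- k * (t - s)) * exp (k * (t - s)) \<le> (c + m / k) * exp (k * (t - s))"
    by (intro mult_right_mono) (simp_all add: \<Psi>_def \<Phi>_def)
  moreover have "\<Phi> t * exp (- k * (t - s)) * exp (k * (t - s)) = \<Phi> t"
    by (simp add: mult.assoc flip: exp_add)
  ultimately have "\<Phi> t \<le> (c + m / k) * exp (k * (t - s))" by (simp only:)
  then show ?thesis using le[of t] st by (simp add: \<Phi>_def)
qed

section \<open>The equation on subintervals of [a, b]\<close>

locale young_ode =
  fixes A :: "real^'d^'d" and f :: "real^'d \<Rightarrow> real^'d" and g :: "real^'d \<Rightarrow> real^'m^'d"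
    and x :: "real \<Rightarrow> real^'m" and p a b C_f C_g :: real
  assumes p: "1 < p" "p < 2"
    and f_lip: "0 \<le> C_f" "\<forall>u v. norm (f u - f v) \<le> C_f * norm (u - v)"
    and g_lip: "0 < C_g" "\<forall>u v. opnorm (g u - g v) \<le> C_g * norm (u - v)"
    and g_C1: "\<exists>Dg. (\<forall>u. (g has_derivative Dg u) (at u)) \<and>
                 (\<exists>C. \<forall>u v. onorm (\<lambda>h. Dg u h - Dg v h) \<le> C * norm (u - v))"
    and L_pos: "0 < opnorm A + C_f"
    and x_cont: "continuous_on {a..b} x" and x_pvar: "finite_pvar x p a b"
    and ab: "a < b"
begin

definition L :: real where "L = opnorm A + C_f"
definition K :: real where "K = young_const p"
definition \<gamma> :: real where "\<gamma> = 1 / (2 * (K + 1) * C_g)"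
definition \<alpha> :: real where "\<alpha> = ln (1 + 1 / (K + 1))"
definition M0 :: real where "M0 = norm (f 0) / L + opnorm (g 0) / ((K + 1) * C_g)"
definition drift :: "real^'d \<Rightarrow> real^'d" where "drift v = A *v v + f v"

abbreviation X :: "real \<Rightarrow> real \<Rightarrow> real" where "X \<equiv> pvar_seminorm x p"

lemma p1: "1 \<le> p" "0 < p" using p by auto

lemma K_pos: "0 < K" unfolding K_def using young_const_pos p by simp

lemma Lpos: "0 < L" using L_pos by (simp add: L_def)

lemma gamma_pos: "0 < \<gamma>" using K_pos g_lip by (simp add: \<gamma>_def)

lemma M0_nonneg: "0 \<le> M0"
  using Lpos K_pos g_lip opnorm_nonneg[of "g 0"] by (simp add: M0_def)

lemma exp_alpha: "exp \<alpha> = 1 + 1 / (K + 1)"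
  using K_pos by (simp add: \<alpha>_def add_pos_pos)

lemma alpha_nonneg: "0 \<le> \<alpha>"
  using K_pos by (simp add: \<alpha>_def)

lemma drift_lip: "norm (drift v - drift w) \<le> L * norm (v - w)"
proof -
  have "drift v - drift w = A *v (v - w) + (f v - f w)"
    by (simp add: drift_def matrix_vector_mult_diff_distrib)
  then have "norm (drift v - drift w) \<le> norm (A *v (v - w)) + norm (f v - f w)"
    by (simp add: norm_triangle_ineq)
  also have "\<dots> \<le> opnorm A * norm (v - w) + C_f * norm (v - w)"
    using f_lip by (intro add_mono opnorm_mult) auto
  finally show ?thesis by (simp add: L_def distrib_right)
qed

lemma drift_bound: "norm (drift v) \<le> L * norm v + norm (f 0)"
  using drift_lip[of v 0] norm_triangle_sub[of "drift v" "drift 0"] by (simp add: drift_def)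

lemma drift_cont: "continuous_on S y \<Longrightarrow> continuous_on S (\<lambda>r. drift (y r))"
proof -
  have "L-lipschitz_on UNIV drift"
    using drift_lip Lpos by (intro lipschitz_onI) (auto simp: dist_norm)
  then have "continuous_on UNIV drift" by (rule lipschitz_on_continuous_on)
  then show "continuous_on S y \<Longrightarrow> continuous_on S (\<lambda>r. drift (y r))"
    by (rule continuous_on_compose2) auto
qed

lemma g_bound: "opnorm (g v) \<le> opnorm (g 0) + C_g * norm v"
  using opnorm_add[of "g 0" "g v - g 0"] g_lip(2)[rule_format, of v 0] by simp

lemma x_ctrl: "a \<le> s \<Longrightarrow> t \<le> b \<Longrightarrow> pcontrol p X s t"
  by (rule pcontrol_subset[OF pcontrol_pvar_seminorm[OF x_pvar p1(2)]])

lemma x_sub: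
  assumes "a \<le> s" "s \<le> t" "t \<le> b"
  shows "continuous_on {s..t} x" "finite_pvar x p s t"
  using assms x_cont finite_pvar_subset[OF x_pvar] by (auto intro: continuous_on_subset)

definition young_path :: "(real \<Rightarrow> real^'d) \<Rightarrow> real \<Rightarrow> real \<Rightarrow> bool" where
  "young_path y s t \<longleftrightarrow> a \<le> s \<and> s \<le> t \<and> t \<le> b \<and> continuous_on {s..t} y \<and> finite_pvar y p s t"

lemma young_pathD:
  assumes "young_path y s t"
  shows "a \<le> s" "s \<le> t" "t \<le> b" "continuous_on {s..t} y" "finite_pvar y p s t"
  using assms by (auto simp: young_path_def)

lemma young_path_subset:
  "young_path y s t \<Longrightarrow> s \<le> s' \<Longrightarrow> s' \<le> t' \<Longrightarrow> t' \<le> t \<Longrightarrow> young_path y s' t'"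
  unfolding young_path_def
  by (auto intro: continuous_on_subset finite_pvar_subset)

lemma young_integral_g:
  assumes y: "young_path y s t"
  obtains F where "\<And>u v. s \<le> u \<Longrightarrow> u \<le> v \<Longrightarrow> v \<le> t \<Longrightarrow> has_young_integral (\<lambda>r. g (y r)) x u v (F v - F u)"
    "\<And>u v. s \<le> u \<Longrightarrow> u \<le> v \<Longrightarrow> v \<le> t \<Longrightarrow> norm (F v - F u - g (y u) *v (x v - x u)) \<le>
       C_g * K * pvar_seminorm y p u v * X u v"
proof -
  note yD = young_pathD[OF y]
  show ?thesis
  \<comment> \<open>The path \<open>y\<close> itself controls the integrand with c = C_g, so the
    Lipschitz constant for the operator norm enters, without any dimension factor.\<close>
  proof (rule young_integral[OF p1(1) p(2) x_sub[OF yD(1-3)] yD(4,5), of C_g "\<lambda>r. g (y r)"])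
    show "0 \<le> C_g" using g_lip by simp
    show "opnorm (g (y v) - g (y u)) \<le> C_g * norm (y v - y u)" for u v
      using g_lip by simp
  qed (rule that, simp_all add: K_def)
qed

text \<open>The graph of the Picard map, restarted at time \<open>s\<close>: a relation, so that no
  value of the integral has to be chosen. A fixed point \<open>picard s t ys y y\<close> is a
  solution on [s, t].\<close>

definition picard :: "real \<Rightarrow> real \<Rightarrow> real^'d \<Rightarrow> (real \<Rightarrow> real^'d) \<Rightarrow> (real \<Rightarrow> real^'d) \<Rightarrow> bool" where
  "picard s t ys y w \<longleftrightarrow> (\<forall>r\<in>{s..t}. \<exists>I. has_young_integral (\<lambda>v. g (y v)) x s r I \<and>
     w r = ys + integral {s..r} (\<lambda>v. drift (y v)) + I)"

lemma picard_exists: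
  assumes "young_path y s t"
  obtains w where "picard s t ys y w"
proof -
  obtain F where "\<And>u v. s \<le> u \<Longrightarrow> u \<le> v \<Longrightarrow> v \<le> t \<Longrightarrow> has_young_integral (\<lambda>r. g (y r)) x u v (F v - F u)"
    by (rule young_integral_g[OF assms]) (rule that)
  then have "picard s t ys y (\<lambda>r. ys + integral {s..r} (\<lambda>v. drift (y v)) + (F r - F s))"
    by (auto simp: picard_def)
  then show ?thesis by (rule that)
qed

text \<open>Uniqueness of the integral identifies the separate values at each time with increments
  of a single indefinite integral \<open>F\<close>; this makes the equation available between any
  two times.\<close>

lemma picard_increments:
  assumes y: "young_path y s t" and w: "picard s t ys y w"
  obtains F where "\<And>u v. s \<le> u \<Longrightarrow> u \<le> v \<Longrightarrow> v \<le> t \<Longrightarrow> has_young_integral (\<lambda>r. g (y r)) x u v (F v - F u)"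
    "\<And>u v. s \<le> u \<Longrightarrow> u \<le> v \<Longrightarrow> v \<le> t \<Longrightarrow> norm (F v - F u - g (y u) *v (x v - x u)) \<le>
       C_g * K * pvar_seminorm y p u v * X u v"
    "\<And>u v. s \<le> u \<Longrightarrow> u \<le> v \<Longrightarrow> v \<le> t \<Longrightarrow> w v - w u = integral {u..v} (\<lambda>r. drift (y r)) + (F v - F u)"
    "w s = ys"
proof -
  note yD = young_pathD[OF y]
  obtain F where F: "\<And>u v. s \<le> u \<Longrightarrow> u \<le> v \<Longrightarrow> v \<le> t \<Longrightarrow> has_young_integral (\<lambda>r. g (y r)) x u v (F v - F u)"
    "\<And>u v. s \<le> u \<Longrightarrow> u \<le> v \<Longrightarrow> v \<le> t \<Longrightarrow> norm (F v - F u - g (y u) *v (x v - x u)) \<le>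
       C_g * K * pvar_seminorm y p u v * X u v"
    by (rule young_integral_g[OF y]) (rule that)
  have wr: "w r = ys + integral {s..r} (\<lambda>v. drift (y v)) + (F r - F s)" if sr: "s \<le> r" "r \<le> t" for r
  proof -
    obtain I where "has_young_integral (\<lambda>v. g (y v)) x s r I" "w r = ys + integral {s..r} (\<lambda>v. drift (y v)) + I"
      using w sr unfolding picard_def by force
    then show ?thesis using has_young_integral_unique[OF _ F(1)[of s r]] sr by auto
  qed
  have "w v - w u = integral {u..v} (\<lambda>r. drift (y r)) + (F v - F u)" if "s \<le> u" "u \<le> v" "v \<le> t" for u v
  proof -
    have "(\<lambda>r. drift (y r)) integrable_on {s..v}"
      using that yD(4) by (intro integrable_continuous_interval drift_cont) (auto intro: continuous_on_subset)
    then have eq: "integral {s..u} (\<lambda>r. drift (y r)) + integral {u..v} (\<lambda>r. drift (y r)) = integral {s..v} (\<lambda>r. drift (y r))"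
      using that by (intro Henstock_Kurzweil_Integration.integral_combine) auto
    show ?thesis using wr[of u] wr[of v] that by (simp flip: eq)
  qed
  moreover have "w s = ys" using wr[of s] yD by simp
  ultimately show ?thesis using F that by blast
qed

lemma is_solution_iff:
  assumes "a \<le> s" "s \<le> t" "t \<le> b"
  shows "is_solution A f g x p s t ys y \<longleftrightarrow> young_path y s t \<and> picard s t ys y y"
  using assms by (simp add: is_solution_def young_path_def picard_def drift_def)

text \<open>The drift integral is deliberately left unevaluated, so that Gronwall's inequality can
  act on it later; the leading term of the Young integral uses the sup bound \<open>R\<close>, the
  remainder the p-variation of \<open>y\<close>.\<close>

lemma picard_increment_bound:
  assumes y: "young_path y s t" and w: "picard s t ys y w"
    and R: "\<And>r. s \<le> r \<Longrightarrow> r \<le> t \<Longrightarrow> norm (y r) \<le> R"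
    and uv: "s \<le> u" "u \<le> v" "v \<le> t"
  shows "norm (w v - w u) \<le> integral {u..v} (\<lambda>r. L * norm (y r) + norm (f 0))
    + ((opnorm (g 0) + C_g * R) * X u v + C_g * K * (pvar_seminorm y p u v * X u v))"
proof -
  note yD = young_pathD[OF y]
  obtain F where F: "\<And>u v. s \<le> u \<Longrightarrow> u \<le> v \<Longrightarrow> v \<le> t \<Longrightarrow> norm (F v - F u - g (y u) *v (x v - x u)) \<le>
       C_g * K * pvar_seminorm y p u v * X u v"
    "\<And>u v. s \<le> u \<Longrightarrow> u \<le> v \<Longrightarrow> v \<le> t \<Longrightarrow> w v - w u = integral {u..v} (\<lambda>r. drift (y r)) + (F v - F u)"
    by (rule picard_increments[OF y w]) (rule that)
  have cy: "continuous_on {u..v} y" using yD(4) uv by (auto intro: continuous_on_subset)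
  have 1: "norm (integral {u..v} (\<lambda>r. drift (y r))) \<le> integral {u..v} (\<lambda>r. L * norm (y r) + norm (f 0))"
    by (intro integral_norm_bound_integral integrable_continuous_interval drift_cont cy continuous_intros)
      (rule drift_bound)
  have "norm (g (y u) *v (x v - x u)) \<le> opnorm (g (y u)) * norm (x v - x u)" by (rule opnorm_mult)
  also have "\<dots> \<le> (opnorm (g 0) + C_g * R) * X u v"
  proof (intro mult_mono)
    have "opnorm (g (y u)) \<le> opnorm (g 0) + C_g * norm (y u)" by (rule g_bound)
    also have "\<dots> \<le> opnorm (g 0) + C_g * R"
      using R[of u] uv g_lip by simp
    finally show b: "opnorm (g (y u)) \<le> opnorm (g 0) + C_g * R" .
    show "0 \<le> opnorm (g 0) + C_g * R" using b opnorm_nonneg order_trans by blast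
    show "norm (x v - x u) \<le> X u v"
      using uv yD p1 by (intro increment_le_pvar_seminorm[OF x_pvar]) auto
  qed simp
  finally have 2: "norm (g (y u) *v (x v - x u)) \<le> (opnorm (g 0) + C_g * R) * X u v" .
  have "w v - w u = integral {u..v} (\<lambda>r. drift (y r)) + (g (y u) *v (x v - x u) + (F v - F u - g (y u) *v (x v - x u)))"
    using F(2)[OF uv] by simp
  then have "norm (w v - w u) \<le> norm (integral {u..v} (\<lambda>r. drift (y r)))
     + (norm (g (y u) *v (x v - x u)) + norm (F v - F u - g (y u) *v (x v - x u)))"
    by (metis norm_triangle_le norm_triangle_ineq add_left_mono order_refl)
  then show ?thesis using 1 2 F(1)[OF uv] by (simp add: mult.assoc)
qed

lemma young_path_norm_le:
  assumes "young_path y s t" "s \<le> r" "r \<le> t"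
  shows "norm (y r) \<le> norm (y s) + pvar_seminorm y p s r"
    "pvar_seminorm y p s r \<le> pvar_seminorm y p s t"
proof -
  note yD = young_pathD[OF assms(1)]
  have "norm (y r - y s) \<le> pvar_seminorm y p s r"
    using assms p1 by (intro increment_le_pvar_seminorm[OF yD(5)]) auto
  then show "norm (y r) \<le> norm (y s) + pvar_seminorm y p s r"
    using norm_triangle_sub[of "y r" "y s"] by simp
  show "pvar_seminorm y p s r \<le> pvar_seminorm y p s t"
    using assms by (intro pcontrol_mono[OF pcontrol_pvar_seminorm[OF yD(5) p1(2)] p1(1)]) auto
qed

lemma solution_small_interval:
  assumes y: "young_path y s t" and sol: "picard s t ys y y" and X: "X s t \<le> \<gamma>"
  shows "norm (y s) + pvar_seminorm y p s t \<le> (exp \<alpha> * norm (y s) + M0) * exp (2 * L * (t - s))"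
proof -
  note yD = young_pathD[OF y]
  define S where "S r = pvar_seminorm y p s r" for r
  define h where "h r = L * norm (y r) + norm (f 0)" for r
  have h_cont: "continuous_on {s..t} h" unfolding h_def by (intro continuous_intros yD(4))
  have h_nn: "0 \<le> h r" for r using Lpos by (simp add: h_def)
  have h_int: "h integrable_on {u..v}" if "s \<le> u" "v \<le> t" for u v
    using that by (intro integrable_continuous_interval continuous_on_subset[OF h_cont]) auto
  define c where "c = exp \<alpha> * norm (y s) + opnorm (g 0) / ((K + 1) * C_g)"
  have key: "S r \<le> 2 * integral {s..r} h + (opnorm (g 0) / ((K + 1) * C_g) + norm (y s) / (K + 1))"
    if r: "s \<le> r" "r \<le> t" for r
  proof -
    define H where "H u = integral {s..u} h" for u
    have Hd: "H v - H u = integral {u..v} h" if "s \<le> u" "u \<le> v" "v \<le> t" for u v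
      using Henstock_Kurzweil_Integration.integral_combine[of s u v h] h_int[of s v] that
      by (simp add: H_def)
    have "mono_on {s..r} H"
    proof (rule monotone_onI)
      fix u v assume "u \<in> {s..r}" "v \<in> {s..r}" "u \<le> v"
      then have "H v - H u = integral {u..v} h" "0 \<le> integral {u..v} h"
        using r Hd[of u v] h_int[of u v] h_nn by (auto intro: integral_nonneg)
      then show "H u \<le> H v" by simp
    qed
    have ne: "K + 1 \<noteq> 0" "C_g \<noteq> 0" using K_pos g_lip by auto
    have gam: "q * c * (1 / (2 * q * c)) = 1 / 2" "2 * (1 / (2 * q * c)) = 1 / (q * c)"
      "2 * (c * (1 / (2 * q * c))) = 1 / q" if "q \<noteq> 0" "c \<noteq> 0" for q c :: real
      using that by (auto simp: field_simps)
    \<comment> \<open>The supremum of |y| on [s, r] is bounded through the unknown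
      \<open>S r\<close> itself, to be absorbed below.\<close>
    define R where "R = norm (y s) + S r"
    define \<phi> where "\<phi> u v = (H v - H u) + ((opnorm (g 0) + C_g * R) * X u v + C_g * K * (pvar_seminorm y p u v * X u v))" for u v
    have R_nn: "0 \<le> R" by (simp add: R_def S_def pvar_seminorm_nonneg)
    have yr: "young_path y s r" by (rule young_path_subset[OF y]) (use r in auto)
    have "pcontrol p \<phi> s r"
      unfolding \<phi>_def
      using yD r g_lip K_pos R_nn opnorm_nonneg[of "g 0"]
      by (intro pcontrol_add pcontrol_cmult pcontrol_mult pcontrol_increment p1 x_ctrl
          pcontrol_pvar_seminorm young_pathD(5)[OF yr] \<open>mono_on {s..r} H\<close>) auto
    moreover have "norm (y v - y u) \<le> \<phi> u v" if uv: "s \<le> u" "u \<le> v" "v \<le> r" for u v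
    proof -
      have "picard s r ys y y" using sol r by (auto simp: picard_def)
      moreover have "norm (y q) \<le> R" if "s \<le> q" "q \<le> r" for q
        using young_path_norm_le[OF yr that] by (simp add: R_def S_def)
      ultimately have "norm (y v - y u) \<le> integral {u..v} h
        + ((opnorm (g 0) + C_g * R) * X u v + C_g * K * (pvar_seminorm y p u v * X u v))"
        unfolding h_def using uv by (intro picard_increment_bound[OF yr])
      then show ?thesis using Hd[of u v] uv r by (simp add: \<phi>_def)
    qed
    ultimately have "S r \<le> \<phi> s r"
      unfolding S_def by (intro pvar_seminorm_le_pcontrol(2)[OF p1(1) r(1)])
    also have "\<dots> = H r + ((opnorm (g 0) + C_g * R) * X s r + C_g * K * (S r * X s r))"
      by (simp add: \<phi>_def H_def S_def)
    also have "\<dots> \<le> H r + ((opnorm (g 0) + C_g * R) * \<gamma> + C_g * K * (S r * \<gamma>))"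
    proof -
      have "X s r \<le> \<gamma>"
        using pcontrol_mono[OF x_ctrl[of s t] p1(1), of s s r t] yD r X by auto
      then show ?thesis
        using g_lip K_pos R_nn opnorm_nonneg[of "g 0"] pvar_seminorm_nonneg[of y p s r]
        by (intro add_left_mono add_mono mult_left_mono) (auto simp: S_def)
    qed
    \<comment> \<open>The unknown occurs with C_g \<gamma> through \<open>R\<close> and with K C_g
      \<gamma> through the Young remainder, in total 1/2. Solving for \<open>S r\<close> doubles the
      other terms and gives \<open>norm (y s)\<close> the coefficient 2 C_g \<gamma> = 1/(K +
      1).\<close>
    also have "\<dots> = H r + opnorm (g 0) * \<gamma> + norm (y s) * (C_g * \<gamma>) + S r * ((K + 1) * C_g * \<gamma>)"
      by (simp add: R_def algebra_simps)
    also have "(K + 1) * C_g * \<gamma> = 1 / 2" unfolding \<gamma>_def using ne by (rule gam)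
    finally have "S r \<le> 2 * H r + (2 * \<gamma>) * opnorm (g 0) + norm (y s) * (2 * (C_g * \<gamma>))"
      by (simp add: field_simps)
    also have "2 * \<gamma> = 1 / ((K + 1) * C_g)" unfolding \<gamma>_def using ne by (rule gam)
    also have "2 * (C_g * \<gamma>) = 1 / (K + 1)" unfolding \<gamma>_def using ne by (rule gam)
    finally show ?thesis by (simp add: H_def)
  qed
  define U where "U r = norm (y s) + S r" for r
  have S_cont: "continuous_on {s..t} S"
    unfolding S_def by (rule continuous_on_pvar_seminorm[OF yD(4,5) p1(1)]) simp
  \<comment> \<open>Gronwall with m = 2 |f(0)| and k = 2 L; the quotient m / k = |f(0)| / L is the
    first summand of \<open>M0\<close>. The function \<open>U\<close> dominates |y| and is
    continuous because the p-variation is.\<close>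
  have "U t + 2 * norm (f 0) / (2 * L) \<le> (c + 2 * norm (f 0) / (2 * L)) * exp (2 * L * (t - s))"
  proof (rule Gronwall)
    show cU: "continuous_on {s..t} U" unfolding U_def by (intro continuous_intros S_cont)
    fix r assume r: "s \<le> r" "r \<le> t"
    have "2 * integral {s..r} h = integral {s..r} (\<lambda>v. 2 * h v)" by simp
    also have "\<dots> \<le> integral {s..r} (\<lambda>v. 2 * norm (f 0) + 2 * L * U v)"
    proof (rule integral_le)
      show "(\<lambda>v. 2 * h v) integrable_on {s..r}" using r by (intro integrable_continuous_interval continuous_intros continuous_on_subset[OF h_cont]) auto
      show "(\<lambda>v. 2 * norm (f 0) + 2 * L * U v) integrable_on {s..r}"
        using r by (intro integrable_continuous_interval continuous_intros continuous_on_subset[OF cU]) auto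
      fix v assume "v \<in> {s..r}"
      then have "norm (y v) \<le> U v" using young_path_norm_le(1)[OF y, of v] r by (simp add: U_def S_def)
      then show "2 * h v \<le> 2 * norm (f 0) + 2 * L * U v"
        using Lpos by (simp add: h_def)
    qed
    finally have "2 * integral {s..r} h \<le> integral {s..r} (\<lambda>v. 2 * norm (f 0) + 2 * L * U v)" .
    then show "U r \<le> c + integral {s..r} (\<lambda>v. 2 * norm (f 0) + 2 * L * U v)"
      using key[OF r] by (simp add: U_def c_def exp_alpha distrib_right)
  qed (use Lpos yD in auto)
  moreover have "0 \<le> norm (f 0) / L" using Lpos by simp
  ultimately have "U t \<le> (c + norm (f 0) / L) * exp (2 * L * (t - s))" by simp
  then show ?thesis by (simp add: U_def S_def c_def M0_def algebra_simps)
qed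

text \<open>The flow property: the relation can be restarted at an interior time from the value
  reached there.\<close>

lemma picard_subset:
  assumes "young_path y s t" "picard s t ys y w" "s \<le> s'" "s' \<le> t'" "t' \<le> t"
  shows "picard s' t' (w s') y w"
proof -
  obtain F where F: "\<And>u v. s \<le> u \<Longrightarrow> u \<le> v \<Longrightarrow> v \<le> t \<Longrightarrow> has_young_integral (\<lambda>r. g (y r)) x u v (F v - F u)"
    "\<And>u v. s \<le> u \<Longrightarrow> u \<le> v \<Longrightarrow> v \<le> t \<Longrightarrow> w v - w u = integral {u..v} (\<lambda>r. drift (y r)) + (F v - F u)"
    by (rule picard_increments[OF assms(1,2)]) (rule that)
  show ?thesis
    unfolding picard_def
  proof
    fix r assume r: "r \<in> {s'..t'}"
    show "\<exists>I. has_young_integral (\<lambda>v. g (y v)) x s' r I \<and> w r = w s' + integral {s'..r} (\<lambda>v. drift (y v)) + I"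
      using F(1)[of s' r] F(2)[of s' r] r assms(3-5)
      by (intro exI[of _ "F r - F s'"]) (auto simp: algebra_simps)
  qed
qed

lemma solution_iterate:
  assumes y: "young_path y s t" and sol: "picard s t ys y y"
    and \<sigma>: "\<sigma> 0 = s" "\<And>k. \<sigma> k \<le> \<sigma> (Suc k)" "\<And>k. \<sigma> k \<le> t" "\<And>k. X (\<sigma> k) (\<sigma> (Suc k)) \<le> \<gamma>"
  shows "norm (y s) + pvar_seminorm y p s (\<sigma> k)
    \<le> (norm (y s) + M0 * real k) * exp (\<alpha> * real k + 2 * L * (\<sigma> k - s))"
proof -
  note yD = young_pathD[OF y]
  have \<sigma>_ge: "s \<le> \<sigma> k" for k
    using seq_mono[of k \<sigma> 0 k] \<sigma>(1,2) by simp
  \<comment> \<open>The induction runs on this sum rather than on the seminorm over [s, \<sigma> k],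
    since it grows by exactly the new seminorm while still dominating the norm of y at the current
    time.\<close>
  define S where "S k = norm (y s) + (\<Sum>j<k. pvar_seminorm y p (\<sigma> j) (\<sigma> (Suc j)))" for k
  have tri: "norm (y s) + pvar_seminorm y p s (\<sigma> k) \<le> S k" for k
  proof (induction k)
    case 0
    then show ?case using \<sigma>(1) pvar_seminorm_diag(2)[of p y s] p1 by (simp add: S_def)
  next
    case (Suc k)
    have "pvar_seminorm y p s (\<sigma> (Suc k)) \<le> pvar_seminorm y p s (\<sigma> k) + pvar_seminorm y p (\<sigma> k) (\<sigma> (Suc k))"
      by (intro pvar_seminorm_triangle(2)[OF p1(1)] finite_pvar_subset[OF yD(5)]) (use \<sigma> \<sigma>_ge in auto)
    then show ?case using Suc by (simp add: S_def)
  qed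
  have "S k \<le> (norm (y s) + M0 * real k) * exp (\<alpha> * real k + 2 * L * (\<sigma> k - s))" for k
  proof (induction k)
    case 0
    then show ?case using \<sigma>(1) by (simp add: S_def)
  next
    case (Suc k)
    define v where "v = norm (y (\<sigma> k))"
    define E where "E = exp (2 * L * (\<sigma> (Suc k) - \<sigma> k))"
    have "1 \<le> E" using Lpos \<sigma>(2) by (simp add: E_def)
    moreover have "1 \<le> exp \<alpha>" using alpha_nonneg by simp
    ultimately have E: "1 \<le> E" "1 \<le> exp \<alpha> * E" using mult_mono[of 1 "exp \<alpha>" 1 E] by auto
    have "v \<le> norm (y s) + pvar_seminorm y p s (\<sigma> k)"
      unfolding v_def by (rule young_path_norm_le(1)[OF y]) (use \<sigma> \<sigma>_ge in auto)
    then have v: "v \<le> S k" using tri[of k] by simp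
    have "v + pvar_seminorm y p (\<sigma> k) (\<sigma> (Suc k)) \<le> (exp \<alpha> * v + M0) * E"
      unfolding v_def E_def using \<sigma> \<sigma>_ge
      by (intro solution_small_interval[where ys = "y (\<sigma> k)"] young_path_subset[OF y] picard_subset[OF y sol]) auto
    \<comment> \<open>The local bound controls \<open>v\<close> plus the new seminorm, so
      \<open>v\<close> is subtracted; its coefficient is then nonnegative and \<open>v\<close> may
      be replaced by \<open>S k\<close>.\<close>
    then have "S (Suc k) \<le> S k + (exp \<alpha> * E - 1) * v + M0 * E"
      by (simp add: S_def algebra_simps)
    also have "\<dots> \<le> S k + (exp \<alpha> * E - 1) * S k + M0 * E"
      using v E M0_nonneg by (intro add_mono mult_left_mono) auto
    also have "\<dots> = S k * (exp \<alpha> * E) + M0 * E" by (simp add: algebra_simps)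
    also have "\<dots> \<le> (norm (y s) + M0 * real k) * exp (\<alpha> * real k + 2 * L * (\<sigma> k - s)) * (exp \<alpha> * E)
        + M0 * exp (\<alpha> * real (Suc k) + 2 * L * (\<sigma> (Suc k) - s))"
    \<comment> \<open>The new \<open>M0\<close> carries only the exponential of the current
      interval, which is dominated by the accumulated one; hence \<open>M0\<close> is counted once
      per interval.\<close>
    proof (intro add_mono mult_right_mono mult_left_mono Suc)
      have "2 * L * (\<sigma> (Suc k) - \<sigma> k) \<le> 2 * L * (\<sigma> (Suc k) - s)"
        using Lpos \<sigma>_ge[of k] by (intro mult_left_mono) auto
      moreover have "0 \<le> \<alpha> * real (Suc k)" using alpha_nonneg by simp
      ultimately show "E \<le> exp (\<alpha> * real (Suc k) + 2 * L * (\<sigma> (Suc k) - s))"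
        unfolding E_def exp_le_cancel_iff by linarith
    qed (use E M0_nonneg in auto)
    also have "(norm (y s) + M0 * real k) * exp (\<alpha> * real k + 2 * L * (\<sigma> k - s)) * (exp \<alpha> * E)
      = (norm (y s) + M0 * real k) * exp (\<alpha> * real (Suc k) + 2 * L * (\<sigma> (Suc k) - s))"
      by (simp add: E_def algebra_simps flip: exp_add)
    finally show ?case by (simp add: algebra_simps)
  qed
  then show ?thesis using tri[of k] order_trans by blast
qed

text \<open>For a solution known only up to \<open>c\<close>, the bound is still in terms of the
  count and length for all of [a, b]. It is thus uniform in \<open>c\<close>, as the continuation
  argument requires.\<close>

lemma a_priori_bound:
  assumes y: "young_path y a c" and sol: "picard a c ya y y"
  defines "N \<equiv> real (greedy_N x p \<gamma> a b)"
  shows "norm (y a) + pvar_seminorm y p a c \<le> (norm ya + M0 * N) * exp (\<alpha> * N + 2 * L * (b - a))"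
proof -
  note yD = young_pathD[OF y]
  interpret greedy x p \<gamma> a b
    by unfold_locales (use p1 x_cont x_pvar gamma_pos ab in auto)
  have ya: "y a = ya"
    by (rule picard_increments[OF y sol])
  define n where "n = greedy_N x p \<gamma> a b"
  \<comment> \<open>Greedy times stopped at \<open>c\<close>: past it the intervals are degenerate
    and the p-variation of x on them is 0.\<close>
  define \<sigma> where "\<sigma> k = min (\<tau> k) c" for k
  have "norm (y a) + pvar_seminorm y p a (\<sigma> n) \<le> (norm (y a) + M0 * real n) * exp (\<alpha> * real n + 2 * L * (\<sigma> n - a))"
  proof (rule solution_iterate[OF y sol])
    fix k
    show "\<sigma> k \<le> \<sigma> (Suc k)" using greedy_properties(1)[of k] by (auto simp: \<sigma>_def)
    show "X (\<sigma> k) (\<sigma> (Suc k)) \<le> \<gamma>"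
    proof (cases "\<tau> k \<le> c")
      case True
      have "X (\<sigma> k) (\<sigma> (Suc k)) \<le> X (\<tau> k) (\<tau> (Suc k))"
        using True greedy_range[of k] greedy_range[of "Suc k"] greedy_properties(1)[of k] yD(3)
        by (intro pcontrol_mono[OF x_ctrl[of a b] p1(1)]) (auto simp: \<sigma>_def)
      then show ?thesis using greedy_properties(2)[of k] by simp
    next
      case False
      then have "\<sigma> k = c" "\<sigma> (Suc k) = c" using greedy_properties(1)[of k] by (auto simp: \<sigma>_def)
      then show ?thesis using pvar_seminorm_diag(2)[of p x c] p1 gamma_pos by simp
    qed
  qed (use yD in \<open>auto simp: \<sigma>_def\<close>)
  moreover have "\<sigma> n = c" using greedy_N(2) yD(3) by (simp add: \<sigma>_def n_def)
  moreover have "(norm ya + M0 * real n) * exp (\<alpha> * real n + 2 * L * (c - a))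
     \<le> (norm ya + M0 * real n) * exp (\<alpha> * real n + 2 * L * (b - a))"
    using yD(3) Lpos M0_nonneg by (intro mult_left_mono) auto
  ultimately show ?thesis using ya by (simp add: N_def n_def)
qed

section \<open>Contraction, uniqueness and existence\<close>

text \<open>Only the Lipschitz constants of \<open>g\<close> and \<open>Dg\<close> enter, since
  \<open>g u - g v - (g u' - g v')\<close> is split at \<open>g (v + (u' - v'))\<close>.\<close>

definition g_quad :: "real \<Rightarrow> bool" where
  "g_quad C \<longleftrightarrow> 0 \<le> C \<and> (\<forall>u v u' v'. norm (g u - g v - (g u' - g v')) \<le>
     real (CARD('d) * CARD('m)) * C_g * norm (u - v - (u' - v')) + C * norm (v - v') * norm (u' - v'))"

lemma g_norm_lip: "norm (g u - g v) \<le> real (CARD('d) * CARD('m)) * C_g * norm (u - v)"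
proof -
  have "norm (g u - g v) \<le> real (CARD('d) * CARD('m)) * opnorm (g u - g v)" by (rule norm_le_opnorm)
  also have "\<dots> \<le> real (CARD('d) * CARD('m)) * (C_g * norm (u - v))"
    using g_lip by (intro mult_left_mono) auto
  finally show ?thesis by (simp add: mult.assoc)
qed

lemma g_quad_exists: "\<exists>C. g_quad C"
proof -
  obtain Dg C where Dg: "\<And>u. (g has_derivative Dg u) (at u)"
    "\<And>u v. onorm (\<lambda>h. Dg u h - Dg v h) \<le> C * norm (u - v)"
    using g_C1 by blast
  have "norm (g u - g v - (g u' - g v')) \<le>
     real (CARD('d) * CARD('m)) * C_g * norm (u - v - (u' - v')) + \<bar>C\<bar> * norm (v - v') * norm (u' - v')" for u v u' v'
  proof -
    define e where "e = u' - v'"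
    \<comment> \<open>The derivative of \<open>h\<close> is the difference of \<open>Dg\<close> at
      two points a constant distance \<open>norm (v - v')\<close> apart, applied to
      \<open>e\<close>. The increment from 0 to 1 is the four-point difference with
      \<open>g u\<close> replaced by \<open>g (v + e)\<close>.\<close>
    define h where "h \<theta> = g (v + \<theta> *\<^sub>R e) - g (v' + \<theta> *\<^sub>R e)" for \<theta> :: real
    have "norm (h 1 - h 0) \<le> (\<bar>C\<bar> * norm (v - v') * norm e) * norm (1 - 0 :: real)"
    proof (rule differentiable_bound[where S = "{0..1::real}" and f = h])
      fix \<theta> :: real
      let ?D = "\<lambda>k. Dg (v + \<theta> *\<^sub>R e) (k *\<^sub>R e) - Dg (v' + \<theta> *\<^sub>R e) (k *\<^sub>R e)"
      have *: "((\<lambda>\<theta>. g (w + \<theta> *\<^sub>R e)) has_derivative (\<lambda>k. Dg (w + \<theta> *\<^sub>R e) (k *\<^sub>R e))) (at \<theta> within {0..1})" for w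
        by (rule has_derivative_compose[of "\<lambda>\<theta>. w + \<theta> *\<^sub>R e" "\<lambda>k. k *\<^sub>R e", OF _ Dg(1)])
          (auto intro!: derivative_eq_intros)
      show "(h has_derivative ?D) (at \<theta> within {0..1})"
        unfolding h_def by (intro has_derivative_diff *)
      have bl: "bounded_linear (\<lambda>h. Dg (v + \<theta> *\<^sub>R e) h - Dg (v' + \<theta> *\<^sub>R e) h)"
        by (intro bounded_linear_sub has_derivative_bounded_linear[OF Dg(1)])
      show "onorm ?D \<le> \<bar>C\<bar> * norm (v - v') * norm e"
      proof (rule onorm_le)
        fix k :: real
        have "norm (?D k) \<le> onorm (\<lambda>h. Dg (v + \<theta> *\<^sub>R e) h - Dg (v' + \<theta> *\<^sub>R e) h) * norm (k *\<^sub>R e)"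
          by (rule onorm[OF bl])
        also have "\<dots> \<le> (\<bar>C\<bar> * norm (v - v')) * norm (k *\<^sub>R e)"
        proof (rule mult_right_mono)
          have "C * norm (v - v') \<le> \<bar>C\<bar> * norm (v - v')" by (intro mult_right_mono) auto
          then show "onorm (\<lambda>h. Dg (v + \<theta> *\<^sub>R e) h - Dg (v' + \<theta> *\<^sub>R e) h) \<le> \<bar>C\<bar> * norm (v - v')"
            using Dg(2)[of "v + \<theta> *\<^sub>R e" "v' + \<theta> *\<^sub>R e"] by simp
        qed simp
        finally show "norm (?D k) \<le> \<bar>C\<bar> * norm (v - v') * norm e * norm k" by (simp add: mult_ac)
      qed
    qed auto
    then have 1: "norm (h 1 - h 0) \<le> \<bar>C\<bar> * norm (v - v') * norm (u' - v')" by (simp add: e_def)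
    have 2: "norm (g u - g (v + e)) \<le> real (CARD('d) * CARD('m)) * C_g * norm (u - v - (u' - v'))"
      using g_norm_lip[of u "v + e"] by (simp add: e_def algebra_simps)
    have eq: "g u - g v - (g u' - g v') = (g u - g (v + e)) + (h 1 - h 0)"
      by (simp add: h_def e_def)
    show ?thesis
      unfolding eq using 1 2 norm_triangle_ineq[of "g u - g (v + e)" "h 1 - h 0"] by linarith
  qed
  then show ?thesis unfolding g_quad_def by (intro exI[of _ "\<bar>C\<bar>"]) auto
qed

text \<open>The Lipschitz constant of \<open>g\<close> for the Frobenius norm. Its dimension factor
  influences only step lengths, not the final bounds.\<close>

definition C1 :: real where "C1 = real (CARD('d) * CARD('m)) * C_g"
definition C2 :: real where "C2 = (SOME C. g_quad C)"

lemma C2: "0 \<le> C2" "norm (g u - g v - (g u' - g v')) \<le> C1 * norm (u - v - (u' - v')) + C2 * norm (v - v') * norm (u' - v')"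
proof -
  have "g_quad C2" unfolding C2_def using g_quad_exists by (rule someI_ex)
  then show "0 \<le> C2" "norm (g u - g v - (g u' - g v')) \<le> C1 * norm (u - v - (u' - v')) + C2 * norm (v - v') * norm (u' - v')"
    unfolding g_quad_def C1_def by blast+
qed

lemma C1_nonneg: "0 \<le> C1" using g_lip by (simp add: C1_def)

lemma g_cont: "continuous_on S y \<Longrightarrow> continuous_on S (\<lambda>r. g (y r))"
proof -
  have "C1-lipschitz_on UNIV g"
    using g_norm_lip C1_nonneg by (intro lipschitz_onI) (auto simp: dist_norm C1_def)
  then have "continuous_on UNIV g" by (rule lipschitz_on_continuous_on)
  then show "continuous_on S y \<Longrightarrow> continuous_on S (\<lambda>r. g (y r))"
    by (rule continuous_on_compose2) auto
qed

section \<open>Moduli of the form P * (v - u) + Q * X u v\<close>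

lemma time_pcontrol: "pcontrol p (\<lambda>u v. v - u) s t"
  by (rule pcontrol_increment[OF p1(1)]) (simp add: monotone_on_def)

lemma affine_pcontrol:
  assumes "a \<le> s" "t \<le> b" "0 \<le> P" "0 \<le> Q"
  shows "pcontrol p (\<lambda>u v. P * (v - u) + Q * X u v) s t"
  using assms by (intro pcontrol_add pcontrol_cmult time_pcontrol x_ctrl p1)

text \<open>A single step length serves all of [a, b], because the p-variation is uniformly small on
  short intervals. Each term receives half of \<open>\<epsilon>\<close>.\<close>

lemma small_step:
  assumes "0 \<le> P" "0 \<le> Q" "0 < \<epsilon>"
  obtains h where "0 < h" "\<And>s t. a \<le> s \<Longrightarrow> s \<le> t \<Longrightarrow> t \<le> b \<Longrightarrow> t - s < h \<Longrightarrow> P * (t - s) + Q * X s t \<le> \<epsilon>"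
proof -
  have e: "0 < \<epsilon> / (2 * (Q + 1))" using assms by simp
  obtain d where d: "0 < d" "\<And>s t. a \<le> s \<Longrightarrow> s \<le> t \<Longrightarrow> t \<le> b \<Longrightarrow> t - s < d \<Longrightarrow> X s t < \<epsilon> / (2 * (Q + 1))"
    using pvar_seminorm_uniformly_small[OF x_cont x_pvar p1(1) e] by metis
  show ?thesis
  proof (rule that[of "min d (\<epsilon> / (2 * (P + 1)))"])
    fix s t assume st: "a \<le> s" "s \<le> t" "t \<le> b" "t - s < min d (\<epsilon> / (2 * (P + 1)))"
    have "P * (t - s) \<le> (P + 1) * (\<epsilon> / (2 * (P + 1)))"
      using st assms by (intro mult_mono) auto
    also have "\<dots> = \<epsilon> / 2" using assms by (simp add: field_simps)
    finally have 1: "P * (t - s) \<le> \<epsilon> / 2" .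
    have "Q * X s t \<le> (Q + 1) * (\<epsilon> / (2 * (Q + 1)))"
      using d(2)[of s t] st assms by (intro mult_mono) (auto simp: pvar_seminorm_nonneg)
    also have "\<dots> = \<epsilon> / 2" using assms by (simp add: field_simps)
    finally show "P * (t - s) + Q * X s t \<le> \<epsilon>" using 1 by simp
  qed (use d assms in auto)
qed

lemma continuous_of_modulus:
  assumes "a \<le> s" "t \<le> b" "0 \<le> P" "0 \<le> Q"
    and "\<And>u v. s \<le> u \<Longrightarrow> u \<le> v \<Longrightarrow> v \<le> t \<Longrightarrow> norm (w v - w u) \<le> P * (v - u) + Q * X u v"
  shows "continuous_on {s..t} w"
  unfolding continuous_on_iff
proof (intro ballI allI impI)
  fix r \<epsilon> :: real assume r: "r \<in> {s..t}" and "0 < \<epsilon>"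
  then have "0 < \<epsilon> / 2" by simp
  note e = this
  obtain h where h: "0 < h" "\<And>s t. a \<le> s \<Longrightarrow> s \<le> t \<Longrightarrow> t \<le> b \<Longrightarrow> t - s < h \<Longrightarrow> P * (t - s) + Q * X s t \<le> \<epsilon> / 2"
    by (rule small_step[OF assms(3,4) e]) (rule that)
  have *: "norm (w v - w u) < \<epsilon>" if "s \<le> u" "u \<le> v" "v \<le> t" "v - u < h" for u v
    using assms(5)[of u v] h(2)[of u v] that assms(1,2) e by linarith
  show "\<exists>d>0. \<forall>r'\<in>{s..t}. dist r' r < d \<longrightarrow> dist (w r') (w r) < \<epsilon>"
  proof (intro exI[of _ h] conjI ballI impI h(1))
    fix r' assume "r' \<in> {s..t}" "dist r' r < h"
    then show "dist (w r') (w r) < \<epsilon>"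
      using *[of r r'] *[of r' r] r by (cases "r \<le> r'") (auto simp: dist_norm norm_minus_commute)
  qed
qed

text \<open>A common starting value makes the p-variation seminorm of y1 - y2 dominate its supremum,
  so the seminorm alone measures the distance. Only the p-variation of \<open>y2\<close> enters,
  since the four-point estimate pairs increments of \<open>y2\<close> with values of the
  difference.\<close>

lemma picard_contraction:
  assumes y1: "young_path y1 s t" and y2: "young_path y2 s t" and start: "y1 s = y2 s"
    and w1: "picard s t ys y1 w1" and w2: "picard s t ys y2 w2"
    and M: "pvar_seminorm y2 p s t \<le> M"
  shows "pvar_seminorm (\<lambda>r. w1 r - w2 r) p s t \<le>
    (L * (t - s) + (1 + K) * (C1 + C2 * M) * X s t) * pvar_seminorm (\<lambda>r. y1 r - y2 r) p s t"
proof -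
  note y1D = young_pathD[OF y1] and y2D = young_pathD[OF y2]
  define z where "z r = y1 r - y2 r" for r
  define G where "G r = g (y1 r) - g (y2 r)" for r
  define S where "S = pvar_seminorm z p s t"
  \<comment> \<open>Bounds both the p-variation and the supremum of \<open>G\<close>, which vanishes
    at \<open>s\<close>.\<close>
  define B where "B = C1 * S + C2 * S * M"
  have S_nn: "0 \<le> S" by (simp add: S_def pvar_seminorm_nonneg)
  have M_nn: "0 \<le> M" using M pvar_seminorm_nonneg order_trans by blast
  have B_nn: "0 \<le> B" using S_nn M_nn C1_nonneg C2(1) by (simp add: B_def)
  have zfin: "finite_pvar z p s t"
    unfolding z_def by (rule finite_pvar_diff[OF p1(1) y1D(2,5) y2D(5)])
  have zs: "z s = 0" using start by (simp add: z_def)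
  have zinc: "norm (z v - z u) \<le> pvar_seminorm z p u v" if "s \<le> u" "u \<le> v" "v \<le> t" for u v
    using increment_le_pvar_seminorm[OF zfin that p1(2)] .
  have zle: "norm (z r) \<le> S" if "s \<le> r" "r \<le> t" for r
    using zinc[of s r] zs pcontrol_mono[OF pcontrol_pvar_seminorm[OF zfin p1(2)] p1(1), of s s r t] that
    by (simp add: S_def)
  have pcG: "pcontrol p (\<lambda>u v. C1 * pvar_seminorm z p u v + C2 * S * pvar_seminorm y2 p u v) s t"
    using C1_nonneg C2(1) S_nn
    by (intro pcontrol_add pcontrol_cmult pcontrol_pvar_seminorm zfin y2D p1) auto
  have Ginc: "norm (G v - G u) \<le> C1 * pvar_seminorm z p u v + C2 * S * pvar_seminorm y2 p u v"
    if uv: "s \<le> u" "u \<le> v" "v \<le> t" for u v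
  proof -
    have "norm (G v - G u) \<le> C1 * norm (z v - z u) + C2 * norm (y2 v - y2 u) * norm (z u)"
      using C2(2)[of "y1 v" "y2 v" "y1 u" "y2 u"] by (simp add: G_def z_def)
    also have "\<dots> \<le> C1 * pvar_seminorm z p u v + C2 * pvar_seminorm y2 p u v * S"
      using C1_nonneg C2(1) zinc[OF uv] zle[of u] increment_le_pvar_seminorm[OF y2D(5) uv p1(2)] uv
      by (intro add_mono mult_mono mult_left_mono) (auto simp: pvar_seminorm_nonneg)
    finally show ?thesis by (simp add: mult_ac)
  qed
  have Gfin: "finite_pvar G p s t"
    by (rule pvar_seminorm_le_pcontrol(1)[OF p1(1) y1D(2) pcG Ginc])
  have "pvar_seminorm G p s t \<le> C1 * S + C2 * S * pvar_seminorm y2 p s t"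
    unfolding S_def by (rule pvar_seminorm_le_pcontrol(2)[OF p1(1) y1D(2) pcG[unfolded S_def] Ginc[unfolded S_def]])
  also have "\<dots> \<le> B"
    unfolding B_def using M C2(1) S_nn by (intro add_left_mono mult_left_mono) auto
  finally have GB: "pvar_seminorm G p s t \<le> B" .
  have Gcont: "continuous_on {s..t} G"
    unfolding G_def by (intro continuous_intros g_cont y1D y2D)
  have Gs: "G s = 0" using start by (simp add: G_def)
  have GuvB: "pvar_seminorm G p u v \<le> B" if "s \<le> u" "u \<le> v" "v \<le> t" for u v
    using pcontrol_mono[OF pcontrol_pvar_seminorm[OF Gfin p1(2)] p1(1), of s u v t] that GB by simp
  have Gle: "norm (G u) \<le> B" if "s \<le> u" "u \<le> t" for u
    using increment_le_pvar_seminorm[OF Gfin order_refl that p1(2)] Gs GuvB[of s u] that by simp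
  \<comment> \<open>Here \<open>G\<close> is its own controlling path with constant 1, because the
    operator norm is at most the Frobenius norm.\<close>
  obtain F where F: "\<And>u v. s \<le> u \<Longrightarrow> u \<le> v \<Longrightarrow> v \<le> t \<Longrightarrow> has_young_integral G x u v (F v - F u)"
    "\<And>u v. s \<le> u \<Longrightarrow> u \<le> v \<Longrightarrow> v \<le> t \<Longrightarrow> norm (F v - F u - G u *v (x v - x u)) \<le>
       1 * young_const p * pvar_seminorm G p u v * X u v"
  proof (rule young_integral[OF p1(1) p(2) x_sub[OF y1D(1-3)] Gcont Gfin, of 1 G])
    show "opnorm (G v - G u) \<le> 1 * norm (G v - G u)" for u v
      by (simp add: opnorm_le_norm)
  qed (simp, rule that)
  obtain F1 where F1: "\<And>u v. s \<le> u \<Longrightarrow> u \<le> v \<Longrightarrow> v \<le> t \<Longrightarrow> has_young_integral (\<lambda>r. g (y1 r)) x u v (F1 v - F1 u)"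
    "\<And>u v. s \<le> u \<Longrightarrow> u \<le> v \<Longrightarrow> v \<le> t \<Longrightarrow> w1 v - w1 u = integral {u..v} (\<lambda>r. drift (y1 r)) + (F1 v - F1 u)"
    by (rule picard_increments[OF y1 w1]) (rule that)
  obtain F2 where F2: "\<And>u v. s \<le> u \<Longrightarrow> u \<le> v \<Longrightarrow> v \<le> t \<Longrightarrow> has_young_integral (\<lambda>r. g (y2 r)) x u v (F2 v - F2 u)"
    "\<And>u v. s \<le> u \<Longrightarrow> u \<le> v \<Longrightarrow> v \<le> t \<Longrightarrow> w2 v - w2 u = integral {u..v} (\<lambda>r. drift (y2 r)) + (F2 v - F2 u)"
    by (rule picard_increments[OF y2 w2]) (rule that)
  have inc: "norm ((w1 v - w2 v) - (w1 u - w2 u)) \<le> (L * S) * (v - u) + ((1 + K) * B) * X u v"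
    if uv: "s \<le> u" "u \<le> v" "v \<le> t" for u v
  proof -
    have FF: "F v - F u = (F1 v - F1 u) - (F2 v - F2 u)"
      using has_young_integral_unique[OF F(1)[OF uv, unfolded G_def[abs_def]]
          has_young_integral_diff[OF F1(1)[OF uv] F2(1)[OF uv]] uv(2)] .
    have d_int: "(\<lambda>r. drift (y r)) integrable_on {u..v}" if "continuous_on {s..t} y" for y
      using uv by (intro integrable_continuous_interval drift_cont continuous_on_subset[OF that]) auto
    have "norm (integral {u..v} (\<lambda>r. drift (y1 r) - drift (y2 r))) \<le> integral {u..v} (\<lambda>r. L * S)"
    proof (rule integral_norm_bound_integral)
      show "(\<lambda>r. drift (y1 r) - drift (y2 r)) integrable_on {u..v}"
        by (intro integrable_diff d_int y1D y2D)
      fix r assume r: "r \<in> {u..v}"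
      have "norm (drift (y1 r) - drift (y2 r)) \<le> L * norm (z r)" unfolding z_def by (rule drift_lip)
      also have "\<dots> \<le> L * S" using zle[of r] r uv Lpos by (intro mult_left_mono) auto
      finally show "norm (drift (y1 r) - drift (y2 r)) \<le> L * S" .
    qed auto
    then have 1: "norm (integral {u..v} (\<lambda>r. drift (y1 r) - drift (y2 r))) \<le> (L * S) * (v - u)"
      using uv by (simp add: mult_ac)
    have "norm (F v - F u - G u *v (x v - x u)) \<le> K * pvar_seminorm G p u v * X u v"
      using F(2)[OF uv] by (simp add: K_def)
    also have "\<dots> \<le> K * B * X u v"
      using GuvB[OF uv] K_pos by (intro mult_right_mono mult_left_mono) (auto simp: pvar_seminorm_nonneg)
    finally have 2: "norm (F v - F u - G u *v (x v - x u)) \<le> K * B * X u v" .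
    have "norm (G u *v (x v - x u)) \<le> opnorm (G u) * norm (x v - x u)" by (rule opnorm_mult)
    also have "\<dots> \<le> B * X u v"
    proof (rule mult_mono)
      show "opnorm (G u) \<le> B" using opnorm_le_norm[of "G u"] Gle[of u] uv by simp
      show "norm (x v - x u) \<le> X u v"
        using uv y1D p1 by (intro increment_le_pvar_seminorm[OF x_pvar]) auto
    qed (use B_nn in auto)
    finally have 3: "norm (G u *v (x v - x u)) \<le> B * X u v" .
    \<comment> \<open>The double negation and the final 0 only fit the expression to the four-term
      norm inequality.\<close>
    have eq: "(w1 v - w2 v) - (w1 u - w2 u) = integral {u..v} (\<lambda>r. drift (y1 r) - drift (y2 r))
       + G u *v (x v - x u) - (- (F v - F u - G u *v (x v - x u))) - 0"
    proof -
      have "(w1 v - w2 v) - (w1 u - w2 u) = (w1 v - w1 u) - (w2 v - w2 u)" by simp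
      also have "\<dots> = integral {u..v} (\<lambda>r. drift (y1 r)) - integral {u..v} (\<lambda>r. drift (y2 r)) + (F v - F u)"
        unfolding F1(2)[OF uv] F2(2)[OF uv] FF by simp
      finally show ?thesis
        by (simp add: Henstock_Kurzweil_Integration.integral_diff d_int[OF y1D(4)] d_int[OF y2D(4)])
    qed
    show ?thesis
      unfolding eq
      using norm_diff_diff_add_le[of "integral {u..v} (\<lambda>r. drift (y1 r) - drift (y2 r))" "G u *v (x v - x u)"
          "- (F v - F u - G u *v (x v - x u))" 0] 1 2 3
      by (simp only: norm_minus_cancel norm_zero) (simp add: algebra_simps)
  qed
  have "pvar_seminorm (\<lambda>r. w1 r - w2 r) p s t \<le> (L * S) * (t - s) + ((1 + K) * B) * X s t"
    using y1D Lpos S_nn K_pos B_nn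
    by (intro pvar_seminorm_le_pcontrol(2)[OF p1(1) y1D(2) affine_pcontrol inc]) auto
  also have "\<dots> = (L * (t - s) + (1 + K) * (C1 + C2 * M) * X s t) * S"
    by (simp add: B_def algebra_simps)
  finally show ?thesis by (simp add: S_def z_def[abs_def])
qed

text \<open>With \<open>M\<close> taken over the whole interval, one step length makes the
  contraction factor at most 1/2 everywhere. The difference of two solutions is its own Picard
  difference, so its seminorm is at most half of itself.\<close>

lemma solution_unique:
  assumes y1: "young_path y1 a b" "picard a b ya y1 y1" and y2: "young_path y2 a b" "picard a b ya y2 y2"
    and r: "r \<in> {a..b}"
  shows "y1 r = y2 r"
proof -
  note y1D = young_pathD[OF y1(1)] and y2D = young_pathD[OF y2(1)]
  define M where "M = pvar_seminorm y2 p a b"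
  have M: "0 \<le> M" by (simp add: M_def pvar_seminorm_nonneg)
  have Q: "0 \<le> (1 + K) * (C1 + C2 * M)" using K_pos C1_nonneg C2(1) M by simp
  obtain h where h: "0 < h" "\<And>s t. a \<le> s \<Longrightarrow> s \<le> t \<Longrightarrow> t \<le> b \<Longrightarrow> t - s < h \<Longrightarrow>
      L * (t - s) + (1 + K) * (C1 + C2 * M) * X s t \<le> 1 / 2"
    using small_step[OF less_imp_le[OF Lpos] Q, of "1 / 2"] by (metis half_gt_zero zero_less_one)
  have y0: "y1 a = y2 a"
    using picard_increments[OF y1] picard_increments[OF y2] by metis
  have step: "y1 r = y2 r" if st: "a \<le> s" "s \<le> t" "t \<le> b" "t - s < h" "y1 s = y2 s" "s \<le> r" "r \<le> t" for s t r
  proof -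
    let ?z = "\<lambda>r. y1 r - y2 r"
    have p12: "young_path y1 s t" "young_path y2 s t"
      using st by (auto intro: young_path_subset[OF y1(1)] young_path_subset[OF y2(1)])
    have "picard s t (y1 s) y1 y1" "picard s t (y1 s) y2 y2"
      using picard_subset[OF y1, of s t] picard_subset[OF y2, of s t] st by auto
    moreover have "pvar_seminorm y2 p s t \<le> M"
      unfolding M_def using st p1
      by (intro pcontrol_mono[OF pcontrol_pvar_seminorm[OF y2D(5)]]) auto
    ultimately have "pvar_seminorm ?z p s t \<le> (L * (t - s) + (1 + K) * (C1 + C2 * M) * X s t) * pvar_seminorm ?z p s t"
      using p12 st by (intro picard_contraction) auto
    also have "\<dots> \<le> 1 / 2 * pvar_seminorm ?z p s t"
      using h(2)[of s t] st by (intro mult_right_mono) (auto simp: pvar_seminorm_nonneg)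
    finally have z0: "pvar_seminorm ?z p s t \<le> 0" by simp
    have zfin: "finite_pvar ?z p s t"
      using finite_pvar_diff(1)[OF p1(1) st(2)] p12 young_pathD(5) by blast
    have "norm (?z r - ?z s) \<le> pvar_seminorm ?z p s r"
      using st p1 by (intro increment_le_pvar_seminorm[OF zfin]) auto
    also have "\<dots> \<le> pvar_seminorm ?z p s t"
      using st p1 by (intro pcontrol_mono[OF pcontrol_pvar_seminorm[OF zfin]]) auto
    finally have "norm (?z r - ?z s) \<le> 0" using z0 by linarith
    then show ?thesis using st by simp
  qed
  \<comment> \<open>Steps of length \<open>h / 2\<close> respect the strict bound
    \<open>t - s < h\<close>; agreement at the end of a step starts the next one.\<close>
  have "\<forall>r. a \<le> r \<and> r \<le> b \<and> r \<le> a + real n * (h / 2) \<longrightarrow> y1 r = y2 r" for n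
  proof (induction n)
    case (Suc n)
    define s where "s = min b (a + real n * (h / 2))"
    define t where "t = min b (a + real (Suc n) * (h / 2))"
    have e: "a + real (Suc n) * (h / 2) = a + real n * (h / 2) + h / 2" by (simp add: algebra_simps)
    have n: "0 \<le> real n * (h / 2)" using h(1) by simp
    have st: "a \<le> s" "s \<le> t" "t \<le> b" "t - s < h"
      unfolding s_def t_def e using h(1) ab n by (auto simp: min_def)
    have "y1 s = y2 s" using Suc.IH st by (auto simp: s_def)
    then show ?case
      using step[OF st] Suc.IH by (metis linear min.bounded_iff s_def t_def)
  qed (use y0 in auto)
  moreover obtain n where "(b - a) / (h / 2) < real n" using reals_Archimedean2 by blast
  then have "b \<le> a + real n * (h / 2)" using h(1) by (simp add: field_simps)
  ultimately show ?thesis using r by (metis atLeastAtMost_iff order_trans)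
qed

text \<open>The initial value enters the smallness conditions only through \<open>R\<close>. The
  first makes the Picard map a contraction, the second makes it preserve the set
  \<open>good\<close>.\<close>

lemma local_existence:
  assumes st: "a \<le> s" "s \<le> t" "t \<le> b" and R: "norm ys \<le> R"
    and small1: "L * (t - s) + (1 + K) * (C1 + C2 * 1) * X s t \<le> 1 / 2"
    and small2: "(L * (R + 1) + norm (f 0)) * (t - s) + (opnorm (g 0) + C_g * (R + 1) + C_g * K) * X s t \<le> 1"
  shows "\<exists>y. young_path y s t \<and> picard s t ys y y"
proof -
  \<comment> \<open>The radius 1 yields M = 1 in the contraction, and \<open>R + 1\<close> as a
    bound of the path.\<close>
  define good where "good y \<longleftrightarrow> young_path y s t \<and> y s = ys \<and> pvar_seminorm y p s t \<le> 1" for y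
  have R_nn: "0 \<le> R" using R norm_ge_zero order_trans by blast
  define P where "P = L * (R + 1) + norm (f 0)"
  define Q where "Q = opnorm (g 0) + C_g * (R + 1) + C_g * K"
  have PQ: "0 \<le> P" "0 \<le> Q"
    using Lpos R_nn K_pos g_lip opnorm_nonneg[of "g 0"] by (auto simp: P_def Q_def)
  have good_const: "good (\<lambda>_. ys)"
  proof -
    have z: "pcontrol p (\<lambda>_ _. 0) s t" by (rule pcontrolI) auto
    have "finite_pvar (\<lambda>_. ys) p s t" "pvar_seminorm (\<lambda>_. ys) p s t \<le> 0"
      using pvar_seminorm_le_pcontrol[OF p1(1) st(2) z, of "\<lambda>_. ys"] by auto
    then show ?thesis using st by (auto simp: good_def young_path_def)
  qed
  have good_step: "good w" if y: "good y" and w: "picard s t ys y w" for y w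
  proof -
    have yp: "young_path y s t" using y by (simp add: good_def)
    note yD = young_pathD[OF yp]
    have S1: "pvar_seminorm y p u v \<le> 1" if "s \<le> u" "u \<le> v" "v \<le> t" for u v
      using pcontrol_mono[OF pcontrol_pvar_seminorm[OF yD(5) p1(2)] p1(1), of s u v t] y that
      by (simp add: good_def)
    have yR: "norm (y r) \<le> R + 1" if r: "s \<le> r" "r \<le> t" for r
      using young_path_norm_le(1)[OF yp r] S1[of s r] r y R by (simp add: good_def)
    have inc: "norm (w v - w u) \<le> P * (v - u) + Q * X u v" if uv: "s \<le> u" "u \<le> v" "v \<le> t" for u v
    proof -
      have "integral {u..v} (\<lambda>r. L * norm (y r) + norm (f 0)) \<le> integral {u..v} (\<lambda>r. P)"
      proof (rule integral_le)
        show "(\<lambda>r. L * norm (y r) + norm (f 0)) integrable_on {u..v}"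
          using uv by (intro integrable_continuous_interval continuous_intros continuous_on_subset[OF yD(4)]) auto
        fix r assume "r \<in> {u..v}"
        then show "L * norm (y r) + norm (f 0) \<le> P"
          using yR[of r] uv Lpos by (simp add: P_def)
      qed (rule integrable_const_ivl)
      then have 1: "integral {u..v} (\<lambda>r. L * norm (y r) + norm (f 0)) \<le> P * (v - u)"
        using uv by (simp add: mult.commute)
      have "pvar_seminorm y p u v * X u v \<le> 1 * X u v"
        using S1[OF uv] by (intro mult_right_mono) (auto simp: pvar_seminorm_nonneg)
      then have 2: "C_g * K * (pvar_seminorm y p u v * X u v) \<le> C_g * K * X u v"
        using g_lip K_pos by (intro mult_left_mono) auto
      show ?thesis
        using picard_increment_bound[OF yp w yR uv] 1 2 by (simp add: Q_def algebra_simps)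
    qed
    note pc = affine_pcontrol[OF st(1,3) PQ]
    have "finite_pvar w p s t" by (rule pvar_seminorm_le_pcontrol(1)[OF p1(1) st(2) pc inc])
    moreover have "continuous_on {s..t} w" by (rule continuous_of_modulus[OF st(1,3) PQ inc])
    moreover have "pvar_seminorm w p s t \<le> 1"
      using pvar_seminorm_le_pcontrol(2)[OF p1(1) st(2) pc inc] small2 by (simp add: P_def Q_def)
    moreover have "w s = ys" by (rule picard_increments[OF yp w])
    ultimately show ?thesis using st by (simp add: good_def young_path_def)
  qed
  have contract: "pvar_seminorm (\<lambda>r. w1 r - w2 r) p s t \<le> 1 / 2 * pvar_seminorm (\<lambda>r. y1 r - y2 r) p s t"
    if "good y1" "good y2" "picard s t ys y1 w1" "picard s t ys y2 w2" for y1 y2 w1 w2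
  proof -
    have "pvar_seminorm (\<lambda>r. w1 r - w2 r) p s t \<le>
      (L * (t - s) + (1 + K) * (C1 + C2 * 1) * X s t) * pvar_seminorm (\<lambda>r. y1 r - y2 r) p s t"
      using that by (intro picard_contraction[where ys = ys]) (auto simp: good_def)
    also have "\<dots> \<le> 1 / 2 * pvar_seminorm (\<lambda>r. y1 r - y2 r) p s t"
      using small1 by (intro mult_right_mono) (auto simp: pvar_seminorm_nonneg)
    finally show ?thesis .
  qed
  \<comment> \<open>Since \<open>picard\<close> is a relation, the iterates are selected by
    dependent choice.\<close>
  have "\<exists>Y. \<forall>n. good (Y n) \<and> picard s t ys (Y n) (Y (Suc n))"
  proof (rule dependent_nat_choice)
    show "\<exists>y. good y" using good_const by blast
    fix y :: "real \<Rightarrow> real^'d" and n :: nat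
    assume y: "good y"
    then have "young_path y s t" by (simp add: good_def)
    then obtain w where "picard s t ys y w" by (rule picard_exists)
    with good_step[OF y] show "\<exists>w. good w \<and> picard s t ys y w" by blast
  qed
  then obtain Y where Y: "\<And>n. good (Y n)" "\<And>n. picard s t ys (Y n) (Y (Suc n))" by blast
  have Yp: "young_path (Y n) s t" "Y n s = ys" for n using Y(1)[of n] by (auto simp: good_def)
  have diff_fin: "finite_pvar (\<lambda>r. y r - z r) p s t" if "good y" "good z" for y z
    using that st p1 by (intro finite_pvar_diff(1)) (auto simp: good_def young_path_def)
  have diff_le: "norm (y r - z r) \<le> pvar_seminorm (\<lambda>r. y r - z r) p s t"
    if yz: "good y" "good z" and r: "s \<le> r" "r \<le> t" for y z r
  proof -
    have "norm ((y r - z r) - (y s - z s)) \<le> pvar_seminorm (\<lambda>r. y r - z r) p s r"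
      by (rule increment_le_pvar_seminorm[OF diff_fin[OF yz] order_refl r p1(2)])
    also have "\<dots> \<le> pvar_seminorm (\<lambda>r. y r - z r) p s t"
      using r by (intro pcontrol_mono[OF pcontrol_pvar_seminorm[OF diff_fin[OF yz] p1(2)] p1(1)]) auto
    finally show ?thesis using yz by (simp add: good_def)
  qed
  \<comment> \<open>The 2 comes from two seminorms of at most 1 at the start. Uniformity in
    \<open>k\<close> gives the Cauchy property without summing a series.\<close>
  have geom: "pvar_seminorm (\<lambda>r. Y (n + k) r - Y n r) p s t \<le> 2 * (1 / 2) ^ n" for n k
  proof (induction n)
    case 0
    have "pvar_seminorm (\<lambda>r. Y k r - Y 0 r) p s t \<le> pvar_seminorm (Y k) p s t + pvar_seminorm (Y 0) p s t"
      using st p1 young_pathD(5)[OF Yp(1)] by (intro finite_pvar_diff(2)) auto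
    then show ?case using Y(1)[of k] Y(1)[of 0] by (simp add: good_def)
  next
    case (Suc n)
    have "pvar_seminorm (\<lambda>r. Y (Suc (n + k)) r - Y (Suc n) r) p s t \<le> 1 / 2 * pvar_seminorm (\<lambda>r. Y (n + k) r - Y n r) p s t"
      by (rule contract[OF Y(1) Y(1) Y(2) Y(2)])
    then show ?case using Suc by simp
  qed
  have zero: "(\<lambda>n. 2 * (1 / 2 :: real) ^ n) \<longlonglongrightarrow> 0"
    using tendsto_mult[OF tendsto_const LIMSEQ_realpow_zero[of "1 / 2"], of 2] by simp
  have "\<exists>l. (\<lambda>n. Y n r) \<longlonglongrightarrow> l" if r: "s \<le> r" "r \<le> t" for r
  proof -
    have "Cauchy (\<lambda>n. Y n r)"
    proof (rule metric_CauchyI)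
      fix \<epsilon> :: real assume "0 < \<epsilon>"
      then obtain N where N: "2 * (1 / 2) ^ N < \<epsilon> / 2"
        using order_tendstoD(2)[OF zero, of "\<epsilon> / 2"] by (auto simp: eventually_sequentially)
      have *: "dist (Y m r) (Y N r) < \<epsilon> / 2" if "N \<le> m" for m
        using diff_le[OF Y(1) Y(1) r, of m N] geom[of N "m - N"] that N by (simp add: dist_norm)
      show "\<exists>M. \<forall>m\<ge>M. \<forall>n\<ge>M. dist (Y m r) (Y n r) < \<epsilon>"
        using * by (intro exI[of _ N]) (metis dist_triangle_half_l dist_commute)
    qed
    then show ?thesis using Cauchy_convergent convergent_def by blast
  qed
  then obtain y where y: "\<And>r. s \<le> r \<Longrightarrow> r \<le> t \<Longrightarrow> (\<lambda>n. Y n r) \<longlonglongrightarrow> y r" by metis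
  \<comment> \<open>Lower semicontinuity upgrades pointwise convergence to convergence in the
    p-variation seminorm.\<close>
  have lim_diff: "pvar_seminorm (\<lambda>r. y r - Y n r) p s t \<le> 2 * (1 / 2) ^ n" for n
  proof (rule pvar_seminorm_limit(2)[OF p1(2) st(2)])
    show "(\<lambda>k. Y (n + k) r - Y n r) \<longlonglongrightarrow> y r - Y n r" if "s \<le> r" "r \<le> t" for r
      using LIMSEQ_ignore_initial_segment[OF y[OF that], of n]
      by (intro tendsto_diff tendsto_const) (simp add: add.commute)
  qed (use geom diff_fin[OF Y(1) Y(1)] in auto)
  have y_fin: "finite_pvar y p s t" "pvar_seminorm y p s t \<le> 1"
    using pvar_seminorm_limit[OF p1(2) st(2), of 1 Y y] y Y(1) young_pathD(5)[OF Yp(1)]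
    by (auto simp: good_def)
  have ys: "y s = ys"
    using LIMSEQ_unique[OF y[OF order_refl st(2)], of ys] Yp(2) by simp
  have sup: "norm (y r - Y n r) \<le> 2 * (1 / 2) ^ n" if r: "s \<le> r" "r \<le> t" for r n
  proof (rule LIMSEQ_le_const2)
    show "(\<lambda>k. norm (Y k r - Y n r)) \<longlonglongrightarrow> norm (y r - Y n r)"
      by (intro tendsto_norm tendsto_diff y r tendsto_const)
    have "norm (Y k r - Y n r) \<le> 2 * (1 / 2) ^ n" if "n \<le> k" for k
      using diff_le[OF Y(1) Y(1) r, of k n] geom[of n "k - n"] that by simp
    then show "\<exists>N. \<forall>k\<ge>N. norm (Y k r - Y n r) \<le> 2 * (1 / 2) ^ n" by blast
  qed
  have "continuous_on {s..t} y"
  proof (rule uniform_limit_theorem)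
    show "\<forall>\<^sub>F n in sequentially. continuous_on {s..t} (Y n)"
      using young_pathD(4)[OF Yp(1)] by simp
    show "uniform_limit {s..t} Y y sequentially"
      unfolding uniform_limit_iff
    proof (intro allI impI)
      fix e :: real assume "0 < e"
      from order_tendstoD(2)[OF zero this]
      show "\<forall>\<^sub>F n in sequentially. \<forall>r\<in>{s..t}. dist (Y n r) (y r) < e"
      proof eventually_elim
        case (elim n)
        show ?case
          using le_less_trans[OF sup elim] by (simp add: dist_norm norm_minus_commute)
      qed
    qed
  qed simp
  then have gy: "good y" using y_fin ys st by (simp add: good_def young_path_def)
  then obtain w where w: "picard s t ys y w"
    using picard_exists by (metis good_def)
  have gw: "good w" by (rule good_step[OF gy w])
  \<comment> \<open>The iterates converge to \<open>y\<close>, and by contraction the shifted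
    iterates converge to its Picard image \<open>w\<close>; hence \<open>y\<close> is a fixed
    point.\<close>
  have "w r = y r" if r: "s \<le> r" "r \<le> t" for r
  proof (rule LIMSEQ_unique)
    have "norm (Y (Suc n) r - w r) \<le> 2 * (1 / 2) ^ n" for n
    proof -
      have "norm (w r - Y (Suc n) r) \<le> pvar_seminorm (\<lambda>r. w r - Y (Suc n) r) p s t"
        by (rule diff_le[OF gw Y(1) r])
      also have "\<dots> \<le> 1 / 2 * pvar_seminorm (\<lambda>r. y r - Y n r) p s t"
        by (rule contract[OF gy Y(1) w Y(2)])
      also have "\<dots> \<le> 2 * (1 / 2) ^ n"
        using lim_diff[of n] pvar_seminorm_nonneg[of "\<lambda>r. y r - Y n r" p s t] by simp
      finally show ?thesis by (simp add: norm_minus_commute)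
    qed
    then have "(\<lambda>n. Y (Suc n) r - w r) \<longlonglongrightarrow> 0"
      by (intro Lim_null_comparison[OF _ zero]) auto
    then show "(\<lambda>n. Y (Suc n) r) \<longlonglongrightarrow> w r" by (rule LIM_zero_cancel)
    show "(\<lambda>n. Y (Suc n) r) \<longlonglongrightarrow> y r"
      using LIMSEQ_Suc[OF y[OF r]] .
  qed
  then have "picard s t ys y y" using w by (auto simp: picard_def)
  then show ?thesis using gy by (auto simp: good_def)
qed

text \<open>Continuity and finite p-variation survive concatenation by the triangle inequality; the
  equation is then checked on each piece.\<close>

lemma picard_glue:
  assumes y1: "young_path y1 a c" "picard a c ya y1 y1" and y2: "young_path y2 c d" "picard c d (y1 c) y2 y2"
  shows "\<exists>y. young_path y a d \<and> picard a d ya y y"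
proof -
  note y1D = young_pathD[OF y1(1)] and y2D = young_pathD[OF y2(1)]
  define y where "y r = (if r \<le> c then y1 r else y2 r)" for r
  have "y2 c = y1 c" by (rule picard_increments[OF y2])
  then have e1: "r \<le> c \<Longrightarrow> y r = y1 r" and e2: "c \<le> r \<Longrightarrow> y r = y2 r" for r
    by (auto simp: y_def)
  have ac: "{a..d} = {a..c} \<union> {c..d}" using y1D y2D by auto
  have "continuous_on {a..c} y" "continuous_on {c..d} y"
    using y1D(4) y2D(4) continuous_on_cong[OF refl, of "{a..c}" y y1]
      continuous_on_cong[OF refl, of "{c..d}" y y2] e1 e2 by auto
  then have "continuous_on {a..d} y" unfolding ac by (intro continuous_on_closed_Un) auto
  moreover have "finite_pvar y p a d"
  proof (rule pvar_seminorm_triangle(1)[OF p1(1) y1D(2) y2D(2)])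
    show "finite_pvar y p a c" using y1D(5) e1 finite_pvar_cong[of a c y y1] by auto
    show "finite_pvar y p c d" using y2D(5) e2 finite_pvar_cong[of c d y y2] by auto
  qed
  ultimately have y: "young_path y a d" using y1D y2D by (simp add: young_path_def)
  \<comment> \<open>The integral of the glued path is built on the whole interval, since a fine
    partition need not contain \<open>c\<close> and integrals over the pieces cannot simply be
    added. Uniqueness identifies each piece with an increment of \<open>F\<close>.\<close>
  obtain F where F: "\<And>u v. a \<le> u \<Longrightarrow> u \<le> v \<Longrightarrow> v \<le> d \<Longrightarrow> has_young_integral (\<lambda>r. g (y r)) x u v (F v - F u)"
    by (rule young_integral_g[OF y]) (rule that)
  have int: "(\<lambda>r. drift (y r)) integrable_on {a..r}" if "r \<le> d" for r
    using that young_pathD(4)[OF y]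
    by (intro integrable_continuous_interval drift_cont) (auto intro: continuous_on_subset)
  have first: "y r = ya + integral {a..r} (\<lambda>v. drift (y v)) + (F r - F a)" if r: "a \<le> r" "r \<le> c" for r
  proof -
    obtain I where I: "has_young_integral (\<lambda>v. g (y1 v)) x a r I" "y1 r = ya + integral {a..r} (\<lambda>v. drift (y1 v)) + I"
      using y1(2) r unfolding picard_def by force
    have "has_young_integral (\<lambda>v. g (y v)) x a r I"
      using I(1) e1 r has_young_integral_cong[of a r "\<lambda>v. g (y v)" "\<lambda>v. g (y1 v)" x I] by auto
    then have "I = F r - F a" using has_young_integral_unique[OF _ F[of a r]] r y2D by auto
    moreover have "integral {a..r} (\<lambda>v. drift (y1 v)) = integral {a..r} (\<lambda>v. drift (y v))"
      using e1 r by (intro Henstock_Kurzweil_Integration.integral_cong) auto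
    ultimately show ?thesis using I(2) e1[of r] r by simp
  qed
  have second: "y r = ya + integral {a..r} (\<lambda>v. drift (y v)) + (F r - F a)" if r: "c \<le> r" "r \<le> d" for r
  proof -
    obtain I where I: "has_young_integral (\<lambda>v. g (y2 v)) x c r I" "y2 r = y1 c + integral {c..r} (\<lambda>v. drift (y2 v)) + I"
      using y2(2) r unfolding picard_def by force
    have "has_young_integral (\<lambda>v. g (y v)) x c r I"
      using I(1) e2 r has_young_integral_cong[of c r "\<lambda>v. g (y v)" "\<lambda>v. g (y2 v)" x I] by auto
    then have "I = F r - F c" using has_young_integral_unique[OF _ F[of c r]] r y1D by auto
    moreover have "integral {c..r} (\<lambda>v. drift (y2 v)) = integral {c..r} (\<lambda>v. drift (y v))"
      using e2 r by (intro Henstock_Kurzweil_Integration.integral_cong) auto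
    moreover have "integral {a..c} (\<lambda>v. drift (y v)) + integral {c..r} (\<lambda>v. drift (y v)) = integral {a..r} (\<lambda>v. drift (y v))"
      using r y1D(2) int[of r] by (intro Henstock_Kurzweil_Integration.integral_combine) auto
    ultimately show ?thesis using I(2) e2[of r] r first[of c] e1[of c] y1D(2)
      by (simp add: add.assoc)
  qed
  have "picard a d ya y y"
    unfolding picard_def
  proof
    fix r assume "r \<in> {a..d}"
    then have ar: "a \<le> r" "r \<le> d" by auto
    show "\<exists>I. has_young_integral (\<lambda>v. g (y v)) x a r I \<and> y r = ya + integral {a..r} (\<lambda>v. drift (y v)) + I"
      using F[OF order_refl ar] linear[of r c] first[OF ar(1)] second[OF _ ar(2)] by blast
  qed
  with y show ?thesis by blast
qed

lemma solution_exists: "\<exists>y. young_path y a b \<and> picard a b ya y y"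
proof -
  define N where "N = real (greedy_N x p \<gamma> a b)"
  \<comment> \<open>The a priori bound at any time a partial solution reaches: all restarts obey it,
    so one step length \<open>h\<close> works for all of them.\<close>
  define R where "R = (norm ya + M0 * N) * exp (\<alpha> * N + 2 * L * (b - a))"
  have R_nn: "0 \<le> R" using M0_nonneg by (simp add: R_def N_def)
  have "0 \<le> (1 + K) * (C1 + C2 * 1)" using K_pos C1_nonneg C2(1) by simp
  then obtain h1 where h1: "0 < h1" "\<And>s t. a \<le> s \<Longrightarrow> s \<le> t \<Longrightarrow> t \<le> b \<Longrightarrow> t - s < h1 \<Longrightarrow>
      L * (t - s) + (1 + K) * (C1 + C2 * 1) * X s t \<le> 1 / 2"
    using small_step[of L "(1 + K) * (C1 + C2 * 1)" "1 / 2"] Lpos by (metis half_gt_zero less_imp_le zero_less_one)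
  have "0 \<le> L * (R + 1) + norm (f 0)" "0 \<le> opnorm (g 0) + C_g * (R + 1) + C_g * K"
    using Lpos R_nn K_pos g_lip opnorm_nonneg[of "g 0"] by auto
  then obtain h2 where h2: "0 < h2" "\<And>s t. a \<le> s \<Longrightarrow> s \<le> t \<Longrightarrow> t \<le> b \<Longrightarrow> t - s < h2 \<Longrightarrow>
      (L * (R + 1) + norm (f 0)) * (t - s) + (opnorm (g 0) + C_g * (R + 1) + C_g * K) * X s t \<le> 1"
    using small_step[of "L * (R + 1) + norm (f 0)" "opnorm (g 0) + C_g * (R + 1) + C_g * K" 1]
    by (metis zero_less_one)
  define h where "h = min h1 h2 / 2"
  have h: "0 < h" "h < h1" "h < h2" using h1(1) h2(1) by (auto simp: h_def)
  have ext: "\<exists>y. young_path y s t \<and> picard s t ys y y"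
    if "a \<le> s" "s \<le> t" "t \<le> b" "t - s \<le> h" "norm ys \<le> R" for s t ys
    using that h h1(2)[of s t] h2(2)[of s t] by (intro local_existence[of s t ys R]) auto
  have "\<exists>y. young_path y a (min b (a + real n * h)) \<and> picard a (min b (a + real n * h)) ya y y" for n
  proof (induction n)
    case 0
    \<comment> \<open>The first step also needs an initial value of size at most \<open>R\<close>;
      this holds since the exponent is nonnegative.\<close>
    have "norm ya * 1 \<le> (norm ya + M0 * N) * exp (\<alpha> * N + 2 * L * (b - a))"
      using M0_nonneg alpha_nonneg Lpos ab by (intro mult_mono) (auto simp: N_def)
    then show ?case using ext[of a a ya] h ab by (simp add: R_def)
  next
    case (Suc n)
    define s where "s = min b (a + real n * h)"
    define t where "t = min b (a + real (Suc n) * h)"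
    have e: "a + real (Suc n) * h = a + real n * h + h" by (simp add: algebra_simps)
    have n: "0 \<le> real n * h" using h(1) by simp
    have st: "a \<le> s" "s \<le> t" "t \<le> b" "t - s \<le> h"
      unfolding s_def t_def e using h(1) ab n by (auto simp: min_def)
    obtain y where y: "young_path y a s" "picard a s ya y y"
      using Suc unfolding s_def by blast
    have "norm (y s) \<le> norm (y a) + pvar_seminorm y p a s"
      by (rule young_path_norm_le(1)[OF y(1)]) (use st in auto)
    also have "\<dots> \<le> R" unfolding R_def N_def by (rule a_priori_bound[OF y])
    finally obtain y' where "young_path y' s t" "picard s t (y s) y' y'"
      using ext[OF st] by blast
    then show ?case using picard_glue[OF y] unfolding t_def by blast
  qed
  moreover obtain n where "(b - a) / h < real n" using reals_Archimedean2 by blast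
  then have "min b (a + real n * h) = b" using h(1) by (simp add: field_simps)
  ultimately show ?thesis by metis
qed

end

theorem theorem2p3:
  fixes A :: "real^'d^'d" and f :: "real^'d \<Rightarrow> real^'d" and g :: "real^'d \<Rightarrow> real^'m^'d"
    and x :: "real \<Rightarrow> real^'m" and p a b C_f C_g :: real and ya :: "real^'d"
  assumes p: "1 < p" "p < 2"
    and f_lip: "0 \<le> C_f" "\<forall>u v. norm (f u - f v) \<le> C_f * norm (u - v)"
    and g_lip: "0 < C_g" "\<forall>u v. opnorm (g u - g v) \<le> C_g * norm (u - v)"
    and g_C1: "\<exists>Dg. (\<forall>u. (g has_derivative Dg u) (at u)) \<and>
                 (\<exists>C. \<forall>u v. onorm (\<lambda>h. Dg u h - Dg v h) \<le> C * norm (u - v))"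
    and L_pos: "0 < opnorm A + C_f"
    and x_cont: "continuous_on {a..b} x" and x_pvar: "finite_pvar x p a b"
    and ab: "0 \<le> a" "a < b"
  shows
    "let L = opnorm A + C_f;
         K = 1 / (1 - 2 powr (1 - 2 / p));
         \<alpha> = ln (1 + 1 / (K + 1));
         M0 = norm (f 0) / L + opnorm (g 0) / ((K + 1) * C_g);
         \<gamma> = 1 / (2 * (K + 1) * C_g);
         N = real (greedy_N x p \<gamma> a b);
         B = (norm ya + M0 * N) * exp (\<alpha> * N + 2 * L * (b - a))
     in (\<exists>y. is_solution A f g x p a b ya y)
      \<and> (\<forall>y1 y2. is_solution A f g x p a b ya y1 \<and> is_solution A f g x p a b ya y2
                 \<longrightarrow> (\<forall>t\<in>{a..b}. y1 t = y2 t))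
      \<and> (\<forall>y. is_solution A f g x p a b ya y \<longrightarrow>
             sup_norm y a b \<le> B \<and> pvar_norm y p a b \<le> B * N powr ((p - 1) / p))"
proof -
  interpret E: young_ode A f g x p a b C_f C_g
    using assms by unfold_locales
  interpret G: greedy x p E.\<gamma> a b
    using assms E.gamma_pos by unfold_locales auto
  have iff: "is_solution A f g x p a b ya y \<longleftrightarrow> E.young_path y a b \<and> E.picard a b ya y y" for y
    using ab by (intro E.is_solution_iff) auto
  define N where "N = real (greedy_N x p E.\<gamma> a b)"
  define B where "B = (norm ya + E.M0 * N) * exp (E.\<alpha> * N + 2 * E.L * (b - a))"
  have N: "1 \<le> N" using G.greedy_N(1) by (simp add: N_def)
  then have N1: "1 \<le> N powr ((p - 1) / p)" using p by (intro ge_one_powr_ge_zero) auto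
  have bounds: "sup_norm y a b \<le> B" "pvar_norm y p a b \<le> B * N powr ((p - 1) / p)"
    if y: "E.young_path y a b" "E.picard a b ya y y" for y
  proof -
    have B: "norm (y a) + pvar_seminorm y p a b \<le> B"
      unfolding B_def N_def by (rule E.a_priori_bound[OF y])
    have "norm (y t) \<le> B" if "t \<in> {a..b}" for t
      using E.young_path_norm_le[OF y(1), of t] that B by auto
    then show "sup_norm y a b \<le> B"
      unfolding sup_norm_def using ab by (intro cSUP_least) auto
    have "0 \<le> B" using B norm_ge_zero[of "y a"] pvar_seminorm_nonneg[of y p a b] by linarith
    then have "B * 1 \<le> B * N powr ((p - 1) / p)" using N1 by (intro mult_left_mono)
    then show "pvar_norm y p a b \<le> B * N powr ((p - 1) / p)"
      unfolding pvar_norm_def using B by simp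
  qed
  have "(\<exists>y. is_solution A f g x p a b ya y)
      \<and> (\<forall>y1 y2. is_solution A f g x p a b ya y1 \<and> is_solution A f g x p a b ya y2
                 \<longrightarrow> (\<forall>t\<in>{a..b}. y1 t = y2 t))
      \<and> (\<forall>y. is_solution A f g x p a b ya y \<longrightarrow>
             sup_norm y a b \<le> B \<and> pvar_norm y p a b \<le> B * N powr ((p - 1) / p))"
    unfolding iff using E.solution_exists E.solution_unique bounds by blast
  then show ?thesis
    unfolding Let_def B_def N_def E.M0_def E.\<gamma>_def E.\<alpha>_def E.K_def E.L_def young_const_def .
qed

end
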